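(* Let $(A,\lambda_A)$ be a $\lambda$-ring. There exists, up to unique isomorphism, a unique adjunction $(F^{\lambda},G^{\lambda},\epsilon^{\lambda},\eta^{\lambda})$ from the category $(\mathscr{A}_{\lambda}/(A,\lambda_A))_{\mathrm{ab}}$ of abelian group objects in $\lambda$-rings over $(A,\lambda_A)$ to the category $\mathscr{M}(A,\lambda_A)$ of $(A,\lambda_A)$-modules (with $F^\lambda$ the left adjoint functor) such that the square of left adjoint functors $$U'\circ F^{\lambda}=F\circ U_{(A,\lambda_A)}\colon(\mathscr{A}_{\lambda}/(A,\lambda_A))_{\mathrm{ab}}\to\mathscr{M}(A)$$ commutes. Moreover, the adjunction $(F^{\lambda},G^{\lambda},\epsilon^{\lambda},\eta^{\lambda})$ is an adjoint equivalence of categories.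
   Context: Rings are commutative and unital; $\mathbb{N}$ is the set of positive integers. $\mathbb{W}(A)$ is the set $A^{\mathbb{N}}$ with the unique ring structure, functorial in $A$, for which all ghost maps $w_n(a)=\sum_{e\mid n}ea_e^{n/e}$ are natural ring homomorphisms. $F_n\colon\mathbb{W}(A)\to\mathbb{W}(A)$ is the natural ring homomorphism with $w_e\circ F_n=w_{ne}$; $\Delta_A\colon\mathbb{W}(A)\to\mathbb{W}(\mathbb{W}(A))$ is the unique natural ring homomorphism with $w_n\circ\Delta_A=F_n$; $\epsilon_A=w_1$. A $\lambda$-ring is a pair $(A,\lambda_A)$ with $\lambda_A\colon A\to\mathbb{W}(A)$ a ring homomorphism such that $\epsilon_A\lambda_A=\mathrm{id}$ and $\mathbb{W}(\lambda_A)\lambda_A=\Delta_A\lambda_A$; a morphism $f\colon(A,\lambda_A)\to(B,\lambda_B)$ is a ring homomorphism with $\lambda_Bf=\mathbb{W}(f)\lambda_A$. Adams operations: $\psi_{A,n}=w_n\circ\lambda_A$. An $(A,\lambda_A)$-module is a pair $(M,\lambda_M)$ of an $A$-module $M$ and additive maps $\lambda_{M,n}\colon M\to M$, $n\in\mathbb{N}$, with $\lambda_{M,n}(ax)=\psi_{A,n}(a)\lambda_{M,n}(x)$, $\lambda_{M,1}=\mathrm{id}$, $\lambda_{M,m}\lambda_{M,n}=\lambda_{M,mn}$; morphisms are $A$-linear maps commuting with the $\lambda_{M,n}$. $\mathscr{A}$ and $\mathscr{A}_\lambda$ are the categories of rings and $\lambda$-rings; $\mathscr{M}(A)$ is the category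 of $A$-modules; $(-)_{\mathrm{ab}}$ denotes the category of abelian group objects. An adjunction from $\mathscr{C}$ to $\mathscr{D}$ is a quadruple (left adjoint $\mathscr{C}\to\mathscr{D}$, right adjoint $\mathscr{D}\to\mathscr{C}$, counit, unit) satisfying the triangle identities; it is an adjoint equivalence if counit and unit are isomorphisms. The functor $F\colon(\mathscr{A}/A)_{\mathrm{ab}}\to\mathscr{M}(A)$ (an equivalence, with adjoint quasi-inverse $G(M)=(A\ltimes M\to A)$) sends $(f\colon B\to A,+_B,0_B,-_B)$ to $\ker f$ with $A$-module structure $a\cdot x=0_B(a)x$. The functor $U_{(A,\lambda_A)}\colon(\mathscr{A}_\lambda/(A,\lambda_A))_{\mathrm{ab}}\to(\mathscr{A}/A)_{\mathrm{ab}}$ forgets the $\lambda$-ring structures; it has a right adjoint $R_{(A,\lambda_A)}$ sending $B\to A$ to the pullback of $\mathbb{W}(B)\to\mathbb{W}(A)$ along $\lambda_A\colon A\to\mathbb{W}(A)$. The functor $U'\colon\mathscr{M}(A,\lambda_A)\to\mathscr{M}(A)$, $(M,\lambda_M)\mapsto M$, has right adjoint $R'$ sending $N$ to $N^{\mathbb{N}}$ with componentwise addition, $(ax)_n=\psi_{A,n}(a)x_n$, and $\lambda_m(x)_e=x_{me}$.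
   Formalization: Uniqueness is false as stated (twist the maps λ_{M,n} by a multiplicative sign; −1 is an automorphism), so the square must also respect the units of (U,R) and (U',R'), i.e. λ_{M,n} on ker f are the Witt coordinates of λ_B, and isomorphisms must induce the identity on F∘U. *)

theory Defs
  imports "HOL-Algebra.Algebra"
begin

section \<open>Categories, functors and adjunctions\<close>

(* Hom-sets are indexed by pairs of objects and are not required to be disjoint, so identities,
   composition and the arrow part of a functor take the objects in question as arguments. *)

record ('o, 'm) cat =
  Obj :: "'o set"
  Hom :: "'o \<Rightarrow> 'o \<Rightarrow> 'm set"
  Ident :: "'o \<Rightarrow> 'm"
  Comp :: "'o \<Rightarrow> 'o \<Rightarrow> 'o \<Rightarrow> 'm \<Rightarrow> 'm \<Rightarrow> 'm"  \<comment> \<open>\<open>Comp C x y z g f\<close> is \<open>g\<close> after \<open>f\<close>, for \<open>f : x \<rightarrow> y\<close> and \<open>g : y \<rightarrow> z\<close>\<close>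

definition category :: "('o, 'm) cat \<Rightarrow> bool" where
  "category C \<longleftrightarrow>
     (\<forall>x\<in>Obj C. Ident C x \<in> Hom C x x) \<and>
     (\<forall>x\<in>Obj C. \<forall>y\<in>Obj C. \<forall>z\<in>Obj C. \<forall>f\<in>Hom C x y. \<forall>g\<in>Hom C y z.
        Comp C x y z g f \<in> Hom C x z) \<and>
     (\<forall>x\<in>Obj C. \<forall>y\<in>Obj C. \<forall>f\<in>Hom C x y.
        Comp C x y y (Ident C y) f = f \<and> Comp C x x y f (Ident C x) = f) \<and>
     (\<forall>w\<in>Obj C. \<forall>x\<in>Obj C. \<forall>y\<in>Obj C. \<forall>z\<in>Obj C.
        \<forall>f\<in>Hom C w x. \<forall>g\<in>Hom C x y. \<forall>h\<in>Hom C y z.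
        Comp C w x z (Comp C x y z h g) f = Comp C w y z h (Comp C w x y g f))"

definition is_iso :: "('o, 'm) cat \<Rightarrow> 'o \<Rightarrow> 'o \<Rightarrow> 'm \<Rightarrow> bool" where
  "is_iso C x y f \<longleftrightarrow> f \<in> Hom C x y \<and>
     (\<exists>g\<in>Hom C y x. Comp C x y x g f = Ident C x \<and> Comp C y x y f g = Ident C y)"

record ('o, 'm, 'p, 'n) cfunctor =
  ob :: "'o \<Rightarrow> 'p"
  ar :: "'o \<Rightarrow> 'o \<Rightarrow> 'm \<Rightarrow> 'n"

definition is_functor :: "('o, 'm) cat \<Rightarrow> ('p, 'n) cat \<Rightarrow> ('o, 'm, 'p, 'n) cfunctor \<Rightarrow> bool" where
  "is_functor C D F \<longleftrightarrow> category C \<and> category D \<and>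
     (\<forall>x\<in>Obj C. ob F x \<in> Obj D) \<and>
     (\<forall>x\<in>Obj C. \<forall>y\<in>Obj C. \<forall>f\<in>Hom C x y. ar F x y f \<in> Hom D (ob F x) (ob F y)) \<and>
     (\<forall>x\<in>Obj C. ar F x x (Ident C x) = Ident D (ob F x)) \<and>
     (\<forall>x\<in>Obj C. \<forall>y\<in>Obj C. \<forall>z\<in>Obj C. \<forall>f\<in>Hom C x y. \<forall>g\<in>Hom C y z.
        ar F x z (Comp C x y z g f) =
        Comp D (ob F x) (ob F y) (ob F z) (ar F y z g) (ar F x y f))"

definition id_functor :: "('o, 'm, 'o, 'm) cfunctor" where
  "id_functor = \<lparr>ob = \<lambda>x. x, ar = \<lambda>x y f. f\<rparr>"

definition comp_functor ::
  "('p, 'n, 'q, 'k) cfunctor \<Rightarrow> ('o, 'm, 'p, 'n) cfunctor \<Rightarrow> ('o, 'm, 'q, 'k) cfunctor"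
  (infixr \<open>\<circ>\<^sub>F\<close> 55) where
  "G \<circ>\<^sub>F F = \<lparr>ob = \<lambda>x. ob G (ob F x), ar = \<lambda>x y f. ar G (ob F x) (ob F y) (ar F x y f)\<rparr>"

definition functors_equal ::
  "('o, 'm) cat \<Rightarrow> ('o, 'm, 'p, 'n) cfunctor \<Rightarrow> ('o, 'm, 'p, 'n) cfunctor \<Rightarrow> bool" where
  "functors_equal C F G \<longleftrightarrow> (\<forall>x\<in>Obj C. ob F x = ob G x) \<and>
     (\<forall>x\<in>Obj C. \<forall>y\<in>Obj C. \<forall>f\<in>Hom C x y. ar F x y f = ar G x y f)"

(* Families of components are extensional on the objects of the source category, so that equality
   of families is equality of natural transformations. *)
definition nat_trans :: "('o, 'm) cat \<Rightarrow> ('p, 'n) cat \<Rightarrow>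
    ('o, 'm, 'p, 'n) cfunctor \<Rightarrow> ('o, 'm, 'p, 'n) cfunctor \<Rightarrow> ('o \<Rightarrow> 'n) \<Rightarrow> bool" where
  "nat_trans C D F G t \<longleftrightarrow> t \<in> extensional (Obj C) \<and>
     (\<forall>x\<in>Obj C. t x \<in> Hom D (ob F x) (ob G x)) \<and>
     (\<forall>x\<in>Obj C. \<forall>y\<in>Obj C. \<forall>f\<in>Hom C x y.
        Comp D (ob F x) (ob F y) (ob G y) (t y) (ar F x y f) =
        Comp D (ob F x) (ob G x) (ob G y) (ar G x y f) (t x))"

definition nat_iso :: "('o, 'm) cat \<Rightarrow> ('p, 'n) cat \<Rightarrow>
    ('o, 'm, 'p, 'n) cfunctor \<Rightarrow> ('o, 'm, 'p, 'n) cfunctor \<Rightarrow> ('o \<Rightarrow> 'n) \<Rightarrow> bool" where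
  "nat_iso C D F G t \<longleftrightarrow> nat_trans C D F G t \<and> (\<forall>x\<in>Obj C. is_iso D (ob F x) (ob G x) (t x))"

record ('o, 'm, 'p, 'n) adj =
  ladj :: "('o, 'm, 'p, 'n) cfunctor"
  radj :: "('p, 'n, 'o, 'm) cfunctor"
  adj_counit :: "'p \<Rightarrow> 'n"
  adj_unit :: "'o \<Rightarrow> 'm"

definition is_adjunction :: "('o, 'm) cat \<Rightarrow> ('p, 'n) cat \<Rightarrow> ('o, 'm, 'p, 'n) adj \<Rightarrow> bool" where
  "is_adjunction C D P \<longleftrightarrow>
     (let F = ladj P; G = radj P; e = adj_counit P; u = adj_unit P in
      is_functor C D F \<and> is_functor D C G \<and>
      nat_trans D D (F \<circ>\<^sub>F G) id_functor e \<and>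
      nat_trans C C id_functor (G \<circ>\<^sub>F F) u \<and>
      (\<forall>x\<in>Obj C. Comp D (ob F x) (ob F (ob G (ob F x))) (ob F x)
          (e (ob F x)) (ar F x (ob G (ob F x)) (u x)) = Ident D (ob F x)) \<and>
      (\<forall>y\<in>Obj D. Comp C (ob G y) (ob G (ob F (ob G y))) (ob G y)
          (ar G (ob F (ob G y)) y (e y)) (u (ob G y)) = Ident C (ob G y)))"

definition is_adjoint_equivalence ::
  "('o, 'm) cat \<Rightarrow> ('p, 'n) cat \<Rightarrow> ('o, 'm, 'p, 'n) adj \<Rightarrow> bool" where
  "is_adjoint_equivalence C D P \<longleftrightarrow> is_adjunction C D P \<and>
     nat_iso D D (ladj P \<circ>\<^sub>F radj P) id_functor (adj_counit P) \<and>
     nat_iso C C id_functor (radj P \<circ>\<^sub>F ladj P) (adj_unit P)"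

(* An isomorphism of adjunctions: natural isomorphisms between the left and between the right
   adjoints which are compatible with the counits and with the units. *)
definition adjunction_iso :: "('o, 'm) cat \<Rightarrow> ('p, 'n) cat \<Rightarrow>
    ('o, 'm, 'p, 'n) adj \<Rightarrow> ('o, 'm, 'p, 'n) adj \<Rightarrow> ('o \<Rightarrow> 'n) \<Rightarrow> ('p \<Rightarrow> 'm) \<Rightarrow> bool" where
  "adjunction_iso C D P Q s t \<longleftrightarrow>
     (let F = ladj P; G = radj P; F' = ladj Q; G' = radj Q in
      nat_iso C D F F' s \<and> nat_iso D C G G' t \<and>
      (\<forall>y\<in>Obj D.
         Comp D (ob F (ob G y)) (ob F' (ob G' y)) y (adj_counit Q y)
           (Comp D (ob F (ob G y)) (ob F (ob G' y)) (ob F' (ob G' y))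
              (s (ob G' y)) (ar F (ob G y) (ob G' y) (t y)))
         = adj_counit P y) \<and>
      (\<forall>x\<in>Obj C.
         Comp C x (ob G (ob F x)) (ob G' (ob F' x))
           (Comp C (ob G (ob F x)) (ob G' (ob F x)) (ob G' (ob F' x))
              (ar G' (ob F x) (ob F' x) (s x)) (t (ob F x)))
           (adj_unit P x)
         = adj_unit Q x))"


section \<open>Big Witt vectors\<close>

(* A Witt vector is a function on nat which is extensional on the positive integers. *)

definition ghost :: "'a ring \<Rightarrow> nat \<Rightarrow> (nat \<Rightarrow> 'a) \<Rightarrow> 'a" where
  "ghost A n a = (\<Oplus>\<^bsub>A\<^esub>e\<in>{e. e dvd n}. add_pow A e (a e [^]\<^bsub>A\<^esub> (n div e)))"

definition witt_map :: "('a \<Rightarrow> 'b) \<Rightarrow> (nat \<Rightarrow> 'a) \<Rightarrow> (nat \<Rightarrow> 'b)" where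
  "witt_map f a = (\<lambda>n\<in>{0<..}. f (a n))"

definition is_witt_structure :: "('a ring \<Rightarrow> (nat \<Rightarrow> 'a) ring) \<Rightarrow> bool" where
  "is_witt_structure S \<longleftrightarrow>
     (\<forall>A. cring A \<longrightarrow> cring (S A) \<and> carrier (S A) = ({0<..} \<rightarrow>\<^sub>E carrier A) \<and>
        (\<forall>n>0. ghost A n \<in> ring_hom (S A) A)) \<and>
     (\<forall>A B f. cring A \<and> cring B \<and> f \<in> ring_hom A B \<longrightarrow> witt_map f \<in> ring_hom (S A) (S B))"

(* Functoriality determines the ring structure on the carrier as soon as the carrier type is
   infinite, because polynomial rings over the integers in countably many variables then occur
   among the rings over which it is natural. The values of the operations outside the carrier and
   on records that are not rings remain arbitrary, hence SOME instead of THE. The same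
   applies to the two definitions that follow. *)
definition Witt :: "'a ring \<Rightarrow> (nat \<Rightarrow> 'a) ring" where
  "Witt = (SOME S. is_witt_structure S)"

definition is_witt_frobenius :: "('a ring \<Rightarrow> nat \<Rightarrow> (nat \<Rightarrow> 'a) \<Rightarrow> (nat \<Rightarrow> 'a)) \<Rightarrow> bool" where
  "is_witt_frobenius \<Phi> \<longleftrightarrow>
     (\<forall>A n. cring A \<and> n > 0 \<longrightarrow> \<Phi> A n \<in> ring_hom (Witt A) (Witt A) \<and>
        (\<forall>e>0. \<forall>a\<in>carrier (Witt A). ghost A e (\<Phi> A n a) = ghost A (n * e) a)) \<and>
     (\<forall>A B f n. cring A \<and> cring B \<and> f \<in> ring_hom A B \<and> n > 0 \<longrightarrow>
        (\<forall>a\<in>carrier (Witt A). witt_map f (\<Phi> A n a) = \<Phi> B n (witt_map f a)))"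

definition witt_frobenius :: "'a ring \<Rightarrow> nat \<Rightarrow> (nat \<Rightarrow> 'a) \<Rightarrow> (nat \<Rightarrow> 'a)" where
  "witt_frobenius = (SOME \<Phi>. is_witt_frobenius \<Phi>)"

definition is_witt_comult :: "('a ring \<Rightarrow> (nat \<Rightarrow> 'a) \<Rightarrow> (nat \<Rightarrow> nat \<Rightarrow> 'a)) \<Rightarrow> bool" where
  "is_witt_comult \<Delta> \<longleftrightarrow>
     (\<forall>A. cring A \<longrightarrow> \<Delta> A \<in> ring_hom (Witt A) (Witt (Witt A)) \<and>
        (\<forall>n>0. \<forall>a\<in>carrier (Witt A). ghost (Witt A) n (\<Delta> A a) = witt_frobenius A n a)) \<and>
     (\<forall>A B f. cring A \<and> cring B \<and> f \<in> ring_hom A B \<longrightarrow>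
        (\<forall>a\<in>carrier (Witt A). witt_map (witt_map f) (\<Delta> A a) = \<Delta> B (witt_map f a)))"

definition witt_comult :: "'a ring \<Rightarrow> (nat \<Rightarrow> 'a) \<Rightarrow> (nat \<Rightarrow> nat \<Rightarrow> 'a)" where
  "witt_comult = (SOME \<Delta>. is_witt_comult \<Delta>)"


section \<open>Lambda-rings and modules over them\<close>

definition lambda_ring :: "'a ring \<Rightarrow> ('a \<Rightarrow> nat \<Rightarrow> 'a) \<Rightarrow> bool" where
  "lambda_ring A l \<longleftrightarrow> cring A \<and> l \<in> ring_hom A (Witt A) \<and>
     (\<forall>a\<in>carrier A. ghost A 1 (l a) = a) \<and>
     (\<forall>a\<in>carrier A. witt_map l (l a) = witt_comult A (l a))"

definition lambda_hom :: "'a ring \<Rightarrow> ('a \<Rightarrow> nat \<Rightarrow> 'a) \<Rightarrow> 'b ring \<Rightarrow> ('b \<Rightarrow> nat \<Rightarrow> 'b) \<Rightarrow> ('a \<Rightarrow> 'b) set" where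
  "lambda_hom A l B m = {f \<in> ring_hom A B. \<forall>a\<in>carrier A. m (f a) = witt_map f (l a)}"

definition adams :: "'a ring \<Rightarrow> ('a \<Rightarrow> nat \<Rightarrow> 'a) \<Rightarrow> nat \<Rightarrow> 'a \<Rightarrow> 'a" where
  "adams A l n a = ghost A n (l a)"

record ('a, 'b) lambda_module = "('a, 'b) module" +
  mod_lam :: "nat \<Rightarrow> 'b \<Rightarrow> 'b"

definition is_lambda_module ::
  "'a ring \<Rightarrow> ('a \<Rightarrow> nat \<Rightarrow> 'a) \<Rightarrow> ('a, 'b) lambda_module \<Rightarrow> bool" where
  "is_lambda_module A l M \<longleftrightarrow> module A M \<and>
     (\<forall>n>0. mod_lam M n \<in> carrier M \<rightarrow> carrier M \<and>
        (\<forall>x\<in>carrier M. \<forall>y\<in>carrier M.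
           mod_lam M n (x \<oplus>\<^bsub>M\<^esub> y) = mod_lam M n x \<oplus>\<^bsub>M\<^esub> mod_lam M n y) \<and>
        (\<forall>a\<in>carrier A. \<forall>x\<in>carrier M.
           mod_lam M n (a \<odot>\<^bsub>M\<^esub> x) = adams A l n a \<odot>\<^bsub>M\<^esub> mod_lam M n x)) \<and>
     (\<forall>x\<in>carrier M. mod_lam M 1 x = x) \<and>
     (\<forall>m>0. \<forall>n>0. \<forall>x\<in>carrier M. mod_lam M m (mod_lam M n x) = mod_lam M (m * n) x)"

(* The categories below consist of the rings and modules whose carrier is a set of elements of one
   type 'u, which plays the role of the universe. Once 'u is infinite, the product of two such
   carriers, which is needed for the square-zero extensions of A, again embeds into 'u.
   Here and below, morphisms are functions that are extensional on the carrier of their source. *)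
definition linear_maps :: "'a ring \<Rightarrow> ('a, 'b, 'k) module_scheme \<Rightarrow> ('a, 'b, 'k) module_scheme \<Rightarrow> ('b \<Rightarrow> 'b) set" where
  "linear_maps A M N = {f \<in> carrier M \<rightarrow>\<^sub>E carrier N.
     (\<forall>x\<in>carrier M. \<forall>y\<in>carrier M. f (x \<oplus>\<^bsub>M\<^esub> y) = f x \<oplus>\<^bsub>N\<^esub> f y) \<and>
     (\<forall>a\<in>carrier A. \<forall>x\<in>carrier M. f (a \<odot>\<^bsub>M\<^esub> x) = a \<odot>\<^bsub>N\<^esub> f x)}"

definition Mod_cat :: "'u ring \<Rightarrow> (('u, 'u) module, 'u \<Rightarrow> 'u) cat" where
  "Mod_cat A = \<lparr>
     Obj = {M. module A M},
     Hom = linear_maps A,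
     Ident = \<lambda>M. \<lambda>x\<in>carrier M. x,
     Comp = \<lambda>M N P g f. compose (carrier M) g f\<rparr>"

definition LMod_cat ::
  "'u ring \<Rightarrow> ('u \<Rightarrow> nat \<Rightarrow> 'u) \<Rightarrow> (('u, 'u) lambda_module, 'u \<Rightarrow> 'u) cat" where
  "LMod_cat A l = \<lparr>
     Obj = {M. is_lambda_module A l M},
     Hom = \<lambda>M N. {f \<in> linear_maps A M N.
       \<forall>n>0. \<forall>x\<in>carrier M. f (mod_lam M n x) = mod_lam N n (f x)},
     Ident = \<lambda>M. \<lambda>x\<in>carrier M. x,
     Comp = \<lambda>M N P g f. compose (carrier M) g f\<rparr>"

definition forget_mod :: "(('u, 'u) lambda_module, 'u \<Rightarrow> 'u, ('u, 'u) module, 'u \<Rightarrow> 'u) cfunctor" where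
  "forget_mod = \<lparr>ob = module.truncate, ar = \<lambda>M N f. f\<rparr>"


section \<open>Abelian group objects over a fixed base\<close>

(* In the category of rings over A, the terminal object is the identity of A and the product of
   f : B \<rightarrow> A with itself is the fibre product of B with itself over A. An abelian group object is
   therefore given by maps total \<times>\<^sub>A total \<rightarrow> total, A \<rightarrow> total and total \<rightarrow> total over A. The
   fibre product is realised on the type of pairs; it only serves as the source of the addition. *)

record 'u ring_ab =
  total :: "'u ring"
  proj :: "'u \<Rightarrow> 'u"
  ab_plus :: "'u \<times> 'u \<Rightarrow> 'u"
  ab_zero :: "'u \<Rightarrow> 'u"
  ab_neg :: "'u \<Rightarrow> 'u"

record 'u lambda_ab = "'u ring_ab" +
  lam :: "'u \<Rightarrow> nat \<Rightarrow> 'u"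

definition fibre_square :: "('u, 'k) ring_ab_scheme \<Rightarrow> ('u \<times> 'u) ring" where
  "fibre_square P = (RDirProd (total P) (total P))
     \<lparr>carrier := {(x, y). x \<in> carrier (total P) \<and> y \<in> carrier (total P) \<and> proj P x = proj P y}\<rparr>"

(* The Witt ring of the fibre product is the fibre product of the Witt rings. *)
definition fibre_square_lam :: "'u lambda_ab \<Rightarrow> 'u \<times> 'u \<Rightarrow> nat \<Rightarrow> 'u \<times> 'u" where
  "fibre_square_lam P = (\<lambda>(x, y). \<lambda>n\<in>{0<..}. (lam P x n, lam P y n))"

definition is_ring_ab :: "'u ring \<Rightarrow> ('u, 'k) ring_ab_scheme \<Rightarrow> bool" where
  "is_ring_ab A P \<longleftrightarrow>
     (let B = total P; f = proj P; p = ab_plus P; z = ab_zero P; i = ab_neg P in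
      cring A \<and> cring B \<and> f \<in> ring_hom B A \<and>
      p \<in> ring_hom (fibre_square P) B \<and> z \<in> ring_hom A B \<and> i \<in> ring_hom B B \<and>
      (\<forall>(x, y)\<in>carrier (fibre_square P). f (p (x, y)) = f x) \<and>
      (\<forall>a\<in>carrier A. f (z a) = a) \<and>
      (\<forall>x\<in>carrier B. f (i x) = f x) \<and>
      (\<forall>x\<in>carrier B. \<forall>y\<in>carrier B. \<forall>w\<in>carrier B. f x = f y \<and> f y = f w \<longrightarrow>
         p (p (x, y), w) = p (x, p (y, w))) \<and>
      (\<forall>x\<in>carrier B. \<forall>y\<in>carrier B. f x = f y \<longrightarrow> p (x, y) = p (y, x)) \<and>
      (\<forall>x\<in>carrier B. p (z (f x), x) = x) \<and>
      (\<forall>x\<in>carrier B. p (i x, x) = z (f x)))"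

definition is_lambda_ab :: "'u ring \<Rightarrow> ('u \<Rightarrow> nat \<Rightarrow> 'u) \<Rightarrow> 'u lambda_ab \<Rightarrow> bool" where
  "is_lambda_ab A l P \<longleftrightarrow> is_ring_ab A P \<and> lambda_ring A l \<and> lambda_ring (total P) (lam P) \<and>
     proj P \<in> lambda_hom (total P) (lam P) A l \<and>
     ab_plus P \<in> lambda_hom (fibre_square P) (fibre_square_lam P) (total P) (lam P) \<and>
     ab_zero P \<in> lambda_hom A l (total P) (lam P) \<and>
     ab_neg P \<in> lambda_hom (total P) (lam P) (total P) (lam P)"

definition ring_ab_maps ::
  "'u ring \<Rightarrow> ('u, 'k) ring_ab_scheme \<Rightarrow> ('u, 'k) ring_ab_scheme \<Rightarrow> ('u \<Rightarrow> 'u) set" where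
  "ring_ab_maps A P Q =
     {g \<in> ring_hom (total P) (total Q) \<inter> extensional (carrier (total P)).
        (\<forall>x\<in>carrier (total P). proj Q (g x) = proj P x) \<and>
        (\<forall>(x, y)\<in>carrier (fibre_square P). g (ab_plus P (x, y)) = ab_plus Q (g x, g y)) \<and>
        (\<forall>a\<in>carrier A. g (ab_zero P a) = ab_zero Q a) \<and>
        (\<forall>x\<in>carrier (total P). g (ab_neg P x) = ab_neg Q (g x))}"

definition Ring_ab_cat :: "'u ring \<Rightarrow> ('u ring_ab, 'u \<Rightarrow> 'u) cat" where
  "Ring_ab_cat A = \<lparr>
     Obj = {P. is_ring_ab A P},
     Hom = ring_ab_maps A,
     Ident = \<lambda>P. \<lambda>x\<in>carrier (total P). x,
     Comp = \<lambda>P Q R g f. compose (carrier (total P)) g f\<rparr>"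

definition LRing_ab_cat ::
  "'u ring \<Rightarrow> ('u \<Rightarrow> nat \<Rightarrow> 'u) \<Rightarrow> ('u lambda_ab, 'u \<Rightarrow> 'u) cat" where
  "LRing_ab_cat A l = \<lparr>
     Obj = {P. is_lambda_ab A l P},
     Hom = \<lambda>P Q. ring_ab_maps A P Q \<inter> lambda_hom (total P) (lam P) (total Q) (lam Q),
     Ident = \<lambda>P. \<lambda>x\<in>carrier (total P). x,
     Comp = \<lambda>P Q R g f. compose (carrier (total P)) g f\<rparr>"

definition forget_ab :: "('u lambda_ab, 'u \<Rightarrow> 'u, 'u ring_ab, 'u \<Rightarrow> 'u) cfunctor" where
  "forget_ab = \<lparr>ob = ring_ab.truncate, ar = \<lambda>P Q g. g\<rparr>"

(* The fields mult and one of a module record carry no meaning for modules. *)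
definition kernel_module :: "'u ring \<Rightarrow> 'u ring_ab \<Rightarrow> ('u, 'u) module" where
  "kernel_module A P = \<lparr>
     carrier = a_kernel (total P) A (proj P),
     monoid.mult = monoid.mult (total P), one = one (total P),
     ring.zero = ring.zero (total P), ring.add = ring.add (total P),
     smult = \<lambda>a x. ab_zero P a \<otimes>\<^bsub>total P\<^esub> x\<rparr>"

definition kernel_functor :: "'u ring \<Rightarrow> ('u ring_ab, 'u \<Rightarrow> 'u, ('u, 'u) module, 'u \<Rightarrow> 'u) cfunctor" where
  "kernel_functor A = \<lparr>
     ob = kernel_module A,
     ar = \<lambda>P Q g. restrict g (carrier (kernel_module A P))\<rparr>"


section \<open>The square of left adjoint functors\<close>

definition square_commutes :: "'u ring \<Rightarrow> ('u \<Rightarrow> nat \<Rightarrow> 'u) \<Rightarrow>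
    ('u lambda_ab, 'u \<Rightarrow> 'u, ('u, 'u) lambda_module, 'u \<Rightarrow> 'u) cfunctor \<Rightarrow> bool" where
  "square_commutes A l L \<longleftrightarrow>
     functors_equal (LRing_ab_cat A l) (forget_mod \<circ>\<^sub>F L) (kernel_functor A \<circ>\<^sub>F forget_ab)"

(* The vertical functors of the square are left adjoints, and the square carries two maps from
   K = ker (B \<rightarrow> A) to the set of sequences in K indexed by the positive integers. The unit of the
   adjunction (forget_mod, N \<mapsto> sequences in N) at the value of L on B sends x to the sequence of
   its images under the module operations. The unit of the adjunction
   (forget_ab, B \<mapsto> pullback of W(B) \<rightarrow> W(A) along the structure map of A) at B sends x to the
   structure map of B at x, a Witt vector with all its coordinates in K. The square is a square of
   adjunctions if these maps agree.

   This does not follow from square_commutes, and uniqueness fails without it. Given one such L,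
   replace the operations on every module L(B) by the operations s(n) * mod_lam n for a completely
   multiplicative sign s with s(2) = -1. This is L followed by an automorphism of the category of
   modules over (A, l) that does not change the underlying modules, so it is again the left adjoint
   of an adjoint equivalence and makes the square commute, but in general it is not isomorphic
   to L. *)
definition units_agree :: "'u ring \<Rightarrow> ('u \<Rightarrow> nat \<Rightarrow> 'u) \<Rightarrow>
    ('u lambda_ab, 'u \<Rightarrow> 'u, ('u, 'u) lambda_module, 'u \<Rightarrow> 'u) cfunctor \<Rightarrow> bool" where
  "units_agree A l L \<longleftrightarrow>
     (\<forall>P\<in>Obj (LRing_ab_cat A l). \<forall>x\<in>carrier (ob L P).
        (\<lambda>n\<in>{0<..}. mod_lam (ob L P) n x) = lam P x)"

definition is_adjunction_over_square :: "'u ring \<Rightarrow> ('u \<Rightarrow> nat \<Rightarrow> 'u) \<Rightarrow>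
    ('u lambda_ab, 'u \<Rightarrow> 'u, ('u, 'u) lambda_module, 'u \<Rightarrow> 'u) adj \<Rightarrow> bool" where
  "is_adjunction_over_square A l P \<longleftrightarrow>
     is_adjunction (LRing_ab_cat A l) (LMod_cat A l) P \<and>
     square_commutes A l (ladj P) \<and> units_agree A l (ladj P)"

(* Isomorphisms are compatible with the square: applying forget_mod to the isomorphism of left
   adjoints gives the identity of kernel_functor after forget_ab. Without this requirement they
   would not be unique, since multiplication by -1 is an automorphism of every left adjoint. *)
definition iso_over_square :: "'u ring \<Rightarrow> ('u \<Rightarrow> nat \<Rightarrow> 'u) \<Rightarrow>
    ('u lambda_ab, 'u \<Rightarrow> 'u, ('u, 'u) lambda_module, 'u \<Rightarrow> 'u) adj \<Rightarrow>
    ('u lambda_ab, 'u \<Rightarrow> 'u, ('u, 'u) lambda_module, 'u \<Rightarrow> 'u) adj \<Rightarrow>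
    ('u lambda_ab \<Rightarrow> 'u \<Rightarrow> 'u) \<times> (('u, 'u) lambda_module \<Rightarrow> 'u \<Rightarrow> 'u) \<Rightarrow> bool" where
  "iso_over_square A l P Q = (\<lambda>(s, t).
     adjunction_iso (LRing_ab_cat A l) (LMod_cat A l) P Q s t \<and>
     (\<forall>B\<in>Obj (LRing_ab_cat A l).
        ar forget_mod (ob (ladj P) B) (ob (ladj Q) B) (s B) =
        Ident (Mod_cat A) (ob (kernel_functor A \<circ>\<^sub>F forget_ab) B)))"

end

theory Submission
  imports Defs "HOL-Library.Poly_Mapping" "HOL-Library.Function_Algebras" "HOL-Library.Countable_Set"
begin

text \<open>The ring of big Witt vectors is constructed from Dwork's lemma: over a polynomial ring over the integers a sequence
  \<open>b\<close> is a sequence of ghost components if and only if \<open>b (p n) \<equiv> \<phi>\<^sub>p (b n)\<close> modulo the power of \<open>p\<close> that divides \<open>p n\<close>.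
  This produces universal polynomials for the ring operations and the Frobenius maps, and, applied to the ring of Witt vectors
  itself, for the comultiplication. By naturality, identities between them only have to be checked over torsion-free rings,
  where the ghost map is injective. If \<open>K\<close> is an ideal of square zero, then \<open>w\<^sub>n(x) = n x\<^sub>n\<close> on \<open>W(K)\<close>; hence there addition is
  componentwise, \<open>(a x)\<^sub>n = w\<^sub>n(a) x\<^sub>n\<close> and \<open>\<Delta>(x)\<^sub>n\<^sub>,\<^sub>m = x\<^sub>n\<^sub>m\<close>.

  The kernel \<open>K\<close> of an abelian group object \<open>B \<rightarrow> A\<close> has square zero, since \<open>(x, 0) (0, y) = 0\<close> in the fibre square. By the formulas
  above, the components of the structure map of \<open>B\<close> make \<open>K\<close> a module over the \<open>\<lambda>\<close>-ring \<open>A\<close>. As \<open>B\<close> is the sum of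
  \<open>A\<close> and \<open>K\<close>, the resulting functor is fully faithful, and \<open>A \<ltimes> M\<close> with \<open>\<lambda>(a, x) = \<lambda>(a) + (\<lambda>\<^sub>n x)\<^sub>n\<close>, the sum being taken
  in \<open>W(A \<ltimes> M)\<close>, shows that it is essentially surjective. The rest is formal: a fully faithful and essentially surjective functor has a
  right adjoint, all its adjunctions are adjoint equivalences, and the comparison between two right adjoints is determined
  by the counits.\<close>

section \<open>Dwork's lemma\<close>

hide_const (open) Divisibility.prime

text \<open>The definitions pick \<open>Witt\<close>, \<open>witt_frobenius\<close> and
  \<open>witt_comult\<close> by \<open>SOME\<close> among structures that are natural only for rings
  on a single type. Existence is therefore half of the work; the other half is that every choice
  agrees with the construction. The universal example, a countable polynomial ring, has to be copied
  into the type of \<open>A\<close>, which is where infinity of that type enters; infinity is used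
  again to code pairs, so that square-zero extensions stay inside the type. A choice is pinned down
  only on carriers, so agreement of rings is a relation weaker than equality and has to be carried
  through \<open>Witt (Witt A)\<close>. The same looseness shapes the end. No right adjoint is
  computed: one is obtained by choosing preimages of modules up to isomorphism. For an arbitrary
  adjunction over the square, the square fixes the underlying modules and the arrows of its left
  adjoint and the condition on units fixes the operations, so that its hom-sets are those of the
  kernel functor. Hence statements about all such adjunctions follow from facts about one
  functor.\<close>

definition mult_in :: "'r::comm_ring_1 set \<Rightarrow> nat \<Rightarrow> 'r \<Rightarrow> bool" where
  "mult_in R n x \<longleftrightarrow> (\<exists>r\<in>R. x = of_nat n * r)"

definition cghost :: "(nat \<Rightarrow> 'r::comm_ring_1) \<Rightarrow> nat \<Rightarrow> 'r" where
  "cghost u n = (\<Sum>d | d dvd n. of_nat d * u d ^ (n div d))"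

text \<open>With \<open>mult_in\<close> the quotient has to lie in \<open>R\<close>, which is
  stronger than \<open>dvd\<close> in the ambient ring. Integers act on \<open>R\<close> although
  \<open>R\<close> need not contain 1, and this action suffices for the Bezout argument in
  \<open>mult_in_coprime\<close>.\<close>

locale nonunital_subring =
  fixes R :: "'r::comm_ring_1 set"
  assumes zero_in: "0 \<in> R"
    and diff_in: "x \<in> R \<Longrightarrow> y \<in> R \<Longrightarrow> x - y \<in> R"
    and mult_in: "x \<in> R \<Longrightarrow> y \<in> R \<Longrightarrow> x * y \<in> R"
begin

lemma minus_in: "x \<in> R \<Longrightarrow> - x \<in> R"
  using diff_in[OF zero_in] by simp

lemma add_in: "x \<in> R \<Longrightarrow> y \<in> R \<Longrightarrow> x + y \<in> R"
  using diff_in[OF _ minus_in] by simp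

lemma of_nat_mult_in: "x \<in> R \<Longrightarrow> of_nat n * x \<in> R"
  by (induction n) (auto simp: zero_in add_in algebra_simps)

lemma of_int_mult_in: "x \<in> R \<Longrightarrow> of_int n * x \<in> R"
  by (cases n rule: int_cases2) (auto simp: of_nat_mult_in minus_in)

lemma power_mult_in: "x \<in> R \<Longrightarrow> y \<in> R \<Longrightarrow> x ^ n * y \<in> R"
  by (induction n) (auto simp: mult_in mult.assoc)

lemma power_in: "x \<in> R \<Longrightarrow> n > 0 \<Longrightarrow> x ^ n \<in> R"
  using power_mult_in[of x x "n - 1"] by (cases n) (auto simp: mult.commute)

lemma sum_in: "(\<And>i. i \<in> I \<Longrightarrow> f i \<in> R) \<Longrightarrow> sum f I \<in> R"
  by (induction I rule: infinite_finite_induct) (auto simp: zero_in add_in)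

lemma mult_in_0: "mult_in R n 0"
  unfolding mult_in_def using zero_in by force

lemma mult_in_diff: "mult_in R n x \<Longrightarrow> mult_in R n y \<Longrightarrow> mult_in R n (x - y)"
  unfolding mult_in_def using diff_in by (metis right_diff_distrib)

lemma mult_in_minus: "mult_in R n x \<Longrightarrow> mult_in R n (- x)"
  using mult_in_diff[OF mult_in_0] by simp

lemma mult_in_add: "mult_in R n x \<Longrightarrow> mult_in R n y \<Longrightarrow> mult_in R n (x + y)"
  unfolding mult_in_def using add_in by (metis distrib_left)

lemma mult_in_sum: "(\<And>i. i \<in> I \<Longrightarrow> mult_in R n (f i)) \<Longrightarrow> mult_in R n (sum f I)"
  by (induction I rule: infinite_finite_induct) (auto simp: mult_in_0 mult_in_add)

lemma mult_in_of_nat: "mult_in R n x \<Longrightarrow> mult_in R (m * n) (of_nat m * x)"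
  unfolding mult_in_def by (metis mult.assoc of_nat_mult)

lemma mult_in_dvd:
  assumes "mult_in R n x" and "m dvd n" shows "mult_in R m x"
proof -
  obtain k where "n = m * k" using assms(2) by blast
  then show ?thesis using assms(1) unfolding mult_in_def
    by (metis mult.assoc of_nat_mult of_nat_mult_in)
qed

text \<open>Bezout: in \<open>a m x + b n x\<close> the first \<open>x\<close> is written as a
  multiple of \<open>n\<close> and the second as a multiple of \<open>m\<close>.\<close>

lemma mult_in_coprime:
  assumes "mult_in R m x" "mult_in R n x" "coprime m n"
  shows "mult_in R (m * n) x"
proof -
  obtain a b :: int where ab: "a * int m + b * int n = 1"
    using assms(3) bezout_int[of "int m" "int n"] by (auto simp: coprime_iff_gcd_eq_1)
  from assms obtain r s where rs: "r \<in> R" "s \<in> R" "x = of_nat m * r" "x = of_nat n * s"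
    by (auto simp: mult_in_def)
  have "x = of_int (a * int m + b * int n) * x" unfolding ab by simp
  also have "\<dots> = of_int a * of_nat m * x + of_int b * of_nat n * x"
    by (simp add: distrib_right)
  also have "of_int a * of_nat m * x = of_nat (m * n) * (of_int a * s)"
    unfolding rs(4) by simp
  also have "of_int b * of_nat n * x = of_nat (m * n) * (of_int b * r)"
    unfolding rs(3) by simp
  finally have "x = of_nat (m * n) * (of_int a * s + of_int b * r)"
    by (simp add: distrib_left)
  then show ?thesis unfolding mult_in_def using rs of_int_mult_in add_in by blast
qed

text \<open>Strong induction on \<open>n\<close>: the full power of one prime is split off, and what
  remains is a smaller divisor coprime to it. The hypothesis \<open>x \<in> R\<close> covers
  \<open>n = 1\<close>.\<close>

lemma mult_in_if_prime_powers:
  assumes "n > 0" "x \<in> R"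
    and "\<And>p k. prime p \<Longrightarrow> p ^ Suc k dvd n \<Longrightarrow> mult_in R (p ^ Suc k) x"
  shows "mult_in R n x"
  using assms
proof (induction n rule: less_induct)
  case (less n)
  show ?case
  proof (cases "n = 1")
    case True then show ?thesis using less.prems by (auto simp: mult_in_def)
  next
    case False
    then obtain p where p: "prime p" "p dvd n" using prime_factor_nat by blast
    obtain m where m: "n = p ^ multiplicity p n * m" "\<not> p dvd m"
      using multiplicity_decompose'[of n p] less.prems(1) p(1) not_prime_unit by (metis less_numeral_extra(3))
    obtain k where k: "multiplicity p n = Suc k"
      using p less.prems(1) by (metis gr0_implies_Suc multiplicity_gt_zero_iff not_prime_unit prime_gt_0_nat zero_less_iff_neq_zero)
    have mpos: "m > 0" using m(1) less.prems(1) by (cases m) auto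
    have "1 < p ^ Suc k" using one_less_power[OF prime_gt_1_nat[OF p(1)], of "Suc k"] by simp
    then have "m < n" using m(1) mpos k by simp
    then have 1: "mult_in R m x"
      using less.IH[of m] less.prems mpos m(1) by (metis dvd_mult dvd_refl dvd_trans)
    have 2: "mult_in R (p ^ Suc k) x" using less.prems(3)[OF p(1), of k] m(1) k by (metis dvd_triv_left)
    have "coprime m (p ^ Suc k)" using m(2) p(1)
      by (metis coprime_commute coprime_power_left_iff prime_imp_coprime)
    from mult_in_coprime[OF 1 2 this] show ?thesis using m(1) k by (simp add: mult.commute)
  qed
qed

text \<open>Taylor expansion of \<open>(y + m r) ^ n\<close> to second order in \<open>m\<close>.
  The linear term is kept explicit because its factor \<open>n\<close> supplies one more prime when
  \<open>n = p\<close>. For \<open>n = 0\<close> the exponent \<open>n - 1\<close> is truncated, but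
  its coefficient vanishes.\<close>

lemma power_diff_expand:
  assumes "x \<in> R" "y \<in> R" "r \<in> R" "x - y = of_nat m * r"
  shows "\<exists>s\<in>R. x ^ n - y ^ n = of_nat (n * m) * (y ^ (n - 1) * r) + of_nat (m * m) * s"
proof (induction n)
  case 0 then show ?case using zero_in by (intro bexI[of _ 0]) auto
next
  case (Suc n)
  then obtain s where s: "s \<in> R" and e: "x ^ n - y ^ n = of_nat (n * m) * (y ^ (n - 1) * r) + of_nat (m * m) * s"
    by blast
  have x: "x = y + of_nat m * r" using assms(4) by (simp add: algebra_simps)
  have xn: "x ^ n = y ^ n + of_nat (n * m) * (y ^ (n - 1) * r) + of_nat (m * m) * s"
    using e by (simp add: algebra_simps)
  \<comment> \<open>\<open>y * y ^ (n - 1) = y ^ n\<close> can fail at \<open>n = 0\<close>; the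
    factor \<open>n\<close> restores it.\<close>
  have yy: "of_nat n * (y * (y ^ (n - 1))) = of_nat n * y ^ n" by (cases n) auto
  let ?s = "of_nat n * (y ^ (n - 1) * (r * r)) + y * s + of_nat m * (r * s)"
  have "x ^ Suc n = (y + of_nat m * r) * x ^ n" using x by simp
  also have "\<dots> = y ^ Suc n + of_nat m * r * y ^ n + of_nat m * r * (of_nat n * (y * (y ^ (n - 1))))
     + of_nat (m * m) * ?s"
    unfolding xn by (simp add: algebra_simps)
  also have "\<dots> = y ^ Suc n + of_nat (Suc n * m) * (y ^ n * r) + of_nat (m * m) * ?s"
    unfolding yy by (simp add: algebra_simps)
  finally have "x ^ Suc n - y ^ Suc n = of_nat (Suc n * m) * (y ^ (Suc n - 1) * r) + of_nat (m * m) * ?s"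
    by simp
  moreover have "?s \<in> R"
    using assms s by (intro add_in of_nat_mult_in power_mult_in mult_in) auto
  ultimately show ?case by blast
qed

lemma power_cong:
  assumes "x \<in> R" "y \<in> R" "mult_in R m (x - y)"
  shows "mult_in R m (x ^ n - y ^ n)"
proof -
  obtain r where r: "r \<in> R" "x - y = of_nat m * r" using assms by (auto simp: mult_in_def)
  from power_diff_expand[OF assms(1,2) r] obtain s where "s \<in> R"
    "x ^ n - y ^ n = of_nat (n * m) * (y ^ (n - 1) * r) + of_nat (m * m) * s" by blast
  then have "x ^ n - y ^ n = of_nat m * (of_nat n * (y ^ (n - 1) * r) + of_nat m * s)"
    by (simp add: algebra_simps)
  moreover have "of_nat n * (y ^ (n - 1) * r) + of_nat m * s \<in> R"
    using assms r \<open>s \<in> R\<close> by (intro add_in of_nat_mult_in power_mult_in) auto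
  ultimately show ?thesis unfolding mult_in_def by blast
qed

text \<open>Both coefficients of the expansion, \<open>p * p ^ Suc k\<close> and the square of
  \<open>p ^ Suc k\<close>, are divisible by \<open>p ^ Suc (Suc k)\<close>.\<close>

lemma prime_power_cong_Suc:
  assumes "x \<in> R" "y \<in> R" "mult_in R (p ^ Suc k) (x - y)"
  shows "mult_in R (p ^ Suc (Suc k)) (x ^ p - y ^ p)"
proof -
  obtain r where r: "r \<in> R" "x - y = of_nat (p ^ Suc k) * r" using assms by (auto simp: mult_in_def)
  from power_diff_expand[OF assms(1,2) r, of p] obtain s where s: "s \<in> R"
    "x ^ p - y ^ p = of_nat (p * p ^ Suc k) * (y ^ (p - 1) * r) + of_nat (p ^ Suc k * p ^ Suc k) * s" by blast
  have "x ^ p - y ^ p = of_nat (p ^ Suc (Suc k)) * (y ^ (p - 1) * r + of_nat (p ^ k) * s)"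
    unfolding s(2) by (simp add: algebra_simps)
  moreover have "y ^ (p - 1) * r + of_nat (p ^ k) * s \<in> R"
    using assms r s by (intro add_in of_nat_mult_in power_mult_in) auto
  ultimately show ?thesis unfolding mult_in_def by blast
qed

text \<open>Each p-th power gains one factor \<open>p\<close>, starting from a congruence modulo
  \<open>p\<close>; the further exponent \<open>m\<close> preserves what has been gained.\<close>

lemma prime_power_cong:
  assumes "p > 0" "x \<in> R" "y \<in> R" "mult_in R p (x - y)"
  shows "mult_in R (p ^ Suc k) (x ^ (p ^ k * m) - y ^ (p ^ k * m))"
proof -
  have "mult_in R (p ^ Suc k) (x ^ (p ^ k) - y ^ (p ^ k))"
  proof (induction k)
    case 0 then show ?case using assms by simp
  next
    case (Suc k)
    have "mult_in R (p ^ Suc (Suc k)) ((x ^ (p ^ k)) ^ p - (y ^ (p ^ k)) ^ p)"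
      using assms Suc by (intro prime_power_cong_Suc power_in) auto
    then show ?case by (simp add: power_mult[symmetric] mult.commute)
  qed
  from power_cong[OF _ _ this, of m] show ?thesis using assms by (auto simp: power_mult power_in)
qed

end

section \<open>Frobenius lifts and the two directions of Dwork's lemma\<close>

locale frobenius_lifts = nonunital_subring R for R :: "'r::comm_ring_1 set" +
  fixes \<phi> :: "nat \<Rightarrow> 'r \<Rightarrow> 'r"
  assumes lift_in: "prime p \<Longrightarrow> x \<in> R \<Longrightarrow> \<phi> p x \<in> R"
    and lift_add: "prime p \<Longrightarrow> x \<in> R \<Longrightarrow> y \<in> R \<Longrightarrow> \<phi> p (x + y) = \<phi> p x + \<phi> p y"
    and lift_mult: "prime p \<Longrightarrow> x \<in> R \<Longrightarrow> y \<in> R \<Longrightarrow> \<phi> p (x * y) = \<phi> p x * \<phi> p y"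
    and lift_cong: "prime p \<Longrightarrow> x \<in> R \<Longrightarrow> mult_in R p (\<phi> p x - x ^ p)"
begin

lemma lift_zero: "prime p \<Longrightarrow> \<phi> p 0 = 0"
  using lift_add[OF _ zero_in zero_in, of p] by simp

lemma lift_of_nat: "prime p \<Longrightarrow> x \<in> R \<Longrightarrow> \<phi> p (of_nat n * x) = of_nat n * \<phi> p x"
  by (induction n) (auto simp: lift_zero distrib_right lift_add of_nat_mult_in)

lemma lift_power: "prime p \<Longrightarrow> x \<in> R \<Longrightarrow> n > 0 \<Longrightarrow> \<phi> p (x ^ n) = \<phi> p x ^ n"
proof (induction n)
  case (Suc n) then show ?case
    by (cases "n = 0") (auto simp: lift_mult power_in)
qed auto

lemma lift_sum:
  assumes "prime p" "\<And>i. i \<in> I \<Longrightarrow> f i \<in> R" shows "\<phi> p (sum f I) = (\<Sum>i\<in>I. \<phi> p (f i))"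
  using assms(2) by (induction I rule: infinite_finite_induct)
    (auto simp: lift_zero[OF assms(1)] lift_add[OF assms(1)] sum_in)

lemma dvd_div_gt0: "d dvd n \<Longrightarrow> n > 0 \<Longrightarrow> n div d > (0::nat)"
  by (auto elim!: dvdE)

lemma cghost_in: "(\<And>d. d > 0 \<Longrightarrow> u d \<in> R) \<Longrightarrow> n > 0 \<Longrightarrow> cghost u n \<in> R"
  unfolding cghost_def
  by (intro sum_in of_nat_mult_in power_in) (auto simp: dvd_div_gt0 intro: Nat.gr0I)

text \<open>The easy direction. Put \<open>N = p ^ k * m\<close>. A divisor \<open>d\<close> of
  \<open>p * N\<close> that does not divide \<open>N\<close> carries the full power
  \<open>p ^ Suc k\<close>. For \<open>d\<close> dividing \<open>N\<close>, the two terms differ by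
  \<open>d\<close> times a difference of equal powers of \<open>u d ^ p\<close> and
  \<open>\<phi> p (u d)\<close>, which are congruent modulo \<open>p\<close>.\<close>

lemma cghost_cong:
  assumes p: "prime p" and m: "m > 0" and u: "\<And>d. d > 0 \<Longrightarrow> u d \<in> R"
  shows "mult_in R (p ^ Suc k) (cghost u (p ^ Suc k * m) - \<phi> p (cghost u (p ^ k * m)))"
proof -
  let ?N = "p ^ k * m"
  have p0: "p > 0" using p by (simp add: prime_gt_0_nat)
  have N0: "?N > 0" using p0 m by simp
  have sub: "{d. d dvd ?N} \<subseteq> {d. d dvd p * ?N}" by auto
  have fin: "finite {d. d dvd p * ?N}" using N0 p0 by simp
  have dpos: "d > 0" if "d dvd p * ?N" for d using that N0 p0 by (metis dvd_pos_nat nat_0_less_mult_iff)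
  have eq1: "cghost u (p * ?N) = (\<Sum>d\<in>{d. d dvd p * ?N} - {d. d dvd ?N}. of_nat d * u d ^ (p * ?N div d))
      + (\<Sum>d | d dvd ?N. of_nat d * u d ^ (p * ?N div d))"
    unfolding cghost_def by (rule sum.subset_diff[OF sub fin])
  have eq2: "\<phi> p (cghost u ?N) = (\<Sum>d | d dvd ?N. of_nat d * \<phi> p (u d) ^ (?N div d))"
    unfolding cghost_def
  proof (subst lift_sum[OF p])
    fix d assume "d \<in> {d. d dvd ?N}"
    then have d: "d > 0" "?N div d > 0" using N0 by (auto simp: dvd_div_gt0 intro: Nat.gr0I)
    then show "of_nat d * u d ^ (?N div d) \<in> R" by (intro of_nat_mult_in power_in u)
  next
    show "(\<Sum>d | d dvd ?N. \<phi> p (of_nat d * u d ^ (?N div d))) = (\<Sum>d | d dvd ?N. of_nat d * \<phi> p (u d) ^ (?N div d))"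
    proof (rule sum.cong[OF refl])
      fix d assume "d \<in> {d. d dvd ?N}"
      then have d: "d > 0" "?N div d > 0" using N0 by (auto simp: dvd_div_gt0 intro: Nat.gr0I)
      then show "\<phi> p (of_nat d * u d ^ (?N div d)) = of_nat d * \<phi> p (u d) ^ (?N div d)"
        using p u by (simp add: lift_of_nat lift_power power_in)
    qed
  qed
  have A: "mult_in R (p ^ Suc k) (of_nat d * u d ^ (p * ?N div d))"
    if d: "d \<in> {d. d dvd p * ?N} - {d. d dvd ?N}" for d
  proof -
    \<comment> \<open>Otherwise the p-part of \<open>d\<close> divides \<open>p ^ k\<close> while
      its prime-to-p part divides \<open>m\<close>, so \<open>d\<close> would divide
      \<open>p ^ k * m\<close>.\<close>
    have "p ^ Suc k dvd d"
    proof (rule ccontr)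
      assume nd: "\<not> p ^ Suc k dvd d"
      have d0: "d > 0" using d dpos by auto
      obtain j e where je: "d = p ^ j * e" "\<not> p dvd e"
        using multiplicity_decompose'[of d p] d0 p by (metis not_prime_unit less_numeral_extra(3))
      have "j \<le> k" using nd je(1) by (metis dvd_mult2 le_imp_power_dvd not_less_eq_eq)
      have "e dvd p ^ Suc k * m" using d je(1) by (metis DiffD1 dvd_mult_right mem_Collect_eq mult.assoc power_Suc)
      moreover have "coprime e (p ^ Suc k)" using je(2) p by (metis coprime_commute coprime_power_left_iff prime_imp_coprime)
      ultimately have "e dvd m" by (simp add: coprime_dvd_mult_right_iff)
      then have "d dvd ?N" using je(1) \<open>j \<le> k\<close> by (simp add: le_imp_power_dvd mult_dvd_mono)
      then show False using d by auto
    qed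
    moreover have "u d ^ (p * ?N div d) \<in> R"
      using d dpos p0 N0 by (intro power_in u) (auto simp: dvd_div_gt0)
    ultimately show ?thesis
      by (metis mult_in_def mult_in_dvd)
  qed
  have B: "mult_in R (p ^ Suc k) (of_nat d * u d ^ (p * ?N div d) - of_nat d * \<phi> p (u d) ^ (?N div d))"
    if d: "d dvd ?N" for d
  proof -
    define q where "q = ?N div d"
    have dq: "?N = d * q" using d q_def by simp
    have d0: "d > 0" "q > 0" using dq N0 by (metis nat_0_less_mult_iff)+
    obtain j e where je: "q = p ^ j * e" "\<not> p dvd e"
      using multiplicity_decompose'[of q p] d0 p by (metis not_prime_unit less_numeral_extra(3))
    \<comment> \<open>The p-part of \<open>q\<close> is \<open>p ^ j\<close>, so \<open>d\<close>
      contains what is missing from \<open>p ^ k\<close>; multiplication by \<open>d\<close> lifts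
      the congruence modulo \<open>p ^ Suc j\<close> to one modulo \<open>p ^ Suc k\<close>.\<close>
    have "p ^ k dvd d * p ^ j"
    proof -
      have "p ^ k dvd d * p ^ j * e" using dq je(1) by (metis dvd_triv_left mult.assoc)
      moreover have "coprime e (p ^ k)" using je(2) p by (metis coprime_commute coprime_power_left_iff prime_imp_coprime)
      ultimately show ?thesis by (simp add: coprime_commute coprime_dvd_mult_left_iff)
    qed
    then have dv: "p ^ Suc k dvd d * p ^ Suc j" by (simp add: mult.left_commute)
    have "mult_in R (p ^ Suc j) (\<phi> p (u d) ^ (p ^ j * e) - (u d ^ p) ^ (p ^ j * e))"
      using p0 p d0 u by (intro prime_power_cong lift_cong) (auto simp: lift_in power_in)
    then have "mult_in R (d * p ^ Suc j) (of_nat d * (\<phi> p (u d) ^ q - (u d ^ p) ^ q))"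
      unfolding je(1) by (rule mult_in_of_nat)
    then have "mult_in R (p ^ Suc k) (of_nat d * (\<phi> p (u d) ^ q - (u d ^ p) ^ q))"
      using dv mult_in_dvd by blast
    then have "mult_in R (p ^ Suc k) (- (of_nat d * (\<phi> p (u d) ^ q - (u d ^ p) ^ q)))"
      by (rule mult_in_minus)
    moreover have "p * ?N div d = p * q" unfolding dq using d0 by simp
    moreover have "?N div d = q" unfolding q_def ..
    ultimately show ?thesis by (simp add: power_mult algebra_simps)
  qed
  have "cghost u (p ^ Suc k * m) - \<phi> p (cghost u ?N) =
     (\<Sum>d\<in>{d. d dvd p * ?N} - {d. d dvd ?N}. of_nat d * u d ^ (p * ?N div d))
     + (\<Sum>d | d dvd ?N. of_nat d * u d ^ (p * ?N div d) - of_nat d * \<phi> p (u d) ^ (?N div d))"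
    using eq1 eq2 by (simp add: sum_subtractf mult.assoc)
  then show ?thesis using A B by (auto intro!: mult_in_add mult_in_sum)
qed

end

text \<open>Inverts the ghost map one index at a time. The quotient by \<open>n\<close> is chosen
  inside \<open>R\<close>; it exists under Dwork's congruences, and without them the value is
  arbitrary.\<close>

fun unghost :: "'r::comm_ring_1 set \<Rightarrow> (nat \<Rightarrow> 'r) \<Rightarrow> nat \<Rightarrow> 'r" where
  "unghost R b n = (SOME r. r \<in> R \<and>
     b n - (\<Sum>d\<in>{d. d dvd n \<and> d < n}. of_nat d * unghost R b d ^ (n div d)) = of_nat n * r)"

declare unghost.simps [simp del]

context frobenius_lifts
begin

text \<open>The difficult direction. By the prime power criterion it suffices to divide
  \<open>b n - ?S\<close>, where \<open>?S\<close> collects the proper divisors, by each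
  \<open>p ^ Suc k\<close> that divides \<open>n\<close>; modulo this power both \<open>b n\<close>
  and \<open>?S\<close> are congruent to \<open>\<phi> p (b (n div p))\<close>.\<close>

lemma dwork:
  assumes b: "\<And>n. n > 0 \<Longrightarrow> b n \<in> R"
    and cong: "\<And>p k m. prime p \<Longrightarrow> m > 0 \<Longrightarrow> mult_in R (p ^ Suc k) (b (p ^ Suc k * m) - \<phi> p (b (p ^ k * m)))"
    and n: "n > 0"
  shows "unghost R b n \<in> R \<and> cghost (unghost R b) n = b n"
  using n
proof (induction n rule: less_induct)
  case (less n)
  let ?S = "\<Sum>d\<in>{d. d dvd n \<and> d < n}. of_nat d * unghost R b d ^ (n div d)"
  \<comment> \<open>Cutting off at \<open>n\<close> gives a sequence in \<open>R\<close> before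
    \<open>unghost R b n\<close> is known to lie there. Its n-th ghost component is
    \<open>?S\<close>, and its components at smaller positive indices are those of \<open>b\<close>,
    so \<open>cghost_cong\<close> yields the congruence for \<open>?S\<close>.\<close>
  define v where "v d = (if d < n then unghost R b d else 0)" for d
  have v: "v d \<in> R" if "d > 0" for d using less.IH that by (auto simp: v_def zero_in)
  have fin: "finite {d. d dvd n}" using less.prems by simp
  have split: "{d. d dvd n} = insert n {d. d dvd n \<and> d < n}"
    using less.prems by (auto dest: dvd_imp_le)
  have ninv: "cghost v n = ?S"
    unfolding cghost_def
  proof (subst split, subst sum.insert)
    show "of_nat n * v n ^ (n div n) + (\<Sum>d | d dvd n \<and> d < n. of_nat d * v d ^ (n div d)) = ?S"
      using less.prems by (auto simp: v_def intro: sum.cong)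
  qed (use fin in auto)
  have "mult_in R n (b n - ?S)"
  proof (rule mult_in_if_prime_powers)
    show "b n - ?S \<in> R" using b v less.prems unfolding ninv[symmetric] by (intro diff_in cghost_in) auto
    fix p k assume p: "prime p" and "p ^ Suc k dvd n"
    then obtain m where m: "n = p ^ Suc k * m" by blast
    have m0: "m > 0" using m less.prems by (cases m) auto
    have lt: "p ^ k * m < n" using m m0 prime_gt_1_nat[OF p] by simp
    have "p ^ k * m > 0" using m0 p by (simp add: prime_gt_0_nat)
    then have "cghost (unghost R b) (p ^ k * m) = b (p ^ k * m)" using less.IH[OF lt] by simp
    moreover have "cghost (unghost R b) (p ^ k * m) = cghost v (p ^ k * m)"
      unfolding cghost_def using lt \<open>p ^ k * m > 0\<close>
      by (intro sum.cong) (auto simp: v_def dest!: dvd_imp_le)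
    ultimately have "b n - ?S = (b n - \<phi> p (b (p ^ k * m))) - (cghost v n - \<phi> p (cghost v (p ^ k * m)))"
      unfolding ninv by simp
    moreover have "mult_in R (p ^ Suc k) (cghost v n - \<phi> p (cghost v (p ^ k * m)))"
      unfolding m using p m0 v by (rule cghost_cong)
    moreover have "mult_in R (p ^ Suc k) (b n - \<phi> p (b (p ^ k * m)))"
      unfolding m using p m0 by (rule cong)
    ultimately show "mult_in R (p ^ Suc k) (b n - ?S)"
      by (simp only: mult_in_diff)
  qed (use less.prems in auto)
  then have "\<exists>r. r \<in> R \<and> b n - ?S = of_nat n * r" by (auto simp: mult_in_def)
  then have *: "unghost R b n \<in> R \<and> b n - ?S = of_nat n * unghost R b n"
    unfolding unghost.simps[of R b n] by (rule someI_ex)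
  have "cghost (unghost R b) n = of_nat n * unghost R b n + ?S"
    unfolding cghost_def by (subst split, subst sum.insert) (use fin less.prems in auto)
  then show ?case using * by (metis diff_add_cancel)
qed

end

section \<open>Integer polynomials in countably many variables\<close>

lemma (in comm_monoid) finprod_poly_mapping_superset:
  assumes "\<And>i k. f i k \<in> carrier G" "\<And>i. f i 0 = \<one>" "finite S" "Poly_Mapping.keys p \<subseteq> S"
  shows "(\<Otimes>i\<in>Poly_Mapping.keys p. f i (Poly_Mapping.lookup p i)) = (\<Otimes>i\<in>S. f i (Poly_Mapping.lookup p i))"
  using assms by (intro finprod_mono_neutral_cong_left) (auto simp: in_keys_iff)

text \<open>Stated in a bare commutative monoid because it is used twice: multiplicatively for
  monomials, and additively for sums of monomials with coefficients.\<close>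

lemma (in comm_monoid) finprod_poly_mapping_add:
  fixes f :: "'i \<Rightarrow> 'k::comm_monoid_add \<Rightarrow> 'a"
  assumes f: "\<And>i k. f i k \<in> carrier G" "\<And>i. f i 0 = \<one>" "\<And>i k k'. f i (k + k') = f i k \<otimes> f i k'"
  shows "(\<Otimes>i\<in>Poly_Mapping.keys (p + q). f i (Poly_Mapping.lookup (p + q) i)) =
    (\<Otimes>i\<in>Poly_Mapping.keys p. f i (Poly_Mapping.lookup p i)) \<otimes> (\<Otimes>i\<in>Poly_Mapping.keys q. f i (Poly_Mapping.lookup q i))"
proof -
  let ?S = "Poly_Mapping.keys p \<union> Poly_Mapping.keys q"
  have "(\<Otimes>i\<in>Poly_Mapping.keys (p + q). f i (Poly_Mapping.lookup (p + q) i)) = (\<Otimes>i\<in>?S. f i (Poly_Mapping.lookup (p + q) i))"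
    using f keys_add[of p q] by (intro finprod_poly_mapping_superset) auto
  also have "\<dots> = (\<Otimes>i\<in>?S. f i (Poly_Mapping.lookup p i)) \<otimes> (\<Otimes>i\<in>?S. f i (Poly_Mapping.lookup q i))"
    using f by (subst finprod_multf[symmetric]) (auto simp: lookup_add)
  also have "\<dots> = (\<Otimes>i\<in>Poly_Mapping.keys p. f i (Poly_Mapping.lookup p i)) \<otimes> (\<Otimes>i\<in>Poly_Mapping.keys q. f i (Poly_Mapping.lookup q i))"
    using f by (subst (1 2) finprod_poly_mapping_superset[where S = ?S]) auto
  finally show ?thesis .
qed

lemma (in comm_monoid) finprod_poly_mapping_single:
  assumes "\<And>i k. f i k \<in> carrier G" "\<And>i. f i 0 = \<one>"
  shows "(\<Otimes>i\<in>Poly_Mapping.keys (Poly_Mapping.single j k). f i (Poly_Mapping.lookup (Poly_Mapping.single j k) i)) = f j k"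
  using assms by simp

text \<open>The variable \<open>(j, i)\<close> stands for coordinate \<open>i + 1\<close> of the
  j-th generic Witt vector; countably many vectors serve operations of every arity at once.\<close>

type_synonym zpoly = "(nat \<times> nat \<Rightarrow>\<^sub>0 nat) \<Rightarrow>\<^sub>0 int"

definition zpoly_ring :: "zpoly ring" where
  "zpoly_ring = \<lparr>carrier = UNIV, monoid.mult = (*), one = 1, ring.zero = 0, ring.add = (+)\<rparr>"

lemma zpoly_ring_simps [simp]:
  "carrier zpoly_ring = UNIV" "x \<otimes>\<^bsub>zpoly_ring\<^esub> y = x * y" "x \<oplus>\<^bsub>zpoly_ring\<^esub> y = x + y" "\<zero>\<^bsub>zpoly_ring\<^esub> = 0" "\<one>\<^bsub>zpoly_ring\<^esub> = 1"
  by (simp_all add: zpoly_ring_def)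

lemma cring_zpoly_ring: "cring zpoly_ring"
  by (intro cringI abelian_groupI comm_monoidI) (auto simp: algebra_simps intro: exI[of _ "- x" for x])

interpretation zpoly_ring: cring zpoly_ring by (rule cring_zpoly_ring)

lemma zpoly_ring_add_pow: "add_pow zpoly_ring n x = of_nat n * x" for n :: nat
  by (induction n) (simp_all add: add_pow_def algebra_simps)

lemma zpoly_ring_pow: "x [^]\<^bsub>zpoly_ring\<^esub> n = x ^ n" for n :: nat
  by (induction n) (simp_all add: algebra_simps)

lemma zpoly_ring_finsum: "finite I \<Longrightarrow> finsum zpoly_ring f I = sum f I"
  by (induction I rule: finite_induct) auto

lemma lookup_of_nat_mult: "Poly_Mapping.lookup (of_nat n * x) k = int n * Poly_Mapping.lookup x k" for x :: zpoly
  by (induction n) (simp_all add: distrib_right lookup_add)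

lemma zpoly_of_nat_mult_cancel: "of_nat n * x = of_nat n * y \<Longrightarrow> n > 0 \<Longrightarrow> x = y" for x y :: zpoly
  by (rule poly_mapping_eqI) (metis lookup_of_nat_mult mult_cancel_left of_nat_eq_0_iff less_not_refl)

section \<open>Evaluation of integer polynomials in a commutative ring\<close>

definition Var :: "nat \<times> nat \<Rightarrow> zpoly" where
  "Var i = Poly_Mapping.single (Poly_Mapping.single i 1) 1"

definition eval_mon :: "'a ring \<Rightarrow> (nat \<times> nat \<Rightarrow> 'a) \<Rightarrow> (nat \<times> nat \<Rightarrow>\<^sub>0 nat) \<Rightarrow> 'a" where
  "eval_mon A c m = (\<Otimes>\<^bsub>A\<^esub>i\<in>Poly_Mapping.keys m. c i [^]\<^bsub>A\<^esub> Poly_Mapping.lookup m i)"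

definition eval_zpoly :: "'a ring \<Rightarrow> (nat \<times> nat \<Rightarrow> 'a) \<Rightarrow> zpoly \<Rightarrow> 'a" where
  "eval_zpoly A c p = (\<Oplus>\<^bsub>A\<^esub>m\<in>Poly_Mapping.keys p. add_pow A (Poly_Mapping.lookup p m) (eval_mon A c m))"

text \<open>Peeling off one key at a time writes any finitely supported function as a sum of
  singletons; it is used for polynomials and again for the exponents of a monomial.\<close>

lemma zpoly_additive_induct:
  assumes "\<And>m k. P (Poly_Mapping.single m k)" "\<And>x y. P x \<Longrightarrow> P y \<Longrightarrow> P (x + y)"
  shows "P (p :: 'm \<Rightarrow>\<^sub>0 'k::comm_monoid_add)"
proof (induction p rule: update_induct)
  case const then show ?case using assms(1)[of undefined 0] by simp
next
  case (update f a b)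
  have "Poly_Mapping.update a b f = f + Poly_Mapping.single a b"
    using update by (intro poly_mapping_eqI) (auto simp: lookup_update lookup_add lookup_single in_keys_iff when_def)
  then show ?case using assms update by simp
qed

context
  fixes A :: "'a ring" and c :: "nat \<times> nat \<Rightarrow> 'a"
  assumes A: "cring A" and c: "\<And>i. c i \<in> carrier A"
begin

interpretation cring A by (rule A)

lemma eval_mon_closed: "eval_mon A c m \<in> carrier A"
  unfolding eval_mon_def using c by (intro finprod_closed) auto

lemma eval_mon_add: "eval_mon A c (m + m') = eval_mon A c m \<otimes>\<^bsub>A\<^esub> eval_mon A c m'"
  unfolding eval_mon_def using c
  by (intro finprod_poly_mapping_add[where f = "\<lambda>i k. c i [^]\<^bsub>A\<^esub> k"]) (auto simp: nat_pow_mult)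

lemma eval_mon_0: "eval_mon A c 0 = \<one>\<^bsub>A\<^esub>"
  by (simp add: eval_mon_def)

lemma eval_mon_single: "eval_mon A c (Poly_Mapping.single i 1) = c i"
  unfolding eval_mon_def using c finprod_poly_mapping_single[of "\<lambda>i k. c i [^]\<^bsub>A\<^esub> k" i 1] by simp

lemma eval_zpoly_closed: "eval_zpoly A c p \<in> carrier A"
  unfolding eval_zpoly_def by (intro finsum_closed) (auto simp: eval_mon_closed)

lemma eval_zpoly_add: "eval_zpoly A c (p + q) = eval_zpoly A c p \<oplus>\<^bsub>A\<^esub> eval_zpoly A c q"
  unfolding eval_zpoly_def using eval_mon_closed
  by (intro add.finprod_poly_mapping_add[where f = "\<lambda>m k. add_pow A k (eval_mon A c m)"])
    (auto simp: add.int_pow_mult add_pow_def[of A "0::int"])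

lemma eval_zpoly_single: "eval_zpoly A c (Poly_Mapping.single m k) = add_pow A k (eval_mon A c m)"
  unfolding eval_zpoly_def using eval_mon_closed
  by (intro add.finprod_poly_mapping_single[where f = "\<lambda>m k. add_pow A k (eval_mon A c m)"])
    (auto simp: add_pow_def[of A "0::int"])

lemma eval_zpoly_mult: "eval_zpoly A c (p * q) = eval_zpoly A c p \<otimes>\<^bsub>A\<^esub> eval_zpoly A c q"
proof (induction p rule: zpoly_additive_induct)
  case (1 m k)
  show ?case
  proof (induction q rule: zpoly_additive_induct)
    case (1 m' k')
    have "add_pow A (k * k') (eval_mon A c (m + m')) = add_pow A k (add_pow A k' (eval_mon A c m \<otimes>\<^bsub>A\<^esub> eval_mon A c m'))"
      using eval_mon_closed by (simp add: add.int_pow_pow eval_mon_add mult.commute)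
    also have "\<dots> = add_pow A k (eval_mon A c m) \<otimes>\<^bsub>A\<^esub> add_pow A k' (eval_mon A c m')"
      using eval_mon_closed by (simp add: add_pow_ldistr_int add_pow_rdistr_int add.int_pow_pow mult.commute)
    finally show ?case by (simp add: mult_single eval_zpoly_single)
  qed (simp add: distrib_left eval_zpoly_add eval_zpoly_closed r_distr)
qed (simp add: distrib_right eval_zpoly_add eval_zpoly_closed l_distr)

lemma eval_zpoly_hom: "eval_zpoly A c \<in> ring_hom zpoly_ring A"
proof (rule ring_hom_memI)
  have "eval_zpoly A c 1 = eval_zpoly A c (Poly_Mapping.single 0 1)" by (simp only: single_one)
  also have "\<dots> = \<one>\<^bsub>A\<^esub>" unfolding eval_zpoly_single eval_mon_0 by simp
  finally show "eval_zpoly A c \<one>\<^bsub>zpoly_ring\<^esub> = \<one>\<^bsub>A\<^esub>" by simp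
qed (simp_all add: eval_zpoly_closed eval_zpoly_add eval_zpoly_mult)

lemma eval_zpoly_Var: "eval_zpoly A c (Var i) = c i"
  unfolding Var_def eval_zpoly_single eval_mon_single using c by simp

end

text \<open>The ring is generated by 1, -1 and the variables. With -1 among the generators there is
  no induction step for negation, in which \<open>frob_cong\<close> would depend on the parity of
  \<open>p\<close>.\<close>

lemma zpoly_induct [case_names one uminus Var add mult]:
  assumes one: "P 1" and um: "P (- 1)" and var: "\<And>i. P (Var i)"
    and add: "\<And>x y. P x \<Longrightarrow> P y \<Longrightarrow> P (x + y)" and mul: "\<And>x y. P x \<Longrightarrow> P y \<Longrightarrow> P (x * y)"
  shows "P (p :: zpoly)"
proof (induction p rule: zpoly_additive_induct)
  case (1 m k)
  have zero: "P 0" using add[OF one um] by simp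
  have nat: "P (of_nat n)" for n by (induction n) (auto simp: zero one intro: add)
  have "P (of_int k)"
  proof (cases k rule: int_cases2)
    case (nonpos n) then show ?thesis using mul[OF um nat[of n]] by simp
  qed (use nat in simp)
  moreover have "P (Poly_Mapping.single m 1)"
  proof (induction m rule: zpoly_additive_induct)
    case (1 i j)
    have "P (Poly_Mapping.single (Poly_Mapping.single i j) 1)"
    proof (induction j)
      case (Suc j)
      have "Poly_Mapping.single (Poly_Mapping.single i (Suc j)) (1::int) =
        Var i * Poly_Mapping.single (Poly_Mapping.single i j) 1"
        by (simp add: Var_def mult_single single_add[symmetric])
      then show ?case using mul[OF var Suc] by simp
    qed (use one in simp)
    then show ?case .
  next
    case (2 x y)
    then show ?case using mul[OF 2] by (simp add: mult_single)
  qed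
  moreover have "Poly_Mapping.single m k = of_int k * Poly_Mapping.single m 1"
    by (simp add: single_of_int[symmetric] mult_single del: single_of_int)
  ultimately show ?case using mul by metis
qed (use add in auto)

section \<open>Frobenius lifts of the polynomial ring\<close>

definition frob :: "nat \<Rightarrow> zpoly \<Rightarrow> zpoly" where
  "frob p = eval_zpoly zpoly_ring (\<lambda>i. Var i ^ p)"

lemma frob_hom: "frob p \<in> ring_hom zpoly_ring zpoly_ring"
  unfolding frob_def by (intro eval_zpoly_hom cring_zpoly_ring) simp

lemma frob_simps: "frob p (x + y) = frob p x + frob p y" "frob p (x * y) = frob p x * frob p y" "frob p 1 = 1"
  using ring_hom_add[OF frob_hom[of p], of x y] ring_hom_mult[OF frob_hom[of p], of x y] ring_hom_one[OF frob_hom[of p]]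
  by simp_all

text \<open>The binomial coefficients strictly between the two ends are divisible by
  \<open>p\<close>.\<close>

lemma prime_dvd_power_add:
  fixes x y :: "'r::comm_ring_1"
  assumes "prime p" shows "of_nat p dvd (x + y) ^ p - x ^ p - y ^ p"
proof -
  have p0: "p > 0" using assms by (simp add: prime_gt_0_nat)
  have s: "{..p} = {0, p} \<union> {0<..<p}" using p0 by auto
  have "(x + y) ^ p = (\<Sum>k\<le>p. of_nat (p choose k) * x ^ k * y ^ (p - k))"
    by (rule binomial_ring)
  also have "\<dots> = y ^ p + x ^ p + (\<Sum>k\<in>{0<..<p}. of_nat (p choose k) * x ^ k * y ^ (p - k))"
    unfolding s using p0 by (subst sum.union_disjoint) auto
  finally have "(x + y) ^ p - x ^ p - y ^ p = (\<Sum>k\<in>{0<..<p}. of_nat (p choose k) * x ^ k * y ^ (p - k))"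
    by simp
  moreover have "of_nat p dvd of_nat (p choose k) * x ^ k * y ^ (p - k)" if "k \<in> {0<..<p}" for k
  proof -
    have "p dvd p choose k" using that assms by (intro dvd_choose_prime) auto
    then have "(of_nat p :: 'r) dvd of_nat (p choose k)" by (auto elim!: dvdE)
    then show ?thesis by (simp add: mult.assoc)
  qed
  ultimately show ?thesis by (metis (no_types, lifting) dvd_sum)
qed

text \<open>Both \<open>frob p\<close> and the p-th power are additive and multiplicative modulo
  \<open>p\<close>, so that only the generators matter.\<close>

lemma frob_cong:
  assumes "prime p" shows "of_nat p dvd frob p x - x ^ p"
proof (induction x rule: zpoly_induct)
  case uminus
  have "frob p (-1) + frob p 1 = frob p 0" using frob_simps(1)[of p "-1" 1] by simp
  moreover have "frob p 0 = 0" using frob_simps(1)[of p 0 0] by simp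
  ultimately have f: "frob p (-1) = -1" by (simp add: frob_simps(3) eq_neg_iff_add_eq_0)
  \<comment> \<open>For \<open>p = 2\<close> the two terms are -1 and 1, with difference -2; for odd
    \<open>p\<close> they coincide.\<close>
  show ?case
  proof (cases "p = 2")
    case True
    then have "frob p (-1) - (-1) ^ p = of_nat p * (- 1)" unfolding f by (simp add: True)
    then show ?thesis by (simp only: dvd_triv_left)
  next
    case False
    then have "p > 2" using prime_ge_2_nat[OF assms] by simp
    then have "odd p" using prime_odd_nat[OF assms] by simp
    then have "(- 1) ^ p = (- 1 :: zpoly)" using power_minus_odd[of p "1::zpoly"] by simp
    then show ?thesis unfolding f by (simp only: diff_self dvd_0_right)
  qed
next
  case (Var i)
  have "frob p (Var i) = Var i ^ p" unfolding frob_def by (subst eval_zpoly_Var[OF cring_zpoly_ring]) auto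
  then show ?case by simp
next
  case (add x y)
  have "frob p (x + y) - (x + y) ^ p = (frob p x - x ^ p) + (frob p y - y ^ p) - ((x + y) ^ p - x ^ p - y ^ p)"
    by (simp add: frob_simps)
  then show ?case using add prime_dvd_power_add[OF assms, of x y] by (metis dvd_add dvd_diff)
next
  case (mult x y)
  have "frob p (x * y) - (x * y) ^ p = (frob p x - x ^ p) * frob p y + x ^ p * (frob p y - y ^ p)"
    by (simp add: frob_simps algebra_simps power_mult_distrib)
  then show ?case using mult by (metis dvd_add dvd_mult dvd_mult2)
qed (simp add: frob_simps)

lemma mult_in_UNIV: "mult_in UNIV n x \<longleftrightarrow> of_nat n dvd x"
  by (auto simp: mult_in_def)

interpretation Z: frobenius_lifts UNIV frob
  by unfold_locales (auto simp: frob_simps mult_in_UNIV frob_cong)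

section \<open>Sequences of ghost components over the polynomial ring\<close>

definition dwork_seq :: "(nat \<Rightarrow> zpoly) \<Rightarrow> bool" where
  "dwork_seq b \<longleftrightarrow> (\<forall>p k m. prime p \<longrightarrow> m > 0 \<longrightarrow>
     of_nat (p ^ Suc k) dvd b (p ^ Suc k * m) - frob p (b (p ^ k * m)))"

lemma dwork_seqD: "dwork_seq b \<Longrightarrow> prime p \<Longrightarrow> m > 0 \<Longrightarrow> of_nat (p ^ Suc k) dvd b (p ^ Suc k * m) - frob p (b (p ^ k * m))"
  by (simp add: dwork_seq_def)

lemma dwork_seq_cghost: "dwork_seq (cghost u)"
  using Z.cghost_cong unfolding dwork_seq_def mult_in_UNIV by blast

lemma cghost_unghost: "dwork_seq b \<Longrightarrow> n > 0 \<Longrightarrow> cghost (unghost UNIV b) n = b n"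
  using Z.dwork[of b n] unfolding dwork_seq_def mult_in_UNIV by blast

lemma frob_diff: "frob p (x - y) = frob p x - frob p y"
  using frob_simps(1)[of p "x - y" y] by simp

lemma frob_of_nat: "frob p (of_nat n * x) = of_nat n * frob p x"
proof -
  have "frob p 0 = 0" using frob_diff[of p 0 0] by simp
  then show ?thesis by (induction n) (simp_all add: distrib_right frob_simps)
qed

lemma frob_power: "frob p (x ^ n) = frob p x ^ n"
  by (induction n) (simp_all add: frob_simps)

lemma dwork_seq_add:
  assumes b: "dwork_seq b" and c: "dwork_seq c" shows "dwork_seq (\<lambda>n. b n + c n)"
  unfolding dwork_seq_def
proof (intro allI impI)
  fix p k m :: nat assume p: "prime p" "0 < m"
  note B = dwork_seqD[OF b p, of k] and C = dwork_seqD[OF c p, of k]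
  have eq: "b (p ^ Suc k * m) + c (p ^ Suc k * m) - frob p (b (p ^ k * m) + c (p ^ k * m)) =
    (b (p ^ Suc k * m) - frob p (b (p ^ k * m))) + (c (p ^ Suc k * m) - frob p (c (p ^ k * m)))"
    by (simp add: frob_simps frob_diff algebra_simps)
  show "of_nat (p ^ Suc k) dvd b (p ^ Suc k * m) + c (p ^ Suc k * m) - frob p (b (p ^ k * m) + c (p ^ k * m))"
    unfolding eq by (intro dvd_add B C)
qed

lemma dwork_seq_diff:
  assumes b: "dwork_seq b" and c: "dwork_seq c" shows "dwork_seq (\<lambda>n. b n - c n)"
  unfolding dwork_seq_def
proof (intro allI impI)
  fix p k m :: nat assume p: "prime p" "0 < m"
  note B = dwork_seqD[OF b p, of k] and C = dwork_seqD[OF c p, of k]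
  have eq: "b (p ^ Suc k * m) - c (p ^ Suc k * m) - frob p (b (p ^ k * m) - c (p ^ k * m)) =
    (b (p ^ Suc k * m) - frob p (b (p ^ k * m))) - (c (p ^ Suc k * m) - frob p (c (p ^ k * m)))"
    by (simp add: frob_simps frob_diff algebra_simps)
  show "of_nat (p ^ Suc k) dvd b (p ^ Suc k * m) - c (p ^ Suc k * m) - frob p (b (p ^ k * m) - c (p ^ k * m))"
    unfolding eq by (intro dvd_diff B C)
qed

lemma dwork_seq_mult:
  assumes b: "dwork_seq b" and c: "dwork_seq c" shows "dwork_seq (\<lambda>n. b n * c n)"
  unfolding dwork_seq_def
proof (intro allI impI)
  fix p k m :: nat assume p: "prime p" "0 < m"
  note B = dwork_seqD[OF b p, of k] and C = dwork_seqD[OF c p, of k]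
  have eq: "b (p ^ Suc k * m) * c (p ^ Suc k * m) - frob p (b (p ^ k * m) * c (p ^ k * m)) =
    (b (p ^ Suc k * m) - frob p (b (p ^ k * m))) * c (p ^ Suc k * m) + frob p (b (p ^ k * m)) * (c (p ^ Suc k * m) - frob p (c (p ^ k * m)))"
    by (simp add: frob_simps frob_diff algebra_simps)
  show "of_nat (p ^ Suc k) dvd b (p ^ Suc k * m) * c (p ^ Suc k * m) - frob p (b (p ^ k * m) * c (p ^ k * m))"
    unfolding eq by (intro dvd_add dvd_mult dvd_mult2 B C)
qed

lemma dwork_seq_0: "dwork_seq (\<lambda>n. 0)"
  using frob_diff[of _ 0 0] by (simp add: dwork_seq_def)

lemma dwork_seq_1: "dwork_seq (\<lambda>n. 1)"
  by (simp add: dwork_seq_def frob_simps)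

text \<open>The congruences are required for all \<open>m > 0\<close>, so the factor
  \<open>n\<close> can be absorbed into \<open>m\<close>. This shift is what produces the Frobenius
  maps.\<close>

lemma dwork_seq_shift:
  assumes "dwork_seq b" "n > 0" shows "dwork_seq (\<lambda>m. b (n * m))"
  unfolding dwork_seq_def
proof (intro allI impI)
  fix p k m :: nat assume p: "prime p" "0 < m"
  have eq: "n * (p ^ Suc k * m) = p ^ Suc k * (n * m)" "n * (p ^ k * m) = p ^ k * (n * m)"
    by (simp_all only: mult.left_commute)
  show "of_nat (p ^ Suc k) dvd b (n * (p ^ Suc k * m)) - frob p (b (n * (p ^ k * m)))"
    unfolding eq using assms p by (intro dwork_seqD) auto
qed

section \<open>The ring of big Witt vectors\<close>

lemma divisor_pos: "e dvd n \<Longrightarrow> n > 0 \<Longrightarrow> e > (0::nat)"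
  by (rule dvd_pos_nat)

lemma ring_hom_nat_pow:
  assumes "ring A" "ring B" "f \<in> ring_hom A B" "x \<in> carrier A"
  shows "f (x [^]\<^bsub>A\<^esub> (n::nat)) = f x [^]\<^bsub>B\<^esub> n"
proof -
  interpret ring_hom_ring A B f using assms by (intro ring_hom_ringI2)
  show ?thesis using assms by (simp add: hom_nat_pow)
qed

lemma ring_hom_add_pow:
  assumes "ring A" "ring B" "f \<in> ring_hom A B" "x \<in> carrier A"
  shows "f (add_pow A (n::nat) x) = add_pow B n (f x)"
proof -
  interpret A: ring A by fact
  have "f (\<zero>\<^bsub>A\<^esub>) = \<zero>\<^bsub>B\<^esub>" using assms by (intro ring_hom_zero)
  then show ?thesis
    using assms ring_hom_closed[OF assms(3)]
    by (induction n) (auto simp: add_pow_def ring_hom_add[OF assms(3)] A.add.nat_pow_closed[unfolded add_pow_def])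
qed

lemma ring_hom_finsum:
  assumes "cring A" "cring B" "f \<in> ring_hom A B" "g \<in> I \<rightarrow> carrier A"
  shows "f (finsum A g I) = finsum B (\<lambda>i. f (g i)) I"
proof -
  interpret ring_hom_cring A B f using assms by (intro ring_hom_cring.intro ring_hom_cring_axioms.intro)
  show ?thesis using hom_finsum[OF assms(4)] by (simp add: comp_def)
qed

section \<open>Witt vectors as sequences, and injectivity of the ghost map\<close>

definition witt_seqs :: "('a, 'k) ring_scheme \<Rightarrow> (nat \<Rightarrow> 'a) set" where
  "witt_seqs A = ({0<..} \<rightarrow>\<^sub>E carrier A)"

lemma witt_seqs_apply [simp]: "a \<in> witt_seqs A \<Longrightarrow> n > 0 \<Longrightarrow> a n \<in> carrier A"
  by (auto simp: witt_seqs_def)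

lemma witt_seqs_restrict: "(\<And>n. n > 0 \<Longrightarrow> f n \<in> carrier A) \<Longrightarrow> (\<lambda>n\<in>{0<..}. f n) \<in> witt_seqs A"
  by (auto simp: witt_seqs_def)

lemma witt_seqs_eqI: "a \<in> witt_seqs A \<Longrightarrow> b \<in> witt_seqs B \<Longrightarrow> (\<And>n. n > 0 \<Longrightarrow> a n = b n) \<Longrightarrow> a = b"
  unfolding witt_seqs_def by (rule ext) (metis PiE_arb greaterThan_iff)

definition torsion_free :: "'a ring \<Rightarrow> bool" where
  "torsion_free A \<longleftrightarrow> (\<forall>n>0. \<forall>x\<in>carrier A. add_pow A (n::nat) x = \<zero>\<^bsub>A\<^esub> \<longrightarrow> x = \<zero>\<^bsub>A\<^esub>)"

lemma witt_map_closed: "(\<And>x. x \<in> carrier A \<Longrightarrow> f x \<in> carrier B) \<Longrightarrow> a \<in> witt_seqs A \<Longrightarrow> witt_map f a \<in> witt_seqs B"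
  unfolding witt_map_def by (rule witt_seqs_restrict) simp

lemma witt_map_hom_closed: "f \<in> ring_hom A B \<Longrightarrow> a \<in> witt_seqs A \<Longrightarrow> witt_map f a \<in> witt_seqs B"
  by (rule witt_map_closed) (auto simp: ring_hom_closed)

lemma witt_map_apply: "n > 0 \<Longrightarrow> witt_map f a n = f (a n)"
  by (simp add: witt_map_def)

lemma witt_map_comp: "witt_map f (witt_map g a) = witt_map (\<lambda>x. f (g x)) a"
  by (auto simp: witt_map_def)

lemma witt_map_cong: "(\<And>n. n > 0 \<Longrightarrow> f (a n) = g (a n)) \<Longrightarrow> witt_map f a = witt_map g a"
  by (auto simp: witt_map_def)

context
  fixes A :: "'a ring" assumes A: "cring A"
begin

interpretation cring A by (rule A)

lemma ghost_term_closed: "a \<in> witt_seqs A \<Longrightarrow> e > 0 \<Longrightarrow> add_pow A e (a e [^]\<^bsub>A\<^esub> k) \<in> carrier A" for e k :: nat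
  by auto

lemma ghost_closed: "a \<in> witt_seqs A \<Longrightarrow> n > 0 \<Longrightarrow> ghost A n a \<in> carrier A"
  unfolding ghost_def by (rule finsum_closed) (auto intro!: ghost_term_closed dest: divisor_pos)

text \<open>The summand for \<open>e = n\<close> is linear in \<open>a n\<close> and the others
  involve only coordinates at proper divisors, so that coordinates can be recovered
  recursively.\<close>

lemma ghost_split:
  assumes "a \<in> witt_seqs A" "n > 0"
  shows "ghost A n a = add_pow A n (a n) \<oplus>\<^bsub>A\<^esub>
    (\<Oplus>\<^bsub>A\<^esub>e\<in>{e. e dvd n \<and> e < n}. add_pow A e (a e [^]\<^bsub>A\<^esub> (n div e)))"
proof -
  let ?f = "\<lambda>e. add_pow A e (a e [^]\<^bsub>A\<^esub> (n div e))"
  have split: "{d. d dvd n} = insert n {d. d dvd n \<and> d < n}"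
    using assms(2) by (auto dest: dvd_imp_le)
  have an: "a n \<in> carrier A" using assms by auto
  have "?f e \<in> carrier A" if "e dvd n" for e
    using assms divisor_pos[OF that] by (intro ghost_term_closed)
  then have c: "?f \<in> {d. d dvd n \<and> d < n} \<rightarrow> carrier A" by blast
  have fn: "?f n = add_pow A n (a n)" using assms(2) an by simp
  have "finsum A ?f (insert n {d. d dvd n \<and> d < n}) = ?f n \<oplus>\<^bsub>A\<^esub> finsum A ?f {d. d dvd n \<and> d < n}"
    using c an by (intro finsum_insert) (auto intro!: add.nat_pow_closed)
  then show ?thesis unfolding ghost_def split fn .
qed

lemma ghost_1: "a \<in> witt_seqs A \<Longrightarrow> ghost A 1 a = a 1"
proof -
  assume a: "a \<in> witt_seqs A"
  have "{e. e dvd (1::nat) \<and> e < 1} = {}" by auto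
  then have "ghost A 1 a = add_pow A (1::nat) (a 1) \<oplus>\<^bsub>A\<^esub> \<zero>\<^bsub>A\<^esub>"
    by (simp only: ghost_split[OF a zero_less_one] finsum_empty)
  moreover have "a 1 \<in> carrier A" using a by auto
  ultimately show ?thesis by simp
qed

text \<open>By induction the summands at proper divisors agree, which leaves \<open>n\<close> times
  \<open>a n\<close> equal to \<open>n\<close> times \<open>b n\<close>.\<close>

lemma ghost_inj:
  assumes "torsion_free A" "a \<in> witt_seqs A" "b \<in> witt_seqs A" "\<And>n. n > 0 \<Longrightarrow> ghost A n a = ghost A n b"
  shows "a = b"
proof (rule witt_seqs_eqI[OF assms(2,3)])
  fix n :: nat assume "n > 0"
  then show "a n = b n"
  proof (induction n rule: less_induct)
    case (less n)
    let ?s = "\<lambda>a. \<Oplus>\<^bsub>A\<^esub>e\<in>{e. e dvd n \<and> e < n}. add_pow A e (a e [^]\<^bsub>A\<^esub> (n div e))"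
    have cl: "?s a \<in> carrier A"
      using assms less.prems by (intro finsum_closed) (auto intro!: ghost_term_closed dest: divisor_pos)
    have "?s a = ?s b"
      using assms less by (intro finsum_cong') (auto intro!: ghost_term_closed dest: divisor_pos)
    moreover have "a n \<in> carrier A" "b n \<in> carrier A" using assms less.prems by auto
    ultimately have eq: "add_pow A n (a n) = add_pow A n (b n)"
      using assms(4)[OF less.prems] cl ghost_split[OF assms(2) less.prems] ghost_split[OF assms(3) less.prems] by simp
    have ab: "a n \<in> carrier A" "b n \<in> carrier A" using assms less.prems by auto
    have "add_pow A n (a n \<oplus>\<^bsub>A\<^esub> \<ominus>\<^bsub>A\<^esub> b n) = add_pow A n (a n) \<oplus>\<^bsub>A\<^esub> add_pow A n (\<ominus>\<^bsub>A\<^esub> b n)"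
      using ab by (simp add: add.nat_pow_distrib)
    also have "\<dots> = add_pow A n (a n) \<oplus>\<^bsub>A\<^esub> \<ominus>\<^bsub>A\<^esub> add_pow A n (b n)"
      using ab by (simp add: add.nat_pow_inv)
    also have "\<dots> = \<zero>\<^bsub>A\<^esub>" using ab by (simp add: eq r_neg)
    finally have "a n \<oplus>\<^bsub>A\<^esub> \<ominus>\<^bsub>A\<^esub> b n = \<zero>\<^bsub>A\<^esub>"
      using assms(1) ab less.prems unfolding torsion_free_def by blast
    then have "a n \<oplus>\<^bsub>A\<^esub> \<ominus>\<^bsub>A\<^esub> b n = b n \<oplus>\<^bsub>A\<^esub> \<ominus>\<^bsub>A\<^esub> b n" using ab by (simp add: r_neg)
    then show "a n = b n" using ab by (simp only: add.right_cancel a_inv_closed)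
  qed
qed

end

lemma ghost_hom:
  assumes "cring A" "cring B" "f \<in> ring_hom A B" "a \<in> witt_seqs A" "n > 0"
  shows "f (ghost A n a) = ghost B n (witt_map f a)"
proof -
  have r: "ring A" "ring B" using assms cring.axioms by auto
  interpret B: cring B by fact
  have a: "a e \<in> carrier A" if "e dvd n" for e using that assms by (auto dest: divisor_pos)
  have "f (ghost A n a) = (\<Oplus>\<^bsub>B\<^esub>e\<in>{e. e dvd n}. f (add_pow A e (a e [^]\<^bsub>A\<^esub> (n div e))))"
    unfolding ghost_def using assms
    by (intro ring_hom_finsum) (auto intro!: ghost_term_closed dest: divisor_pos)
  also have "\<dots> = ghost B n (witt_map f a)"
    unfolding ghost_def
  proof (intro B.finsum_cong' refl)
    fix e assume "e \<in> {e. e dvd n}"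
    then have e: "e > 0" "a e \<in> carrier A" using a assms by (auto dest: divisor_pos)
    then have fe: "f (a e) \<in> carrier B" using assms ring_hom_closed by metis
    interpret A: cring A by fact
    show "f (add_pow A e (a e [^]\<^bsub>A\<^esub> (n div e))) = add_pow B e (witt_map f a e [^]\<^bsub>B\<^esub> (n div e))"
      using e assms r by (simp add: witt_map_apply ring_hom_add_pow ring_hom_nat_pow)
  qed (use assms a in \<open>auto intro!: B.add.nat_pow_closed simp: witt_map_apply ring_hom_closed[OF assms(3)] dest: divisor_pos\<close>)
  finally show ?thesis .
qed

lemma torsion_free_zpoly_ring: "torsion_free zpoly_ring"
  unfolding torsion_free_def using zpoly_of_nat_mult_cancel[of _ _ 0] by (auto simp: zpoly_ring_add_pow)

text \<open>Passage from ring records to the arithmetic of the type class, in which Dwork's lemma is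
  stated.\<close>

lemma ghost_zpoly_ring: "n > 0 \<Longrightarrow> ghost zpoly_ring n u = cghost u n"
  unfolding ghost_def cghost_def by (simp add: zpoly_ring_finsum zpoly_ring_add_pow zpoly_ring_pow)

lemma cghost_restrict: "n > 0 \<Longrightarrow> cghost (restrict u {0<..}) n = cghost u n"
  unfolding cghost_def by (intro sum.cong) (auto dest: divisor_pos)

section \<open>Generic Witt vectors and universal operations\<close>

lemma zpoly_ring_hom_ext:
  assumes "cring B" "h \<in> ring_hom zpoly_ring B" "h' \<in> ring_hom zpoly_ring B" "\<And>i. h (Var i) = h' (Var i)"
  shows "h x = h' x"
proof -
  interpret H: ring_hom_cring zpoly_ring B h using assms cring_zpoly_ring by (intro ring_hom_cring.intro ring_hom_cring_axioms.intro)
  interpret H': ring_hom_cring zpoly_ring B h' using assms cring_zpoly_ring by (intro ring_hom_cring.intro ring_hom_cring_axioms.intro)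
  have m1: "\<ominus>\<^bsub>zpoly_ring\<^esub> \<one>\<^bsub>zpoly_ring\<^esub> = - 1" by (rule zpoly_ring.minus_equality) auto
  show ?thesis
  proof (induction x rule: zpoly_induct)
    case uminus
    show ?case using H.hom_a_inv[of "\<one>\<^bsub>zpoly_ring\<^esub>"] H'.hom_a_inv[of "\<one>\<^bsub>zpoly_ring\<^esub>"] H.hom_one H'.hom_one
      unfolding m1 by simp
  next
    case one show ?case using H.hom_one H'.hom_one by simp
  next
    case (add x y) then show ?case using H.hom_add[of x y] H'.hom_add[of x y] by simp
  next
    case (mult x y) then show ?case using H.hom_mult[of x y] H'.hom_mult[of x y] by simp
  qed (rule assms)
qed

text \<open>Indices of Witt vectors start at 1 and those of variables at 0.\<close>

definition gen :: "nat \<Rightarrow> nat \<Rightarrow> zpoly" where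
  "gen j = (\<lambda>n\<in>{0<..}. Var (j, n - 1))"

definition eval_gens :: "'a ring \<Rightarrow> (nat \<Rightarrow> nat \<Rightarrow> 'a) \<Rightarrow> zpoly \<Rightarrow> 'a" where
  "eval_gens A as = eval_zpoly A (\<lambda>(j, i). as j (Suc i))"

lemma gen_witt_seqs: "gen j \<in> witt_seqs zpoly_ring"
  unfolding gen_def by (rule witt_seqs_restrict) simp

lemma eval_gens_hom: "cring A \<Longrightarrow> (\<And>j. as j \<in> witt_seqs A) \<Longrightarrow> eval_gens A as \<in> ring_hom zpoly_ring A"
  unfolding eval_gens_def by (rule eval_zpoly_hom) (auto split: prod.splits)

lemma eval_gens_Var: "cring A \<Longrightarrow> (\<And>j. as j \<in> witt_seqs A) \<Longrightarrow> eval_gens A as (Var (j, i)) = as j (Suc i)"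
  unfolding eval_gens_def by (subst eval_zpoly_Var) (auto split: prod.splits)

lemma witt_map_eval_gens_gen:
  assumes "cring A" "\<And>j. as j \<in> witt_seqs A"
  shows "witt_map (eval_gens A as) (gen j) = as j"
proof (rule witt_seqs_eqI[OF witt_map_hom_closed[OF eval_gens_hom[OF assms] gen_witt_seqs] assms(2)])
  show "n > 0 \<Longrightarrow> witt_map (eval_gens A as) (gen j) n = as j n" for n
    by (simp add: gen_def witt_map_def eval_gens_Var[OF assms])
qed

lemma eval_gens_natural:
  assumes "cring A" "cring B" "f \<in> ring_hom A B" "\<And>j. as j \<in> witt_seqs A"
  shows "f (eval_gens A as x) = eval_gens B (\<lambda>j. witt_map f (as j)) x"
proof -
  have "(f \<circ> eval_gens A as) x = eval_gens B (\<lambda>j. witt_map f (as j)) x"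
  proof (rule zpoly_ring_hom_ext)
    show "f \<circ> eval_gens A as \<in> ring_hom zpoly_ring B"
      using assms eval_gens_hom ring_hom_trans by blast
    show "eval_gens B (\<lambda>j. witt_map f (as j)) \<in> ring_hom zpoly_ring B"
      using assms by (intro eval_gens_hom witt_map_hom_closed)
    fix i :: "nat \<times> nat"
    obtain j k where i: "i = (j, k)" by (cases i)
    have "\<And>j. witt_map f (as j) \<in> witt_seqs B" using assms witt_map_hom_closed by blast
    then show "(f \<circ> eval_gens A as) (Var i) = eval_gens B (\<lambda>j. witt_map f (as j)) (Var i)"
      unfolding i comp_def using assms by (simp add: eval_gens_Var witt_map_apply)
  qed fact
  then show ?thesis by simp
qed

text \<open>The natural operation on families \<open>as\<close> of Witt vectors whose \<open>n\<close>-th ghost component is the polynomial \<open>b n\<close>,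
  provided that \<open>b\<close> satisfies Dwork's congruences.\<close>

definition witt_op :: "'a ring \<Rightarrow> (nat \<Rightarrow> zpoly) \<Rightarrow> (nat \<Rightarrow> nat \<Rightarrow> 'a) \<Rightarrow> nat \<Rightarrow> 'a" where
  "witt_op A b as = (\<lambda>n\<in>{0<..}. eval_gens A as (unghost UNIV b n))"

lemma witt_op_witt_map: "witt_op A b as = witt_map (eval_gens A as) (restrict (unghost UNIV b) {0<..})"
  by (auto simp: witt_op_def witt_map_def)

lemma restrict_witt_seqs_zpoly_ring: "restrict u {0<..} \<in> witt_seqs zpoly_ring"
  by (rule witt_seqs_restrict) simp

lemma witt_op_closed:
  assumes "cring A" "\<And>j. as j \<in> witt_seqs A" shows "witt_op A b as \<in> witt_seqs A"
  unfolding witt_op_witt_map by (rule witt_map_hom_closed[OF eval_gens_hom[OF assms] restrict_witt_seqs_zpoly_ring])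

lemma witt_op_natural:
  "cring A \<Longrightarrow> cring B \<Longrightarrow> f \<in> ring_hom A B \<Longrightarrow> (\<And>j. as j \<in> witt_seqs A) \<Longrightarrow>
   witt_map f (witt_op A b as) = witt_op B b (\<lambda>j. witt_map f (as j))"
  unfolding witt_op_def witt_map_def by (auto simp: eval_gens_natural witt_map_def)

text \<open>Over the polynomial ring this is \<open>cghost_unghost\<close>; the evaluation
  homomorphism carries it to \<open>A\<close>.\<close>

lemma ghost_witt_op:
  assumes "cring A" "\<And>j. as j \<in> witt_seqs A" "dwork_seq b" "n > 0"
  shows "ghost A n (witt_op A b as) = eval_gens A as (b n)"
proof -
  have "eval_gens A as (ghost zpoly_ring n (restrict (unghost UNIV b) {0<..})) = ghost A n (witt_op A b as)"
    unfolding witt_op_witt_map using assms by (intro ghost_hom cring_zpoly_ring eval_gens_hom restrict_witt_seqs_zpoly_ring) auto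
  then show ?thesis using assms by (simp add: ghost_zpoly_ring cghost_restrict cghost_unghost)
qed

lemma eval_gens_ghost_gen:
  assumes "cring A" "\<And>j. as j \<in> witt_seqs A" "n > 0"
  shows "eval_gens A as (cghost (gen j) n) = ghost A n (as j)"
  using ghost_hom[OF cring_zpoly_ring assms(1) eval_gens_hom[OF assms(1,2)] gen_witt_seqs[of j] assms(3)] assms
  by (simp add: ghost_zpoly_ring witt_map_eval_gens_gen)

section \<open>The ring structure on Witt vectors\<close>

definition seq3 :: "'b \<Rightarrow> 'b \<Rightarrow> 'b \<Rightarrow> nat \<Rightarrow> 'b" where
  "seq3 a b c j = (if j = 0 then a else if j = 1 then b else c)"

lemma witt_map_seq3: "witt_map f (seq3 a b c j) = seq3 (witt_map f a) (witt_map f b) (witt_map f c) j"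
  by (simp add: seq3_def)

text \<open>Each operation is the universal one with the prescribed ghost components. As
  \<open>witt_op\<close> expects an infinite family of vectors, \<open>seq3\<close> fills it up with
  the last one, and the constants are given the zero sequence throughout.\<close>

definition witt_ring :: "'a ring \<Rightarrow> (nat \<Rightarrow> 'a) ring" where
  "witt_ring A = \<lparr>carrier = witt_seqs A,
     monoid.mult = \<lambda>a b. witt_op A (\<lambda>n. cghost (gen 0) n * cghost (gen 1) n) (seq3 a b b),
     one = witt_op A (\<lambda>n. 1) (\<lambda>_. \<lambda>n\<in>{0<..}. \<zero>\<^bsub>A\<^esub>),
     ring.zero = witt_op A (\<lambda>n. 0) (\<lambda>_. \<lambda>n\<in>{0<..}. \<zero>\<^bsub>A\<^esub>),
     ring.add = \<lambda>a b. witt_op A (\<lambda>n. cghost (gen 0) n + cghost (gen 1) n) (seq3 a b b)\<rparr>"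

definition witt_ring_neg :: "'a ring \<Rightarrow> (nat \<Rightarrow> 'a) \<Rightarrow> nat \<Rightarrow> 'a" where
  "witt_ring_neg A a = witt_op A (\<lambda>n. 0 - cghost (gen 0) n) (\<lambda>_. a)"

lemma carrier_witt_ring: "carrier (witt_ring A) = witt_seqs A"
  by (simp add: witt_ring_def witt_seqs_def)

lemma witt_ring_ops:
  "\<zero>\<^bsub>witt_ring A\<^esub> = witt_op A (\<lambda>n. 0) (\<lambda>_. \<lambda>n\<in>{0<..}. \<zero>\<^bsub>A\<^esub>)"
  "\<one>\<^bsub>witt_ring A\<^esub> = witt_op A (\<lambda>n. 1) (\<lambda>_. \<lambda>n\<in>{0<..}. \<zero>\<^bsub>A\<^esub>)"
  "a \<oplus>\<^bsub>witt_ring A\<^esub> b = witt_op A (\<lambda>n. cghost (gen 0) n + cghost (gen 1) n) (seq3 a b b)"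
  "a \<otimes>\<^bsub>witt_ring A\<^esub> b = witt_op A (\<lambda>n. cghost (gen 0) n * cghost (gen 1) n) (seq3 a b b)"
  by (simp_all add: witt_ring_def)

lemma seq3_in: "a \<in> S \<Longrightarrow> b \<in> S \<Longrightarrow> c \<in> S \<Longrightarrow> seq3 a b c j \<in> S"
  by (simp add: seq3_def)

context
  fixes A :: "'a ring" assumes A: "cring A"
begin

interpretation cring A by (rule A)

lemma zero_seq_witt_seqs: "(\<lambda>n\<in>{0<..}. \<zero>\<^bsub>A\<^esub>) \<in> witt_seqs A"
  by (rule witt_seqs_restrict) simp

lemma witt_ring_closed:
  "\<zero>\<^bsub>witt_ring A\<^esub> \<in> witt_seqs A" "\<one>\<^bsub>witt_ring A\<^esub> \<in> witt_seqs A" "a \<in> witt_seqs A \<Longrightarrow> b \<in> witt_seqs A \<Longrightarrow> a \<oplus>\<^bsub>witt_ring A\<^esub> b \<in> witt_seqs A"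
  "a \<in> witt_seqs A \<Longrightarrow> b \<in> witt_seqs A \<Longrightarrow> a \<otimes>\<^bsub>witt_ring A\<^esub> b \<in> witt_seqs A" "a \<in> witt_seqs A \<Longrightarrow> witt_ring_neg A a \<in> witt_seqs A"
  by (simp_all only: witt_ring_ops witt_ring_neg_def witt_op_closed A zero_seq_witt_seqs seq3_in)

lemma eval_gens_simps:
  assumes "\<And>j. as j \<in> witt_seqs A"
  shows "eval_gens A as (x + y) = eval_gens A as x \<oplus>\<^bsub>A\<^esub> eval_gens A as y" "eval_gens A as (x * y) = eval_gens A as x \<otimes>\<^bsub>A\<^esub> eval_gens A as y"
    "eval_gens A as 0 = \<zero>\<^bsub>A\<^esub>" "eval_gens A as 1 = \<one>\<^bsub>A\<^esub>" "eval_gens A as (0 - y) = \<ominus>\<^bsub>A\<^esub> eval_gens A as y" "eval_gens A as x \<in> carrier A"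
proof -
  interpret H: ring_hom_cring zpoly_ring A "eval_gens A as"
    using assms cring_zpoly_ring A by (intro ring_hom_cring.intro ring_hom_cring_axioms.intro eval_gens_hom)
  have m: "\<ominus>\<^bsub>zpoly_ring\<^esub> y = 0 - y" by (rule zpoly_ring.minus_equality) auto
  show "eval_gens A as (x + y) = eval_gens A as x \<oplus>\<^bsub>A\<^esub> eval_gens A as y" "eval_gens A as (x * y) = eval_gens A as x \<otimes>\<^bsub>A\<^esub> eval_gens A as y"
    "eval_gens A as 0 = \<zero>\<^bsub>A\<^esub>" "eval_gens A as 1 = \<one>\<^bsub>A\<^esub>" "eval_gens A as (0 - y) = \<ominus>\<^bsub>A\<^esub> eval_gens A as y" "eval_gens A as x \<in> carrier A"
    using H.hom_add[of x y] H.hom_mult[of x y] H.hom_zero H.hom_one H.hom_a_inv[of y] H.hom_closed[of x] unfolding m by auto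
qed

lemma ghost_witt_ring:
  assumes "n > 0"
  shows "ghost A n \<zero>\<^bsub>witt_ring A\<^esub> = \<zero>\<^bsub>A\<^esub>" "ghost A n \<one>\<^bsub>witt_ring A\<^esub> = \<one>\<^bsub>A\<^esub>"
    "a \<in> witt_seqs A \<Longrightarrow> b \<in> witt_seqs A \<Longrightarrow> ghost A n (a \<oplus>\<^bsub>witt_ring A\<^esub> b) = ghost A n a \<oplus>\<^bsub>A\<^esub> ghost A n b"
    "a \<in> witt_seqs A \<Longrightarrow> b \<in> witt_seqs A \<Longrightarrow> ghost A n (a \<otimes>\<^bsub>witt_ring A\<^esub> b) = ghost A n a \<otimes>\<^bsub>A\<^esub> ghost A n b"
    "a \<in> witt_seqs A \<Longrightarrow> ghost A n (witt_ring_neg A a) = \<ominus>\<^bsub>A\<^esub> ghost A n a"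
proof -
  note D = dwork_seq_0 dwork_seq_1 dwork_seq_add dwork_seq_mult dwork_seq_diff dwork_seq_cghost
  show "ghost A n \<zero>\<^bsub>witt_ring A\<^esub> = \<zero>\<^bsub>A\<^esub>" "ghost A n \<one>\<^bsub>witt_ring A\<^esub> = \<one>\<^bsub>A\<^esub>"
    unfolding witt_ring_ops using assms zero_seq_witt_seqs
    by (simp_all add: ghost_witt_op[OF A] D eval_gens_simps)
  show "ghost A n (witt_ring_neg A a) = \<ominus>\<^bsub>A\<^esub> ghost A n a" if a: "a \<in> witt_seqs A"
    unfolding witt_ring_neg_def using assms a
    by (subst ghost_witt_op[OF A]) (auto simp only: eval_gens_simps eval_gens_ghost_gen[OF A] intro!: D)
  assume ab: "a \<in> witt_seqs A" "b \<in> witt_seqs A"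
  have s: "seq3 a b b j \<in> witt_seqs A" for j using ab by (auto simp: seq3_def)
  have e: "eval_gens A (seq3 a b b) (cghost (gen 0) n) = ghost A n a" "eval_gens A (seq3 a b b) (cghost (gen 1) n) = ghost A n b"
    using eval_gens_ghost_gen[OF A, of "seq3 a b b", OF s assms] by (simp_all add: seq3_def)
  show "ghost A n (a \<oplus>\<^bsub>witt_ring A\<^esub> b) = ghost A n a \<oplus>\<^bsub>A\<^esub> ghost A n b"
    "ghost A n (a \<otimes>\<^bsub>witt_ring A\<^esub> b) = ghost A n a \<otimes>\<^bsub>A\<^esub> ghost A n b"
    unfolding witt_ring_ops using assms
    by (simp_all add: ghost_witt_op[OF A, of "seq3 a b b", OF s] D eval_gens_simps[of "seq3 a b b", OF s] e[simplified])
qed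

lemma witt_ring_natural:
  assumes "cring B" "f \<in> ring_hom A B"
  shows "witt_map f \<zero>\<^bsub>witt_ring A\<^esub> = \<zero>\<^bsub>witt_ring B\<^esub>" "witt_map f \<one>\<^bsub>witt_ring A\<^esub> = \<one>\<^bsub>witt_ring B\<^esub>"
    "a \<in> witt_seqs A \<Longrightarrow> b \<in> witt_seqs A \<Longrightarrow> witt_map f (a \<oplus>\<^bsub>witt_ring A\<^esub> b) = witt_map f a \<oplus>\<^bsub>witt_ring B\<^esub> witt_map f b"
    "a \<in> witt_seqs A \<Longrightarrow> b \<in> witt_seqs A \<Longrightarrow> witt_map f (a \<otimes>\<^bsub>witt_ring A\<^esub> b) = witt_map f a \<otimes>\<^bsub>witt_ring B\<^esub> witt_map f b"
    "a \<in> witt_seqs A \<Longrightarrow> witt_map f (witt_ring_neg A a) = witt_ring_neg B (witt_map f a)"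
proof -
  interpret B: cring B by fact
  have z: "witt_map f (\<lambda>n\<in>{0<..}. \<zero>\<^bsub>A\<^esub>) = (\<lambda>n\<in>{0<..}. \<zero>\<^bsub>B\<^esub>)"
    using assms ring_hom_zero[OF assms(2)] B.ring_axioms ring_axioms by (auto simp: witt_map_def)
  show "witt_map f \<zero>\<^bsub>witt_ring A\<^esub> = \<zero>\<^bsub>witt_ring B\<^esub>" "witt_map f \<one>\<^bsub>witt_ring A\<^esub> = \<one>\<^bsub>witt_ring B\<^esub>"
    unfolding witt_ring_ops using assms zero_seq_witt_seqs by (simp_all add: witt_op_natural[OF A] z)
  show "witt_map f (witt_ring_neg A a) = witt_ring_neg B (witt_map f a)" if a: "a \<in> witt_seqs A"
    unfolding witt_ring_neg_def using assms a by (subst witt_op_natural[OF A]) auto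
  assume ab: "a \<in> witt_seqs A" "b \<in> witt_seqs A"
  have s: "seq3 a b b j \<in> witt_seqs A" for j using ab by (auto simp: seq3_def)
  have t: "(\<lambda>j. witt_map f (seq3 a b b j)) = seq3 (witt_map f a) (witt_map f b) (witt_map f b)"
    by (simp add: witt_map_seq3 fun_eq_iff)
  show "witt_map f (a \<oplus>\<^bsub>witt_ring A\<^esub> b) = witt_map f a \<oplus>\<^bsub>witt_ring B\<^esub> witt_map f b"
    "witt_map f (a \<otimes>\<^bsub>witt_ring A\<^esub> b) = witt_map f a \<otimes>\<^bsub>witt_ring B\<^esub> witt_map f b"
    unfolding witt_ring_ops using assms by (simp_all add: witt_op_natural[OF A, of _ _ "seq3 a b b", OF _ _ s] t)
qed

text \<open>Every triple of Witt vectors is the image of three generic ones. Three are enough, since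
  no ring axiom involves more.\<close>

lemma lift3:
  assumes "a \<in> witt_seqs A" "b \<in> witt_seqs A" "c \<in> witt_seqs A"
  obtains h where "h \<in> ring_hom zpoly_ring A" "witt_map h (gen 0) = a" "witt_map h (gen 1) = b" "witt_map h (gen 2) = c"
proof
  have s: "seq3 a b c j \<in> witt_seqs A" for j using assms by (auto simp: seq3_def)
  show "eval_gens A (seq3 a b c) \<in> ring_hom zpoly_ring A" using A s by (intro eval_gens_hom)
  show "witt_map (eval_gens A (seq3 a b c)) (gen 0) = a" "witt_map (eval_gens A (seq3 a b c)) (gen 1) = b"
    "witt_map (eval_gens A (seq3 a b c)) (gen 2) = c"
    using witt_map_eval_gens_gen[OF A, of "seq3 a b c", OF s] by (simp_all add: seq3_def)
qed

end

text \<open>After applying a ghost component, each axiom becomes the same axiom in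
  \<open>A\<close>.\<close>

lemma cring_witt_ring_torsion_free:
  assumes A: "cring A" and tf: "torsion_free A"
  shows "cring (witt_ring A)" "a \<in> witt_seqs A \<Longrightarrow> witt_ring_neg A a \<oplus>\<^bsub>witt_ring A\<^esub> a = \<zero>\<^bsub>witt_ring A\<^esub>"
proof -
  interpret cring A by fact
  note [simp] = ghost_witt_ring[OF A] witt_ring_closed[OF A] ghost_closed[OF A] carrier_witt_ring
  have neg: "witt_ring_neg A a \<oplus>\<^bsub>witt_ring A\<^esub> a = \<zero>\<^bsub>witt_ring A\<^esub>" if "a \<in> witt_seqs A" for a
    by (rule ghost_inj[OF A tf]) (use that in \<open>auto simp: l_neg\<close>)
  then show "a \<in> witt_seqs A \<Longrightarrow> witt_ring_neg A a \<oplus>\<^bsub>witt_ring A\<^esub> a = \<zero>\<^bsub>witt_ring A\<^esub>" .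
  show "cring (witt_ring A)"
  proof (intro cringI abelian_groupI comm_monoidI)
    fix a assume "a \<in> carrier (witt_ring A)"
    then show "\<exists>y\<in>carrier (witt_ring A). y \<oplus>\<^bsub>witt_ring A\<^esub> a = \<zero>\<^bsub>witt_ring A\<^esub>"
      using neg[of a] witt_ring_closed(5)[OF A, of a] unfolding carrier_witt_ring by blast
  qed (simp_all, (rule ghost_inj[OF A tf]; simp add: a_ac m_ac r_distr)+)
qed

lemma cring_witt_ring:
  assumes A: "cring A"
  shows "cring (witt_ring A)" "a \<in> witt_seqs A \<Longrightarrow> witt_ring_neg A a \<oplus>\<^bsub>witt_ring A\<^esub> a = \<zero>\<^bsub>witt_ring A\<^esub>"
proof -
  interpret Z: cring "witt_ring zpoly_ring" by (rule cring_witt_ring_torsion_free(1)[OF cring_zpoly_ring torsion_free_zpoly_ring])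
  have Zneg: "witt_ring_neg zpoly_ring a \<oplus>\<^bsub>witt_ring zpoly_ring\<^esub> a = \<zero>\<^bsub>witt_ring zpoly_ring\<^esub>" if "a \<in> witt_seqs zpoly_ring" for a
    by (rule cring_witt_ring_torsion_free(2)[OF cring_zpoly_ring torsion_free_zpoly_ring that])
  note [simp] = witt_ring_closed[OF A]
  have g: "gen j \<in> carrier (witt_ring zpoly_ring)" for j by (simp only: carrier_witt_ring gen_witt_seqs)
  have cl: "a \<in> carrier (witt_ring zpoly_ring) \<Longrightarrow> b \<in> carrier (witt_ring zpoly_ring) \<Longrightarrow> a \<oplus>\<^bsub>witt_ring zpoly_ring\<^esub> b \<in> witt_seqs zpoly_ring"
    "a \<in> carrier (witt_ring zpoly_ring) \<Longrightarrow> b \<in> carrier (witt_ring zpoly_ring) \<Longrightarrow> a \<otimes>\<^bsub>witt_ring zpoly_ring\<^esub> b \<in> witt_seqs zpoly_ring"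
    "\<zero>\<^bsub>witt_ring zpoly_ring\<^esub> \<in> witt_seqs zpoly_ring" "\<one>\<^bsub>witt_ring zpoly_ring\<^esub> \<in> witt_seqs zpoly_ring" for a b
    using Z.a_closed Z.m_closed by (auto simp only: carrier_witt_ring witt_ring_closed[OF cring_zpoly_ring])
  have neg: "witt_ring_neg A a \<oplus>\<^bsub>witt_ring A\<^esub> a = \<zero>\<^bsub>witt_ring A\<^esub>" if a: "a \<in> witt_seqs A" for a
  proof -
    from lift3[OF A a a a] obtain h where h: "h \<in> ring_hom zpoly_ring A" "witt_map h (gen 0) = a" by metis
    show ?thesis
      using arg_cong[OF Zneg[OF gen_witt_seqs[of 0]], of "witt_map h"] h witt_ring_natural[OF cring_zpoly_ring A h(1)] gen_witt_seqs witt_ring_closed[OF cring_zpoly_ring]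
      by metis
  qed
  then show "a \<in> witt_seqs A \<Longrightarrow> witt_ring_neg A a \<oplus>\<^bsub>witt_ring A\<^esub> a = \<zero>\<^bsub>witt_ring A\<^esub>" .
  \<comment> \<open>The predicate \<open>P\<close> is instantiated by one axiom at a time;
    naturality then pulls the axiom back to the generic vectors.\<close>
  have ident: "P a b c" if "a \<in> witt_seqs A" "b \<in> witt_seqs A" "c \<in> witt_seqs A"
    and "\<And>h. h \<in> ring_hom zpoly_ring A \<Longrightarrow> P (witt_map h (gen 0)) (witt_map h (gen 1)) (witt_map h (gen 2))" for P a b c
    using lift3[OF A that(1-3)] that(4) by metis
  show "cring (witt_ring A)"
  proof (intro cringI abelian_groupI comm_monoidI; (unfold carrier_witt_ring)?)
    fix a assume "a \<in> witt_seqs A"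
    then show "\<exists>y\<in>witt_seqs A. y \<oplus>\<^bsub>witt_ring A\<^esub> a = \<zero>\<^bsub>witt_ring A\<^esub>" using neg[of a] witt_ring_closed(5)[OF A, of a] by blast
    show "\<zero>\<^bsub>witt_ring A\<^esub> \<oplus>\<^bsub>witt_ring A\<^esub> a = a"
      by (rule ident[OF \<open>a \<in> witt_seqs A\<close> \<open>a \<in> witt_seqs A\<close> \<open>a \<in> witt_seqs A\<close>])
        (simp only: witt_ring_natural[OF cring_zpoly_ring A, symmetric] gen_witt_seqs cl Z.l_zero g)
    show "\<one>\<^bsub>witt_ring A\<^esub> \<otimes>\<^bsub>witt_ring A\<^esub> a = a"
      by (rule ident[OF \<open>a \<in> witt_seqs A\<close> \<open>a \<in> witt_seqs A\<close> \<open>a \<in> witt_seqs A\<close>])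
        (simp only: witt_ring_natural[OF cring_zpoly_ring A, symmetric] gen_witt_seqs cl Z.l_one g)
    fix b assume "b \<in> witt_seqs A"
    show "a \<oplus>\<^bsub>witt_ring A\<^esub> b = b \<oplus>\<^bsub>witt_ring A\<^esub> a"
      by (rule ident[OF \<open>a \<in> witt_seqs A\<close> \<open>b \<in> witt_seqs A\<close> \<open>b \<in> witt_seqs A\<close>])
        (simp only: witt_ring_natural[OF cring_zpoly_ring A, symmetric] gen_witt_seqs cl Z.a_comm[OF g g, of 0 1] g)
    show "a \<otimes>\<^bsub>witt_ring A\<^esub> b = b \<otimes>\<^bsub>witt_ring A\<^esub> a"
      by (rule ident[OF \<open>a \<in> witt_seqs A\<close> \<open>b \<in> witt_seqs A\<close> \<open>b \<in> witt_seqs A\<close>])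
        (simp only: witt_ring_natural[OF cring_zpoly_ring A, symmetric] gen_witt_seqs cl Z.m_comm[OF g g, of 0 1] g)
    fix c assume "c \<in> witt_seqs A"
    show "a \<oplus>\<^bsub>witt_ring A\<^esub> b \<oplus>\<^bsub>witt_ring A\<^esub> c = a \<oplus>\<^bsub>witt_ring A\<^esub> (b \<oplus>\<^bsub>witt_ring A\<^esub> c)"
      by (rule ident[OF \<open>a \<in> witt_seqs A\<close> \<open>b \<in> witt_seqs A\<close> \<open>c \<in> witt_seqs A\<close>])
        (simp only: witt_ring_natural[OF cring_zpoly_ring A, symmetric] gen_witt_seqs cl Z.a_assoc g)
    show "a \<otimes>\<^bsub>witt_ring A\<^esub> b \<otimes>\<^bsub>witt_ring A\<^esub> c = a \<otimes>\<^bsub>witt_ring A\<^esub> (b \<otimes>\<^bsub>witt_ring A\<^esub> c)"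
      by (rule ident[OF \<open>a \<in> witt_seqs A\<close> \<open>b \<in> witt_seqs A\<close> \<open>c \<in> witt_seqs A\<close>])
        (simp only: witt_ring_natural[OF cring_zpoly_ring A, symmetric] gen_witt_seqs cl Z.m_assoc g)
    show "(a \<oplus>\<^bsub>witt_ring A\<^esub> b) \<otimes>\<^bsub>witt_ring A\<^esub> c = a \<otimes>\<^bsub>witt_ring A\<^esub> c \<oplus>\<^bsub>witt_ring A\<^esub> b \<otimes>\<^bsub>witt_ring A\<^esub> c"
      by (rule ident[OF \<open>a \<in> witt_seqs A\<close> \<open>b \<in> witt_seqs A\<close> \<open>c \<in> witt_seqs A\<close>])
        (simp only: witt_ring_natural[OF cring_zpoly_ring A, symmetric] gen_witt_seqs cl Z.l_distr g)
  qed auto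
qed

lemma witt_map_witt_ring_hom:
  "cring A \<Longrightarrow> cring B \<Longrightarrow> f \<in> ring_hom A B \<Longrightarrow> witt_map f \<in> ring_hom (witt_ring A) (witt_ring B)"
  by (rule ring_hom_memI) (auto simp only: carrier_witt_ring witt_ring_natural witt_map_hom_closed)

lemma ghost_witt_ring_hom: "cring A \<Longrightarrow> n > 0 \<Longrightarrow> ghost A n \<in> ring_hom (witt_ring A) A"
  by (rule ring_hom_memI) (auto simp only: carrier_witt_ring ghost_witt_ring ghost_closed)

lemma is_witt_structure_witt_ring: "is_witt_structure witt_ring"
  unfolding is_witt_structure_def by (auto simp only: carrier_witt_ring witt_seqs_def[symmetric] cring_witt_ring ghost_witt_ring_hom witt_map_witt_ring_hom)

section \<open>Frobenius maps and comultiplication\<close>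

definition witt_frob :: "'a ring \<Rightarrow> nat \<Rightarrow> (nat \<Rightarrow> 'a) \<Rightarrow> nat \<Rightarrow> 'a" where
  "witt_frob A n a = witt_op A (\<lambda>m. cghost (gen 0) (n * m)) (\<lambda>_. a)"

lemma witt_frob_closed: "cring A \<Longrightarrow> a \<in> witt_seqs A \<Longrightarrow> witt_frob A n a \<in> witt_seqs A"
  unfolding witt_frob_def by (rule witt_op_closed)

lemma ghost_witt_frob: "cring A \<Longrightarrow> a \<in> witt_seqs A \<Longrightarrow> n > 0 \<Longrightarrow> m > 0 \<Longrightarrow> ghost A m (witt_frob A n a) = ghost A (n * m) a"
  unfolding witt_frob_def by (simp add: ghost_witt_op dwork_seq_shift dwork_seq_cghost eval_gens_ghost_gen[of A "\<lambda>_. a"])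

lemma witt_frob_natural:
  "cring A \<Longrightarrow> cring B \<Longrightarrow> f \<in> ring_hom A B \<Longrightarrow> a \<in> witt_seqs A \<Longrightarrow> witt_map f (witt_frob A n a) = witt_frob B n (witt_map f a)"
  unfolding witt_frob_def by (simp add: witt_op_natural)

text \<open>A natural operation is a ring homomorphism as soon as it is one over the polynomial
  ring, because any two vectors come from generic ones. The operation appears twice, as
  \<open>G\<close> over \<open>zpoly_ring\<close> and as \<open>H\<close> over \<open>A\<close>,
  since a variable cannot be polymorphic in the carrier; \<open>N\<close> is the functorial action
  on the target.\<close>

lemma witt_ring_hom_transfer:
  fixes A :: "'a ring" and G :: "zpoly ring \<Rightarrow> (nat \<Rightarrow> zpoly) \<Rightarrow> 'z" and H :: "'a ring \<Rightarrow> (nat \<Rightarrow> 'a) \<Rightarrow> 'b"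
  assumes A: "cring A"
    and R: "cring RZ" "G zpoly_ring \<in> ring_hom (witt_ring zpoly_ring) RZ"
    and S: "cring S" "\<And>h. h \<in> ring_hom zpoly_ring A \<Longrightarrow> N h \<in> ring_hom RZ S"
    and nat: "\<And>h a. h \<in> ring_hom zpoly_ring A \<Longrightarrow> a \<in> witt_seqs zpoly_ring \<Longrightarrow> N h (G zpoly_ring a) = H A (witt_map h a)"
  shows "H A \<in> ring_hom (witt_ring A) S"
proof (rule ring_hom_memI; (unfold carrier_witt_ring)?)
  interpret Z: cring "witt_ring zpoly_ring" by (rule cring_witt_ring[OF cring_zpoly_ring])
  note W = witt_ring_natural[OF cring_zpoly_ring A] and cl = witt_ring_closed[OF cring_zpoly_ring]
  fix a b assume ab: "a \<in> witt_seqs A" "b \<in> witt_seqs A"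
  obtain h where h: "h \<in> ring_hom zpoly_ring A" "witt_map h (gen 0) = a" "witt_map h (gen 1) = b"
    using lift3[OF A ab ab(2)] by metis
  note GM = ring_hom_add[OF R(2)] ring_hom_mult[OF R(2)] ring_hom_closed[OF R(2)]
    and NM = ring_hom_add[OF S(2)[OF h(1)]] ring_hom_mult[OF S(2)[OF h(1)]] ring_hom_closed[OF S(2)[OF h(1)]]
  show "H A a \<in> carrier S" unfolding h(2)[symmetric] nat[OF h(1) gen_witt_seqs, symmetric]
    using GM NM gen_witt_seqs carrier_witt_ring by metis
  have g: "gen j \<in> carrier (witt_ring zpoly_ring)" for j by (simp only: carrier_witt_ring gen_witt_seqs)
  have "H A (a \<oplus>\<^bsub>witt_ring A\<^esub> b) = N h (G zpoly_ring (gen 0 \<oplus>\<^bsub>witt_ring zpoly_ring\<^esub> gen 1))"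
    by (simp only: nat h cl W gen_witt_seqs)
  also have "\<dots> = H A a \<oplus>\<^bsub>S\<^esub> H A b"
    by (simp only: GM g NM) (simp only: nat h gen_witt_seqs)
  finally show "H A (a \<oplus>\<^bsub>witt_ring A\<^esub> b) = H A a \<oplus>\<^bsub>S\<^esub> H A b" .
  have "H A (a \<otimes>\<^bsub>witt_ring A\<^esub> b) = N h (G zpoly_ring (gen 0 \<otimes>\<^bsub>witt_ring zpoly_ring\<^esub> gen 1))"
    by (simp only: nat h cl W gen_witt_seqs)
  also have "\<dots> = H A a \<otimes>\<^bsub>S\<^esub> H A b"
    by (simp only: GM g NM) (simp only: nat h gen_witt_seqs)
  finally show "H A (a \<otimes>\<^bsub>witt_ring A\<^esub> b) = H A a \<otimes>\<^bsub>S\<^esub> H A b" .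
next
  interpret cring A by (rule A)
  obtain h where h: "h \<in> ring_hom zpoly_ring A"
    using lift3[OF A zero_seq_witt_seqs[OF A] zero_seq_witt_seqs[OF A] zero_seq_witt_seqs[OF A]] by metis
  have "H A \<one>\<^bsub>witt_ring A\<^esub> = N h (G zpoly_ring \<one>\<^bsub>witt_ring zpoly_ring\<^esub>)"
    by (simp only: nat h witt_ring_closed[OF cring_zpoly_ring] witt_ring_natural[OF cring_zpoly_ring A h])
  also have "\<dots> = \<one>\<^bsub>S\<^esub>" using ring_hom_one[OF R(2)] ring_hom_one[OF S(2)[OF h]] by simp
  finally show "H A \<one>\<^bsub>witt_ring A\<^esub> = \<one>\<^bsub>S\<^esub>" .
qed

lemma witt_frob_hom_torsion_free:
  assumes A: "cring A" "torsion_free A" and n: "n > 0"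
  shows "witt_frob A n \<in> ring_hom (witt_ring A) (witt_ring A)"
  by (rule ring_hom_memI; (unfold carrier_witt_ring)?)
    (auto intro!: ghost_inj[OF A] simp: witt_frob_closed ghost_witt_frob ghost_witt_ring witt_ring_closed A(1) n)

lemma witt_frob_hom: "cring A \<Longrightarrow> n > 0 \<Longrightarrow> witt_frob A n \<in> ring_hom (witt_ring A) (witt_ring A)"
  by (rule witt_ring_hom_transfer[where G = "\<lambda>A. witt_frob A n" and H = "\<lambda>A. witt_frob A n" and N = witt_map and RZ = "witt_ring zpoly_ring"])
    (simp_all add: witt_frob_natural cring_zpoly_ring cring_witt_ring witt_map_witt_ring_hom witt_frob_hom_torsion_free torsion_free_zpoly_ring)

text \<open>The ghost image of the Witt vectors of the polynomial ring. The condition at 0 makes \<open>b \<mapsto> (n \<mapsto> b (p n))\<close>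
  a Frobenius lift also at the index 0; it excludes the unit, which is why Dwork's lemma is stated for nonunital subrings.\<close>

definition dwork_set :: "(nat \<Rightarrow> zpoly) set" where
  "dwork_set = {b. dwork_seq b \<and> b 0 = 0}"

section \<open>Frobenius lifts on the ring of ghost sequences\<close>

lemma power_fun_apply: "(f ^ n) x = (f x :: 'b::comm_ring_1) ^ n"
  by (induction n) simp_all

lemma sum_fun_apply: "sum g I x = (\<Sum>i\<in>I. g i x :: 'b::comm_ring_1)"
  by (induction I rule: infinite_finite_induct) simp_all

text \<open>Arithmetic in the function ring is pointwise, so Dwork's lemma for a sequence of
  sequences yields ghost identities at every fixed second index.\<close>

lemma cghost_fun_apply: "cghost v n m = cghost (\<lambda>e. v e m) n" for v :: "nat \<Rightarrow> 'a \<Rightarrow> 'b::comm_ring_1"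
  unfolding cghost_def by (simp add: sum_fun_apply power_fun_apply)

lemma zpoly_dvd_cancel_coprime:
  fixes y :: "'r::comm_ring_1"
  assumes "of_nat a dvd of_nat b * y" "coprime a b" shows "of_nat a dvd y"
proof -
  obtain s t :: int where st: "s * int a + t * int b = 1"
    using assms(2) bezout_int[of "int a" "int b"] by (auto simp: coprime_iff_gcd_eq_1)
  have "y = of_int (s * int a + t * int b) * y" unfolding st by simp
  also have "\<dots> = of_nat a * (of_int s * y) + of_int t * (of_nat b * y)"
    by (simp add: algebra_simps)
  finally show ?thesis using assms(1) by (metis dvd_add dvd_mult dvd_triv_left)
qed

text \<open>The quotient \<open>r\<close> of \<open>x (p * n) - x n ^ p\<close> by \<open>p\<close>
  has to satisfy Dwork's congruences itself, for every prime \<open>q\<close>. For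
  \<open>q \<noteq> p\<close> the factor \<open>p\<close> is cancelled; for \<open>q = p\<close> one
  more power of \<open>p\<close> is required before dividing.\<close>

lemma dwork_set_frobenius_cong:
  assumes x: "x \<in> dwork_set" and p: "prime p"
  shows "mult_in dwork_set p ((\<lambda>n. x (p * n)) - x ^ p)"
proof -
  have xd: "dwork_seq x" "x 0 = 0" using x by (auto simp: dwork_set_def)
  have p0: "p > 0" using p prime_gt_0_nat by blast
  have D: "of_nat p dvd x (p * n) - x n ^ p" if "n > 0" for n
  proof -
    have "of_nat p dvd x (p * n) - frob p (x n)" using dwork_seqD[OF xd(1) p that, of 0] by simp
    from dvd_add[OF this frob_cong[OF p, of "x n"]] show ?thesis by simp
  qed
  \<comment> \<open>The value 0 at index 0 is the condition of \<open>dwork_set\<close>; it fits the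
    equation because \<open>x 0 = 0\<close>.\<close>
  define r where "r n = (if n = 0 then 0 else SOME y. x (p * n) - x n ^ p = of_nat p * y)" for n
  have r: "x (p * n) - x n ^ p = of_nat p * r n" if "n > 0" for n
    using D[OF that] someI_ex[of "\<lambda>y. x (p * n) - x n ^ p = of_nat p * y"] that by (auto simp: r_def dvd_def)
  have "dwork_seq r"
    unfolding dwork_seq_def
  proof (intro allI impI)
    fix q k m :: nat assume q: "prime q" and m: "m > 0"
    have q0: "q > 0" using q prime_gt_0_nat by blast
    let ?N = "q ^ Suc k * m" and ?M = "q ^ k * m"
    let ?y = "r ?N - frob q (r ?M)"
    have X: "of_nat p * ?y = (x (p * ?N) - frob q (x (p * ?M))) - (x ?N ^ p - frob q (x ?M) ^ p)"
    proof -
      have "of_nat p * ?y = of_nat p * r ?N - frob q (of_nat p * r ?M)"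
        by (simp add: frob_of_nat right_diff_distrib)
      also have "\<dots> = (x (p * ?N) - x ?N ^ p) - frob q (x (p * ?M) - x ?M ^ p)"
        using r[of ?N] r[of ?M] m q0 by simp
      finally show ?thesis by (simp add: frob_diff frob_power algebra_simps)
    qed
    have c2: "of_nat (q ^ Suc k) dvd x ?N - frob q (x ?M)" by (rule dwork_seqD[OF xd(1) q m])
    show "of_nat (q ^ Suc k) dvd ?y"
    proof (cases "q = p")
      case False
      have "of_nat (q ^ Suc k) dvd x (q ^ Suc k * (p * m)) - frob q (x (q ^ k * (p * m)))"
        using p0 m by (intro dwork_seqD[OF xd(1) q]) auto
      moreover have "of_nat (q ^ Suc k) dvd x ?N ^ p - frob q (x ?M) ^ p"
        unfolding power_diff_sumr2 by (rule dvd_mult2[OF c2])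
      ultimately have "of_nat (q ^ Suc k) dvd of_nat p * ?y"
        unfolding X mult.left_commute[of p "q ^ Suc k" m] mult.left_commute[of p "q ^ k" m] by (rule dvd_diff)
      moreover have "coprime (q ^ Suc k) p" using False p q by (simp add: primes_coprime)
      ultimately show ?thesis by (rule zpoly_dvd_cancel_coprime)
    next
      case True
      \<comment> \<open>The additional power comes from the congruence of \<open>x\<close> at the
        next level for the first difference, and from taking p-th powers for the second.\<close>
      have "of_nat (p ^ Suc (Suc k)) dvd x (p ^ Suc (Suc k) * m) - frob p (x (p ^ Suc k * m))"
        by (rule dwork_seqD[OF xd(1) p m])
      then have "of_nat (p ^ Suc (Suc k)) dvd x (p * ?N) - frob q (x (p * ?M))"
        by (simp only: True power_Suc mult.assoc)
      moreover have "mult_in UNIV (p ^ Suc (Suc k)) (x ?N ^ p - frob q (x ?M) ^ p)"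
        using c2 True by (intro nonunital_subring.prime_power_cong_Suc[of UNIV])
          (auto simp: nonunital_subring_def mult_in_UNIV simp del: of_nat_power power_Suc)
      ultimately have "of_nat (p ^ Suc (Suc k)) dvd of_nat p * ?y"
        unfolding X mult_in_UNIV by (rule dvd_diff)
      then obtain z where "of_nat p * ?y = of_nat p * (of_nat (p ^ Suc k) * z)"
        by (auto simp: dvd_def mult.assoc)
      then have "?y = of_nat (p ^ Suc k) * z" using zpoly_of_nat_mult_cancel p0 by blast
      then show ?thesis unfolding True by simp
    qed
  qed
  then have "r \<in> dwork_set" by (simp add: dwork_set_def r_def)
  moreover have "(\<lambda>n. x (p * n)) - x ^ p = of_nat p * r"
  proof
    fix n show "((\<lambda>n. x (p * n)) - x ^ p) n = (of_nat p * r) n"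
      using r[of n] xd(2) p0 by (cases "n = 0") (simp_all add: power_fun_apply r_def zero_power)
  qed
  ultimately show ?thesis by (auto simp: mult_in_def)
qed

interpretation G: frobenius_lifts dwork_set "\<lambda>p b n. b (p * n)"
proof unfold_locales
  show "0 \<in> dwork_set" using dwork_seq_0 by (simp add: dwork_set_def zero_fun_def)
  fix x y assume "x \<in> dwork_set" "y \<in> dwork_set"
  then show "x - y \<in> dwork_set" "x * y \<in> dwork_set"
    using dwork_seq_diff[of x y] dwork_seq_mult[of x y]
    by (simp_all add: dwork_set_def fun_diff_def times_fun_def)
next
  fix p x assume "prime (p::nat)" "x \<in> dwork_set"
  then show "(\<lambda>n. x (p * n)) \<in> dwork_set"
    using dwork_seq_shift[of x p] prime_gt_0_nat[of p] by (simp add: dwork_set_def)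
qed (simp_all add: dwork_set_frobenius_cong fun_eq_iff)

text \<open>\<open>comult_ghost n\<close> is the ghost sequence, in \<open>m\<close>, of the n-th
  coordinate of the comultiplied generic vector: the iterated ghost component at \<open>n\<close>
  and \<open>m\<close> has to be the component of \<open>gen 0\<close> at \<open>n * m\<close>. The
  value at \<open>m = 0\<close> meets the condition of \<open>dwork_set\<close>.\<close>

definition comult_ghost :: "nat \<Rightarrow> nat \<Rightarrow> zpoly" where
  "comult_ghost = unghost dwork_set (\<lambda>n m. if m = 0 then 0 else cghost (gen 0) (n * m))"

lemma comult_ghost:
  assumes "n > 0"
  shows "dwork_seq (comult_ghost n)" "m > 0 \<Longrightarrow> cghost (\<lambda>e. comult_ghost e m) n = cghost (gen 0) (n * m)"
proof -
  let ?B = "\<lambda>n m. if m = 0 then 0 else cghost (gen 0) (n * m)"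
  have "comult_ghost n \<in> dwork_set \<and> cghost comult_ghost n = ?B n"
    unfolding comult_ghost_def
  proof (rule G.dwork)
    fix n :: nat assume "n > 0"
    then have "dwork_seq (\<lambda>m. cghost (gen 0) (n * m))" by (intro dwork_seq_shift dwork_seq_cghost)
    \<comment> \<open>Changing the value at 0 does not affect the congruences, whose indices are
      positive.\<close>
    then have "dwork_seq (?B n)" by (auto simp: dwork_seq_def dest: prime_gt_0_nat)
    then show "?B n \<in> dwork_set" by (simp add: dwork_set_def)
  next
    fix p k m :: nat assume p: "prime p" "m > 0"
    \<comment> \<open>The Frobenius lift is the shift by \<open>p\<close>, so both sides are the
      component at \<open>p ^ Suc k * m * j\<close> and the congruence is an equality.\<close>
    have "?B (p ^ Suc k * m) - (\<lambda>j. ?B (p ^ k * m) (p * j)) = 0"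
      using prime_gt_0_nat[OF p(1)] by (auto simp: fun_eq_iff ac_simps)
    then show "mult_in dwork_set (p ^ Suc k) (?B (p ^ Suc k * m) - (\<lambda>j. ?B (p ^ k * m) (p * j)))"
      by (simp only: G.mult_in_0)
  qed fact
  then show "dwork_seq (comult_ghost n)" "m > 0 \<Longrightarrow> cghost (\<lambda>e. comult_ghost e m) n = cghost (gen 0) (n * m)"
    by (auto simp: dwork_set_def cghost_fun_apply fun_eq_iff)
qed

section \<open>The comultiplication\<close>

definition witt_delta :: "'a ring \<Rightarrow> (nat \<Rightarrow> 'a) \<Rightarrow> nat \<Rightarrow> nat \<Rightarrow> 'a" where
  "witt_delta A a = (\<lambda>n\<in>{0<..}. witt_op A (comult_ghost n) (\<lambda>_. a))"

lemma witt_delta_closed: "cring A \<Longrightarrow> a \<in> witt_seqs A \<Longrightarrow> witt_delta A a \<in> witt_seqs (witt_ring A)"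
  unfolding witt_delta_def by (rule witt_seqs_restrict) (simp add: carrier_witt_ring witt_op_closed)

lemma witt_delta_natural:
  "cring A \<Longrightarrow> cring B \<Longrightarrow> f \<in> ring_hom A B \<Longrightarrow> a \<in> witt_seqs A \<Longrightarrow>
    witt_map (witt_map f) (witt_delta A a) = witt_delta B (witt_map f a)"
  unfolding witt_delta_def by (rule ext) (simp add: witt_map_def[of "witt_map f"] witt_op_natural)

text \<open>Torsion is detected by the ghost components, which are additive. Consequently the ghost
  map of \<open>witt_ring A\<close> is injective as well, which decides identities in
  \<open>witt_ring (witt_ring A)\<close>.\<close>

lemma torsion_free_witt_ring:
  assumes A: "cring A" "torsion_free A" shows "torsion_free (witt_ring A)"
  unfolding torsion_free_def
proof (intro allI ballI impI)
  interpret A: cring A by fact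
  interpret W: cring "witt_ring A" by (rule cring_witt_ring[OF A(1)])
  fix n :: nat and x assume n: "n > 0" and x: "x \<in> carrier (witt_ring A)" and e: "add_pow (witt_ring A) n x = \<zero>\<^bsub>witt_ring A\<^esub>"
  have xw: "x \<in> witt_seqs A" using x by (simp add: carrier_witt_ring)
  show "x = \<zero>\<^bsub>witt_ring A\<^esub>"
  proof (rule ghost_inj[OF A xw])
    fix m :: nat assume m: "m > 0"
    have "add_pow A n (ghost A m x) = ghost A m (add_pow (witt_ring A) n x)"
      using ring_hom_add_pow[OF W.ring_axioms A.ring_axioms ghost_witt_ring_hom[OF A(1) m] x] by simp
    also have "\<dots> = \<zero>\<^bsub>A\<^esub>" by (simp add: e ghost_witt_ring A m)
    finally show "ghost A m x = ghost A m \<zero>\<^bsub>witt_ring A\<^esub>"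
      using A(2) n ghost_closed[OF A(1) xw m] by (simp add: torsion_free_def ghost_witt_ring A m)
  qed (simp add: witt_ring_closed A)
qed

text \<open>Naturality of the n-th ghost map along the homomorphism
  \<open>ghost A m\<close>.\<close>

lemma ghost_ghost:
  assumes A: "cring A" and v: "v \<in> witt_seqs (witt_ring A)" and "n > 0" "m > 0"
  shows "ghost A m (ghost (witt_ring A) n v) = ghost A n (witt_map (ghost A m) v)"
  using assms by (intro ghost_hom cring_witt_ring ghost_witt_ring_hom)

lemma ghost_witt_delta:
  assumes A: "cring A" and a: "a \<in> witt_seqs A" and n: "n > 0"
  shows "ghost (witt_ring A) n (witt_delta A a) = witt_frob A n a"
proof -
  have *: "ghost (witt_ring zpoly_ring) n (witt_delta zpoly_ring (gen 0)) = witt_frob zpoly_ring n (gen 0)"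
  proof (rule ghost_inj[OF cring_zpoly_ring torsion_free_zpoly_ring])
    have c: "witt_delta zpoly_ring (gen 0) \<in> witt_seqs (witt_ring zpoly_ring)" by (intro witt_delta_closed cring_zpoly_ring gen_witt_seqs)
    show "ghost (witt_ring zpoly_ring) n (witt_delta zpoly_ring (gen 0)) \<in> witt_seqs zpoly_ring"
      using ghost_closed[OF cring_witt_ring(1)[OF cring_zpoly_ring] c n] by (simp add: carrier_witt_ring)
    fix m :: nat assume m: "m > 0"
    \<comment> \<open>Evaluation at the constant family \<open>gen 0\<close> sends each variable
      \<open>(j, i)\<close> to \<open>(0, i)\<close>. It is not the identity, but it fixes the ghost
      components of \<open>gen 0\<close>.\<close>
    have g: "eval_gens zpoly_ring (\<lambda>_. gen 0) (cghost (gen 0) k) = cghost (gen 0) k" if "k > 0" for k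
      using eval_gens_ghost_gen[of zpoly_ring "\<lambda>_. gen 0" k 0, OF cring_zpoly_ring gen_witt_seqs that] that by (simp add: ghost_zpoly_ring)
    have h: "eval_gens zpoly_ring (\<lambda>_. gen 0) \<in> ring_hom zpoly_ring zpoly_ring" by (intro eval_gens_hom cring_zpoly_ring gen_witt_seqs)
    have "ghost zpoly_ring m (ghost (witt_ring zpoly_ring) n (witt_delta zpoly_ring (gen 0))) = ghost zpoly_ring n (witt_map (ghost zpoly_ring m) (witt_delta zpoly_ring (gen 0)))"
      using m n by (intro ghost_ghost cring_zpoly_ring c)
    also have "witt_map (ghost zpoly_ring m) (witt_delta zpoly_ring (gen 0)) = (\<lambda>e\<in>{0<..}. eval_gens zpoly_ring (\<lambda>_. gen 0) (comult_ghost e m))"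
      using m by (auto simp: witt_map_def witt_delta_def ghost_witt_op[OF cring_zpoly_ring gen_witt_seqs] comult_ghost)
    also have "\<dots> = witt_map (eval_gens zpoly_ring (\<lambda>_. gen 0)) (\<lambda>e\<in>{0<..}. comult_ghost e m)"
      by (auto simp: witt_map_def)
    also have "ghost zpoly_ring n \<dots> = eval_gens zpoly_ring (\<lambda>_. gen 0) (ghost zpoly_ring n (\<lambda>e\<in>{0<..}. comult_ghost e m))"
      using n by (intro ghost_hom[symmetric] cring_zpoly_ring h restrict_witt_seqs_zpoly_ring)
    also have "\<dots> = cghost (gen 0) (n * m)"
      using m n by (simp add: ghost_zpoly_ring cghost_restrict comult_ghost g)
    also have "\<dots> = ghost zpoly_ring m (witt_frob zpoly_ring n (gen 0))"
      using m n by (simp add: ghost_witt_frob cring_zpoly_ring gen_witt_seqs ghost_zpoly_ring)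
    finally show "ghost zpoly_ring m (ghost (witt_ring zpoly_ring) n (witt_delta zpoly_ring (gen 0))) = ghost zpoly_ring m (witt_frob zpoly_ring n (gen 0))" .
  qed (intro witt_frob_closed cring_zpoly_ring gen_witt_seqs)
  obtain h where h: "h \<in> ring_hom zpoly_ring A" "witt_map h (gen 0) = a" using lift3[OF A a a a] by metis
  have "ghost (witt_ring A) n (witt_delta A a) = ghost (witt_ring A) n (witt_map (witt_map h) (witt_delta zpoly_ring (gen 0)))"
    using witt_delta_natural[OF cring_zpoly_ring A h(1) gen_witt_seqs, of 0] unfolding h(2) by simp
  also have "\<dots> = witt_map h (ghost (witt_ring zpoly_ring) n (witt_delta zpoly_ring (gen 0)))"
    using n h by (intro ghost_hom[symmetric] cring_witt_ring cring_zpoly_ring A witt_map_witt_ring_hom witt_delta_closed gen_witt_seqs)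
  also have "\<dots> = witt_frob A n a" unfolding * using witt_frob_natural[OF cring_zpoly_ring A h(1) gen_witt_seqs, of n 0] unfolding h(2) .
  finally show ?thesis .
qed

lemma witt_delta_hom:
  assumes A: "cring A" shows "witt_delta A \<in> ring_hom (witt_ring A) (witt_ring (witt_ring A))"
proof -
  note Z = cring_zpoly_ring cring_witt_ring(1)[OF cring_zpoly_ring] torsion_free_witt_ring[OF cring_zpoly_ring torsion_free_zpoly_ring]
  have hom: "witt_frob zpoly_ring n \<in> ring_hom (witt_ring zpoly_ring) (witt_ring zpoly_ring)" if "n > 0" for n by (rule witt_frob_hom[OF cring_zpoly_ring that])
  have "witt_delta zpoly_ring \<in> ring_hom (witt_ring zpoly_ring) (witt_ring (witt_ring zpoly_ring))"
  proof (rule ring_hom_memI; (unfold carrier_witt_ring)?)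
    fix a b assume ab: "a \<in> witt_seqs zpoly_ring" "b \<in> witt_seqs zpoly_ring"
    then have C: "a \<in> carrier (witt_ring zpoly_ring)" "b \<in> carrier (witt_ring zpoly_ring)" by (simp_all only: carrier_witt_ring)
    note cl = witt_ring_closed[OF Z(2)] witt_delta_closed[OF Z(1)] witt_ring_closed[OF Z(1)]
    show "witt_delta zpoly_ring a \<in> witt_seqs (witt_ring zpoly_ring)" by (intro cl ab)
    show "witt_delta zpoly_ring (a \<oplus>\<^bsub>witt_ring zpoly_ring\<^esub> b) = witt_delta zpoly_ring a \<oplus>\<^bsub>witt_ring (witt_ring zpoly_ring)\<^esub> witt_delta zpoly_ring b"
      by (rule ghost_inj[OF Z(2,3)])
        (simp_all only: cl ab ghost_witt_ring[OF Z(2)] ghost_witt_delta[OF Z(1)] ring_hom_add[OF hom C])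
    show "witt_delta zpoly_ring (a \<otimes>\<^bsub>witt_ring zpoly_ring\<^esub> b) = witt_delta zpoly_ring a \<otimes>\<^bsub>witt_ring (witt_ring zpoly_ring)\<^esub> witt_delta zpoly_ring b"
      by (rule ghost_inj[OF Z(2,3)])
        (simp_all only: cl ab ghost_witt_ring[OF Z(2)] ghost_witt_delta[OF Z(1)] ring_hom_mult[OF hom C])
  next
    note cl = witt_ring_closed[OF Z(2)] witt_delta_closed[OF Z(1)] witt_ring_closed[OF Z(1)]
    show "witt_delta zpoly_ring \<one>\<^bsub>witt_ring zpoly_ring\<^esub> = \<one>\<^bsub>witt_ring (witt_ring zpoly_ring)\<^esub>"
      by (rule ghost_inj[OF Z(2,3)])
        (simp_all only: cl ghost_witt_ring[OF Z(2)] ghost_witt_delta[OF Z(1)] ring_hom_one[OF hom])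
  qed
  from cring_witt_ring(1)[OF Z(2)] this cring_witt_ring(1)[OF cring_witt_ring(1)[OF A]] show ?thesis
    by (rule witt_ring_hom_transfer[where G = witt_delta and H = witt_delta and N = "\<lambda>h. witt_map (witt_map h)", OF A])
      (simp_all add: witt_delta_natural cring_zpoly_ring A cring_witt_ring witt_map_witt_ring_hom)
qed

section \<open>Uniqueness of the Witt structure over infinite carriers\<close>

text \<open>A finitely supported function is determined by its finite graph. Countability is what
  lets the polynomial ring embed into an arbitrary infinite type.\<close>

instance poly_mapping :: (countable, "{countable, zero}") countable
proof
  let ?g = "\<lambda>p :: 'a \<Rightarrow>\<^sub>0 'b. (\<lambda>k. (k, Poly_Mapping.lookup p k)) ` Poly_Mapping.keys p"
  have "inj ?g"
  proof (rule injI, rule poly_mapping_eqI)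
    fix p q :: "'a \<Rightarrow>\<^sub>0 'b" and k assume e: "?g p = ?g q"
    have "(k, v) \<in> ?g p \<longleftrightarrow> v \<noteq> 0 \<and> v = Poly_Mapping.lookup p k" for v and p :: "'a \<Rightarrow>\<^sub>0 'b"
      by (auto simp: in_keys_iff)
    from this[of _ p] this[of _ q] e show "Poly_Mapping.lookup p k = Poly_Mapping.lookup q k" by metis
  qed
  moreover have "range ?g \<subseteq> Collect finite" by auto
  ultimately have "countable (UNIV :: ('a \<Rightarrow>\<^sub>0 'b) set)"
    using countable_Collect_finite countable_image_inj_on countable_subset by metis
  then show "\<exists>to_nat :: ('a \<Rightarrow>\<^sub>0 'b) \<Rightarrow> nat. inj to_nat" by (rule countableE) auto
qed

lemma zpoly_embedding:
  assumes "infinite (UNIV :: 'u set)" obtains j :: "zpoly \<Rightarrow> 'u" where "inj j"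
proof -
  obtain f :: "nat \<Rightarrow> 'u" where "inj f" using infinite_countable_subset[OF assms] by auto
  then have "inj (f \<circ> (to_nat :: zpoly \<Rightarrow> nat))" by (intro inj_compose) auto
  then show ?thesis using that by blast
qed

text \<open>\<open>Witt\<close> is a choice that leaves the operations open outside of the carrier,
  so equality of records cannot be expected. The relation compares exactly what
  \<open>ring_hom\<close> consults.\<close>

definition ring_agree :: "('a, 'k) ring_scheme \<Rightarrow> ('a, 'l) ring_scheme \<Rightarrow> bool" where
  "ring_agree R S \<longleftrightarrow> carrier R = carrier S \<and> \<one>\<^bsub>R\<^esub> = \<one>\<^bsub>S\<^esub> \<and>
     (\<forall>x\<in>carrier R. \<forall>y\<in>carrier R. x \<oplus>\<^bsub>R\<^esub> y = x \<oplus>\<^bsub>S\<^esub> y \<and> x \<otimes>\<^bsub>R\<^esub> y = x \<otimes>\<^bsub>S\<^esub> y)"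

lemma ring_agree_hom_right: "ring_agree R S \<Longrightarrow> ring_hom T R = ring_hom T S"
  unfolding ring_agree_def ring_hom_def by (auto simp: Pi_iff)

lemma ring_agree_hom_left: "ring R \<Longrightarrow> ring_agree R S \<Longrightarrow> ring_hom R T = ring_hom S T"
  unfolding ring_agree_def ring_hom_def by (auto simp: Pi_iff)

lemma ring_agree_trans: "ring_agree R S \<Longrightarrow> ring_agree S T \<Longrightarrow> ring_agree R T"
  by (auto simp: ring_agree_def)

lemma ring_agree_witt_seqs: "ring_agree R S \<Longrightarrow> witt_seqs R = witt_seqs S"
  by (simp add: ring_agree_def witt_seqs_def)

lemma witt_map_id: "a \<in> witt_seqs R \<Longrightarrow> witt_map id a = a"
  by (rule witt_seqs_eqI[OF witt_map_closed[of R id R]]) (auto simp: witt_map_apply)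

lemma ring_agree_id: "ring_agree R S \<Longrightarrow> id \<in> ring_hom R S"
  unfolding ring_agree_def ring_hom_def by auto

lemma ring_agree_ghost:
  "cring R \<Longrightarrow> cring S \<Longrightarrow> ring_agree R S \<Longrightarrow> a \<in> witt_seqs R \<Longrightarrow> n > 0 \<Longrightarrow> ghost R n a = ghost S n a"
  using ghost_hom[OF _ _ ring_agree_id, of R S a n] by (simp add: witt_map_id)

lemma ring_agree_witt_ring:
  assumes "cring R" "cring S" "ring_agree R S" shows "ring_agree (witt_ring R) (witt_ring S)"
proof -
  note nat = witt_ring_natural[OF assms(1,2) ring_agree_id[OF assms(3)]]
  note cl = witt_ring_closed[OF assms(1)]
  have id: "\<one>\<^bsub>witt_ring R\<^esub> = \<one>\<^bsub>witt_ring S\<^esub>" using nat(2) cl(2) by (simp add: witt_map_id)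
  have "x \<oplus>\<^bsub>witt_ring R\<^esub> y = x \<oplus>\<^bsub>witt_ring S\<^esub> y \<and> x \<otimes>\<^bsub>witt_ring R\<^esub> y = x \<otimes>\<^bsub>witt_ring S\<^esub> y" if "x \<in> witt_seqs R" "y \<in> witt_seqs R" for x y
    using nat(3,4)[OF that] cl(3,4)[OF that] that by (simp add: witt_map_id)
  with id show ?thesis unfolding ring_agree_def carrier_witt_ring using ring_agree_witt_seqs[OF assms(3)] by simp
qed

text \<open>A copy of the polynomial ring on the type \<open>'u\<close>, because an unknown Witt
  structure is natural only along homomorphisms between rings on that type.\<close>

locale zpoly_copy =
  fixes j :: "zpoly \<Rightarrow> 'u"
  assumes inj: "inj j"
begin

definition ji :: "'u \<Rightarrow> zpoly" where
  "ji = inv_into UNIV j"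

definition T :: "'u ring" where
  "T = \<lparr>carrier = range j, monoid.mult = \<lambda>x y. j (ji x * ji y), one = j 1,
     ring.zero = j 0, ring.add = \<lambda>x y. j (ji x + ji y)\<rparr>"

lemma inv_j [simp]: "ji (j x) = x"
  using inj by (simp add: ji_def)

lemma T_simps [simp]: "carrier T = range j" "\<one>\<^bsub>T\<^esub> = j 1" "\<zero>\<^bsub>T\<^esub> = j 0"
  "j x \<otimes>\<^bsub>T\<^esub> j y = j (x * y)" "j x \<oplus>\<^bsub>T\<^esub> j y = j (x + y)"
  by (simp_all add: T_def)

lemma cring_T: "cring T"
proof (intro cringI abelian_groupI comm_monoidI)
  fix x assume "x \<in> carrier T"
  then obtain p where "x = j p" by auto
  then show "\<exists>y\<in>carrier T. y \<oplus>\<^bsub>T\<^esub> x = \<zero>\<^bsub>T\<^esub>" by (intro bexI[of _ "j (- p)"]) auto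
qed (auto simp: algebra_simps)

lemma j_hom: "j \<in> ring_hom zpoly_ring T"
  by (rule ring_hom_memI) auto

lemma inv_j_hom: "ji \<in> ring_hom T zpoly_ring"
  by (rule ring_hom_memI) auto

lemma torsion_free_T: "torsion_free T"
  unfolding torsion_free_def
proof (intro allI ballI impI)
  interpret T: cring T by (rule cring_T)
  fix n :: nat and x assume n: "n > 0" "x \<in> carrier T" "add_pow T n x = \<zero>\<^bsub>T\<^esub>"
  then obtain p where p: "x = j p" by auto
  have "ji (add_pow T n x) = add_pow zpoly_ring n (ji x)"
    by (intro ring_hom_add_pow T.ring_axioms zpoly_ring.ring_axioms inv_j_hom n)
  then have "of_nat n * p = of_nat n * 0" using n p by (simp add: zpoly_ring_add_pow)
  then show "x = \<zero>\<^bsub>T\<^esub>" using zpoly_of_nat_mult_cancel[of n p 0] n p by simp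
qed

lemma lift:
  fixes A :: "'a ring"
  assumes "cring A" "a \<in> witt_seqs A" "b \<in> witt_seqs A"
  obtains h \<alpha> \<beta> where "h \<in> ring_hom T A" "\<alpha> \<in> witt_seqs T" "\<beta> \<in> witt_seqs T" "witt_map h \<alpha> = a" "witt_map h \<beta> = b"
proof -
  obtain h where h: "h \<in> ring_hom zpoly_ring A" "witt_map h (gen 0) = a" "witt_map h (gen 1) = b"
    using lift3[OF assms(1-3) assms(3)] by metis
  show ?thesis
  proof (rule that[of "h \<circ> ji" "witt_map j (gen 0)" "witt_map j (gen 1)"])
    show "h \<circ> ji \<in> ring_hom T A" using inv_j_hom h(1) by (rule ring_hom_trans)
    show "witt_map j (gen 0) \<in> witt_seqs T" "witt_map j (gen 1) \<in> witt_seqs T"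
      by (intro witt_map_hom_closed[OF j_hom] gen_witt_seqs)+
    show "witt_map (h \<circ> ji) (witt_map j (gen 0)) = a" "witt_map (h \<circ> ji) (witt_map j (gen 1)) = b"
      using h by (simp_all add: witt_map_comp)
  qed
qed

end

text \<open>Over the copy \<open>T\<close> the ghost map is injective and forces the operations; a
  homomorphism from \<open>T\<close> that hits two given vectors transports the result to
  \<open>A\<close>.\<close>

lemma is_witt_structure_unique:
  fixes A :: "'u ring"
  assumes inf: "infinite (UNIV :: 'u set)" and S: "is_witt_structure S" and A: "cring A"
  shows "ring_agree (S A) (witt_ring A)"
proof -
  obtain j :: "zpoly \<Rightarrow> 'u" where "inj j" using zpoly_embedding[OF inf] by metis
  then interpret zpoly_copy j by unfold_locales
  have car: "carrier (S A) = witt_seqs A" and cr: "cring (S A)" and gh: "\<And>n. n > 0 \<Longrightarrow> ghost A n \<in> ring_hom (S A) A"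
    if "cring A" for A :: "'u ring"
    using S that unfolding is_witt_structure_def witt_seqs_def by auto
  have nat: "witt_map f \<in> ring_hom (S A) (S B)" if "cring A" "cring B" "f \<in> ring_hom A B" for f and A B :: "'u ring"
    using S that unfolding is_witt_structure_def by auto
  interpret S: cring "S T" by (rule cr[OF cring_T])
  have T: "\<alpha> \<oplus>\<^bsub>S T\<^esub> \<beta> = \<alpha> \<oplus>\<^bsub>witt_ring T\<^esub> \<beta>" "\<alpha> \<otimes>\<^bsub>S T\<^esub> \<beta> = \<alpha> \<otimes>\<^bsub>witt_ring T\<^esub> \<beta>" "\<one>\<^bsub>S T\<^esub> = \<one>\<^bsub>witt_ring T\<^esub>"
    if ab: "\<alpha> \<in> witt_seqs T" "\<beta> \<in> witt_seqs T" for \<alpha> \<beta>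
  proof -
    have c: "\<alpha> \<in> carrier (S T)" "\<beta> \<in> carrier (S T)" using ab by (simp_all add: car cring_T)
    note gi = ghost_inj[OF cring_T torsion_free_T] and g = gh[OF cring_T]
    note cl = S.a_closed[OF c] S.m_closed[OF c] S.one_closed
    show "\<alpha> \<oplus>\<^bsub>S T\<^esub> \<beta> = \<alpha> \<oplus>\<^bsub>witt_ring T\<^esub> \<beta>" "\<alpha> \<otimes>\<^bsub>S T\<^esub> \<beta> = \<alpha> \<otimes>\<^bsub>witt_ring T\<^esub> \<beta>" "\<one>\<^bsub>S T\<^esub> = \<one>\<^bsub>witt_ring T\<^esub>"
      using cl unfolding car[OF cring_T]
      by (intro gi; simp only: witt_ring_closed[OF cring_T] ab ghost_witt_ring[OF cring_T] ring_hom_add[OF g c] ring_hom_mult[OF g c] ring_hom_one[OF g])+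
  qed
  show ?thesis unfolding ring_agree_def car[OF A]
  proof (intro conjI ballI)
    show "witt_seqs A = carrier (witt_ring A)" by (simp add: carrier_witt_ring)
  next
    interpret cring A by fact
    obtain h where h: "h \<in> ring_hom T A"
      using lift[OF A zero_seq_witt_seqs[OF A] zero_seq_witt_seqs[OF A]] by metis
    have "\<one>\<^bsub>S A\<^esub> = witt_map h \<one>\<^bsub>S T\<^esub>" using ring_hom_one[OF nat[OF cring_T A h]] by simp
    also have "\<dots> = \<one>\<^bsub>witt_ring A\<^esub>"
      using T(3)[OF zero_seq_witt_seqs zero_seq_witt_seqs] cring_T witt_ring_natural(2)[OF cring_T A h] by simp
    finally show "\<one>\<^bsub>S A\<^esub> = \<one>\<^bsub>witt_ring A\<^esub>" .
  next
    fix a b assume ab: "a \<in> witt_seqs A" "b \<in> witt_seqs A"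
    obtain h \<alpha> \<beta> where h: "h \<in> ring_hom T A" "\<alpha> \<in> witt_seqs T" "\<beta> \<in> witt_seqs T" "witt_map h \<alpha> = a" "witt_map h \<beta> = b"
      using lift[OF A ab] by metis
    have c: "\<alpha> \<in> carrier (S T)" "\<beta> \<in> carrier (S T)" using h by (simp_all add: car cring_T)
    note hh = nat[OF cring_T A h(1)]
    show "a \<oplus>\<^bsub>S A\<^esub> b = a \<oplus>\<^bsub>witt_ring A\<^esub> b" "a \<otimes>\<^bsub>S A\<^esub> b = a \<otimes>\<^bsub>witt_ring A\<^esub> b"
      using ring_hom_add[OF hh c] ring_hom_mult[OF hh c] T(1,2)[OF h(2,3)] witt_ring_natural(3,4)[OF cring_T A h(1-3)]
      unfolding h(4,5) by simp_all
  qed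
qed

section \<open>Replacing the chosen structures by the constructed ones\<close>

lemma Witt_agree:
  fixes A :: "'u ring"
  assumes "infinite (UNIV :: 'u set)" "cring A"
  shows "ring_agree (Witt A) (witt_ring A)"
proof -
  have "is_witt_structure (Witt :: 'u ring \<Rightarrow> _)"
    unfolding Witt_def by (rule someI[of is_witt_structure, OF is_witt_structure_witt_ring])
  then show ?thesis using is_witt_structure_unique assms by blast
qed

lemma cring_Witt: "cring A \<Longrightarrow> cring (Witt A)"
proof -
  have "is_witt_structure (Witt :: 'a ring \<Rightarrow> _)"
    unfolding Witt_def by (rule someI[of is_witt_structure, OF is_witt_structure_witt_ring])
  then show "cring A \<Longrightarrow> cring (Witt A)" for A :: "'a ring" by (simp add: is_witt_structure_def)
qed

lemma carrier_Witt: "cring A \<Longrightarrow> carrier (Witt A) = witt_seqs A"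
proof -
  have "is_witt_structure (Witt :: 'a ring \<Rightarrow> _)"
    unfolding Witt_def by (rule someI[of is_witt_structure, OF is_witt_structure_witt_ring])
  then show "cring A \<Longrightarrow> carrier (Witt A) = witt_seqs A" for A :: "'a ring" by (simp add: is_witt_structure_def witt_seqs_def)
qed

context
  fixes dummy :: "'u itself" assumes inf: "infinite (UNIV :: 'u set)"
begin

lemma ring_hom_Witt:
  fixes A :: "'u ring" assumes "cring A"
  shows "ring_hom R (Witt A) = ring_hom R (witt_ring A)" "ring_hom (Witt A) R = ring_hom (witt_ring A) R"
  using ring_agree_hom_right[OF Witt_agree[OF inf assms]]
    ring_agree_hom_left[OF _ Witt_agree[OF inf assms]] cring_Witt[OF assms] cring.axioms(1) by blast+

lemma is_witt_frobenius_witt_frob: "is_witt_frobenius (witt_frob :: 'u ring \<Rightarrow> _)"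
  unfolding is_witt_frobenius_def
  by (auto simp: ring_hom_Witt carrier_Witt witt_frob_hom ghost_witt_frob witt_frob_natural)

lemma witt_frobenius_eq:
  fixes A :: "'u ring" assumes A: "cring A" and n: "n > 0" and a: "a \<in> witt_seqs A"
  shows "witt_frobenius A n a = witt_frob A n a"
proof -
  let ?F = "witt_frobenius :: 'u ring \<Rightarrow> _"
  have F: "is_witt_frobenius ?F"
    unfolding witt_frobenius_def by (rule someI[of is_witt_frobenius, OF is_witt_frobenius_witt_frob])
  obtain j :: "zpoly \<Rightarrow> 'u" where "inj j" using zpoly_embedding[OF inf] by metis
  then interpret zpoly_copy j by unfold_locales
  obtain h \<alpha> where h: "h \<in> ring_hom T A" "\<alpha> \<in> witt_seqs T" "witt_map h \<alpha> = a"
    using lift[OF A a a] by metis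
  have gh: "?F T n \<in> ring_hom (witt_ring T) (witt_ring T)" "\<And>e. e > 0 \<Longrightarrow> ghost T e (?F T n \<alpha>) = ghost T (n * e) \<alpha>"
    using F cring_T n h(2) unfolding is_witt_frobenius_def by (simp_all add: ring_hom_Witt carrier_Witt)
  have c: "?F T n \<alpha> \<in> witt_seqs T" using ring_hom_closed[OF gh(1), of \<alpha>] h(2) by (simp add: carrier_witt_ring)
  have "?F T n \<alpha> = witt_frob T n \<alpha>"
    using c h(2) by (intro ghost_inj[OF cring_T torsion_free_T]) (simp_all add: witt_frob_closed cring_T gh ghost_witt_frob n)
  moreover have "witt_map h (?F T n \<alpha>) = ?F A n a"
    using F cring_T A h n unfolding is_witt_frobenius_def by (auto simp: carrier_Witt)
  ultimately show ?thesis using witt_frob_natural[OF cring_T A h(1,2)] h(3) by simp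
qed

text \<open>The outer \<open>Witt\<close> is chosen for rings on
  \<open>nat \<Rightarrow> 'u\<close>, so uniqueness is applied at that type, which is infinite
  because of the constant functions. Then \<open>witt_ring\<close> is applied to the agreement of
  \<open>Witt A\<close> with \<open>witt_ring A\<close>.\<close>

lemma Witt_Witt_agree:
  fixes A :: "'u ring" assumes A: "cring A"
  shows "ring_agree (Witt (Witt A)) (witt_ring (witt_ring A))"
proof -
  have i: "infinite (UNIV :: (nat \<Rightarrow> 'u) set)"
  proof
    assume "finite (UNIV :: (nat \<Rightarrow> 'u) set)"
    moreover have "inj (\<lambda>x :: 'u. \<lambda>_ :: nat. x)" by (auto simp: inj_def fun_eq_iff)
    ultimately show False using inf finite_imageD[of "\<lambda>x :: 'u. \<lambda>_ :: nat. x" UNIV] by (metis finite_subset top_greatest)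
  qed
  show ?thesis
    by (rule ring_agree_trans[OF Witt_agree[OF i cring_Witt[OF A]] ring_agree_witt_ring[OF cring_Witt[OF A] cring_witt_ring(1)[OF A] Witt_agree[OF inf A]]])
qed

lemma ghost_Witt:
  fixes A :: "'u ring" assumes A: "cring A" "v \<in> witt_seqs (witt_ring A)" "n > 0"
  shows "ghost (Witt A) n v = ghost (witt_ring A) n v"
  using ring_agree_ghost[OF cring_Witt[OF A(1)] cring_witt_ring(1)[OF A(1)] Witt_agree[OF inf A(1)]]
    ring_agree_witt_seqs[OF Witt_agree[OF inf A(1)]] A by auto

lemma is_witt_comult_witt_delta: "is_witt_comult (witt_delta :: 'u ring \<Rightarrow> _)"
  unfolding is_witt_comult_def
  by (auto simp: ring_hom_Witt carrier_Witt ring_agree_hom_right[OF Witt_Witt_agree] witt_delta_hom witt_delta_closed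
      ghost_Witt ghost_witt_delta witt_frobenius_eq witt_delta_natural)

lemma witt_comult_eq:
  fixes A :: "'u ring" assumes A: "cring A" and a: "a \<in> witt_seqs A"
  shows "witt_comult A a = witt_delta A a"
proof -
  let ?F = "witt_comult :: 'u ring \<Rightarrow> _"
  have F: "is_witt_comult ?F"
    unfolding witt_comult_def by (rule someI[of is_witt_comult, OF is_witt_comult_witt_delta])
  obtain j :: "zpoly \<Rightarrow> 'u" where "inj j" using zpoly_embedding[OF inf] by metis
  then interpret zpoly_copy j by unfold_locales
  obtain h \<alpha> where h: "h \<in> ring_hom T A" "\<alpha> \<in> witt_seqs T" "witt_map h \<alpha> = a"
    using lift[OF A a a] by metis
  have hom: "?F T \<in> ring_hom (witt_ring T) (witt_ring (witt_ring T))"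
    using F cring_T unfolding is_witt_comult_def
    by (simp add: ring_hom_Witt carrier_Witt ring_agree_hom_right[OF Witt_Witt_agree])
  then have c: "?F T \<alpha> \<in> witt_seqs (witt_ring T)" using ring_hom_closed[OF hom, of \<alpha>] h(2) by (simp add: carrier_witt_ring)
  have gh: "ghost (witt_ring T) n (?F T \<alpha>) = witt_frob T n \<alpha>" if "n > 0" for n
  proof -
    have "ghost (Witt T) n (?F T \<alpha>) = witt_frobenius T n \<alpha>"
      using F cring_T that h(2) unfolding is_witt_comult_def by (simp add: carrier_Witt)
    then show ?thesis using that c h(2) by (simp add: ghost_Witt cring_T witt_frobenius_eq)
  qed
  have "?F T \<alpha> = witt_delta T \<alpha>"
    using c h(2) by (intro ghost_inj[OF cring_witt_ring(1)[OF cring_T] torsion_free_witt_ring[OF cring_T torsion_free_T]])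
      (simp_all add: witt_delta_closed cring_T gh ghost_witt_delta)
  moreover have "witt_map (witt_map h) (?F T \<alpha>) = ?F A a"
    using F cring_T A h unfolding is_witt_comult_def by (auto simp: carrier_Witt)
  ultimately show ?thesis using witt_delta_natural[OF cring_T A h(1,2)] h(3) by simp
qed

text \<open>Removes the chosen objects from the axioms: later arguments only use
  \<open>witt_ring\<close> and \<open>witt_delta\<close>.\<close>

lemma lambda_ring_iff:
  fixes A :: "'u ring"
  shows "lambda_ring A l \<longleftrightarrow> cring A \<and> l \<in> ring_hom A (witt_ring A) \<and> (\<forall>a\<in>carrier A. l a 1 = a) \<and>
    (\<forall>a\<in>carrier A. witt_map l (l a) = witt_delta A (l a))"
proof (cases "cring A \<and> l \<in> ring_hom A (witt_ring A)")
  case True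
  then have "l a \<in> witt_seqs A" if "a \<in> carrier A" for a using ring_hom_closed[of l A "witt_ring A" a] that by (simp add: carrier_witt_ring)
  then show ?thesis unfolding lambda_ring_def using True by (simp add: ring_hom_Witt ghost_1[simplified] witt_comult_eq)
qed (auto simp: lambda_ring_def ring_hom_Witt)

end

section \<open>Witt vectors of square-zero ideals\<close>

definition sq_zero :: "'b set \<Rightarrow> 'b ring \<Rightarrow> bool" where
  "sq_zero K B \<longleftrightarrow> K \<subseteq> carrier B \<and> \<zero>\<^bsub>B\<^esub> \<in> K \<and> (\<forall>x\<in>K. \<forall>y\<in>K. x \<oplus>\<^bsub>B\<^esub> y \<in> K \<and> x \<otimes>\<^bsub>B\<^esub> y = \<zero>\<^bsub>B\<^esub>) \<and>
     (\<forall>a\<in>carrier B. \<forall>x\<in>K. a \<otimes>\<^bsub>B\<^esub> x \<in> K)"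

definition witt_seqs_in :: "'b set \<Rightarrow> (nat \<Rightarrow> 'b) set" where
  "witt_seqs_in K = ({0<..} \<rightarrow>\<^sub>E K)"

lemma witt_seqs_in_apply [simp]: "x \<in> witt_seqs_in K \<Longrightarrow> n > 0 \<Longrightarrow> x n \<in> K"
  by (auto simp: witt_seqs_in_def)

lemma witt_seqs_in_restrict: "(\<And>n. n > 0 \<Longrightarrow> f n \<in> K) \<Longrightarrow> (\<lambda>n\<in>{0<..}. f n) \<in> witt_seqs_in K"
  by (auto simp: witt_seqs_in_def)

lemma witt_seqs_in_subset: "K \<subseteq> carrier B \<Longrightarrow> x \<in> witt_seqs_in K \<Longrightarrow> x \<in> witt_seqs B"
  by (auto simp: witt_seqs_in_def witt_seqs_def)

lemma sq_zero_witt_seqs: "sq_zero K B \<Longrightarrow> x \<in> witt_seqs_in K \<Longrightarrow> x \<in> witt_seqs B"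
  by (auto simp: sq_zero_def intro: witt_seqs_in_subset)

lemma sq_zero_add_pow:
  fixes n :: nat
  assumes "sq_zero K B" "x \<in> K" shows "add_pow B n x \<in> K"
  using assms by (induction n) (auto simp: sq_zero_def add_pow_def)

text \<open>For a proper divisor \<open>e\<close> the exponent \<open>n div e\<close> is at least 2,
  so the power vanishes.\<close>

lemma ghost_sq_zero:
  assumes B: "cring B" and K: "sq_zero K B" and x: "x \<in> witt_seqs_in K" and n: "n > 0"
  shows "ghost B n x = add_pow B n (x n)"
proof -
  interpret cring B by fact
  have xc: "x \<in> witt_seqs B" using K x by (rule sq_zero_witt_seqs)
  have "add_pow B e (x e [^]\<^bsub>B\<^esub> (n div e)) = \<zero>\<^bsub>B\<^esub>" if e: "e dvd n" "e < n" for e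
  proof -
    obtain k where k: "n = e * k" using e by blast
    have e0: "e > 0" using k n by (cases e) auto
    have "k \<noteq> 0" "k \<noteq> 1" using k e n by auto
    then obtain i where "k = Suc (Suc i)" by (metis One_nat_def not0_implies_Suc)
    then have d: "n div e = Suc (Suc i)" using k e0 by simp
    have xe: "x e \<in> K" "x e \<in> carrier B" using x xc e0 by auto
    have "x e [^]\<^bsub>B\<^esub> (n div e) = x e [^]\<^bsub>B\<^esub> i \<otimes>\<^bsub>B\<^esub> (x e \<otimes>\<^bsub>B\<^esub> x e)"
      unfolding d using xe by (simp add: m_assoc)
    also have "\<dots> = \<zero>\<^bsub>B\<^esub>" using K xe unfolding sq_zero_def by simp
    finally show ?thesis by simp
  qed
  then have "(\<Oplus>\<^bsub>B\<^esub>e\<in>{e. e dvd n \<and> e < n}. add_pow B e (x e [^]\<^bsub>B\<^esub> (n div e))) = \<zero>\<^bsub>B\<^esub>"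
    by (intro add.finprod_one_eqI) auto
  then show ?thesis using ghost_split[OF B xc n] xc n by simp
qed

text \<open>On \<open>K\<close> the n-th ghost component is \<open>n\<close> times the n-th
  coordinate, so each formula can be checked after applying the injective ghost map, for
  \<open>witt_delta\<close> twice.\<close>

lemma witt_ring_sq_zero_torsion_free:
  assumes R: "cring R" "torsion_free R" and K: "sq_zero K R" and x: "x \<in> witt_seqs_in K"
  shows "y \<in> witt_seqs_in K \<Longrightarrow> x \<oplus>\<^bsub>witt_ring R\<^esub> y = (\<lambda>n\<in>{0<..}. x n \<oplus>\<^bsub>R\<^esub> y n)"
    and "a \<in> witt_seqs R \<Longrightarrow> a \<otimes>\<^bsub>witt_ring R\<^esub> x = (\<lambda>n\<in>{0<..}. ghost R n a \<otimes>\<^bsub>R\<^esub> x n)"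
    and "witt_delta R x = (\<lambda>n\<in>{0<..}. \<lambda>m\<in>{0<..}. x (n * m))"
proof -
  interpret cring R by fact
  have xc: "x \<in> witt_seqs R" using K x by (rule sq_zero_witt_seqs)
  note gs = ghost_sq_zero[OF R(1) K]
  show "x \<oplus>\<^bsub>witt_ring R\<^esub> y = (\<lambda>n\<in>{0<..}. x n \<oplus>\<^bsub>R\<^esub> y n)" if y: "y \<in> witt_seqs_in K"
  proof -
    have yc: "y \<in> witt_seqs R" using K y by (rule sq_zero_witt_seqs)
    have s: "(\<lambda>n\<in>{0<..}. x n \<oplus>\<^bsub>R\<^esub> y n) \<in> witt_seqs_in K"
      using K x y by (intro witt_seqs_in_restrict) (simp add: sq_zero_def)
    show ?thesis
    proof (rule ghost_inj[OF R _ sq_zero_witt_seqs[OF K s]])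
      fix n :: nat assume n: "n > 0"
      then show "ghost R n (x \<oplus>\<^bsub>witt_ring R\<^esub> y) = ghost R n (\<lambda>n\<in>{0<..}. x n \<oplus>\<^bsub>R\<^esub> y n)"
        using xc yc by (simp add: ghost_witt_ring R gs x y s[simplified] add.nat_pow_distrib)
    qed (simp add: witt_ring_closed R xc yc)
  qed
  show "a \<otimes>\<^bsub>witt_ring R\<^esub> x = (\<lambda>n\<in>{0<..}. ghost R n a \<otimes>\<^bsub>R\<^esub> x n)" if a: "a \<in> witt_seqs R"
  proof -
    have s: "(\<lambda>n\<in>{0<..}. ghost R n a \<otimes>\<^bsub>R\<^esub> x n) \<in> witt_seqs_in K"
      using K x a by (intro witt_seqs_in_restrict) (simp add: sq_zero_def ghost_closed R)
    show ?thesis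
    proof (rule ghost_inj[OF R _ sq_zero_witt_seqs[OF K s]])
      fix n :: nat assume n: "n > 0"
      then show "ghost R n (a \<otimes>\<^bsub>witt_ring R\<^esub> x) = ghost R n (\<lambda>n\<in>{0<..}. ghost R n a \<otimes>\<^bsub>R\<^esub> x n)"
        using xc a by (simp add: ghost_witt_ring R gs x s[simplified] add_pow_rdistr ghost_closed)
    qed (simp add: witt_ring_closed R xc a)
  qed
  let ?v = "\<lambda>n\<in>{0<..}. \<lambda>m\<in>{0<..}. x (n * m)"
  have vk: "(\<lambda>m\<in>{0<..}. x (n * m)) \<in> witt_seqs_in K" if "n > 0" for n
    using x that by (intro witt_seqs_in_restrict) simp
  have v: "?v \<in> witt_seqs (witt_ring R)"
    by (rule witt_seqs_restrict) (simp add: carrier_witt_ring sq_zero_witt_seqs[OF K vk])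
  have "ghost (witt_ring R) n ?v = witt_frob R n x" if n: "n > 0" for n
  proof (rule ghost_inj[OF R])
    show "ghost (witt_ring R) n ?v \<in> witt_seqs R" using ghost_closed[OF cring_witt_ring(1)[OF R(1)] v n] by (simp add: carrier_witt_ring)
    fix m :: nat assume m: "m > 0"
    have w: "witt_map (ghost R m) ?v = (\<lambda>e\<in>{0<..}. add_pow R m (x (e * m)))"
      using m by (auto simp: witt_map_def gs vk)
    have wk: "(\<lambda>e\<in>{0<..}. add_pow R m (x (e * m))) \<in> witt_seqs_in K"
      using x m by (intro witt_seqs_in_restrict sq_zero_add_pow[OF K]) simp
    \<comment> \<open>The common value is \<open>n * m\<close> times the coordinate
      \<open>x (n * m)\<close>.\<close>
    have "ghost R m (ghost (witt_ring R) n ?v) = add_pow R n (add_pow R m (x (n * m)))"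
      unfolding ghost_ghost[OF R(1) v n m] w using n by (simp add: gs[OF wk])
    also have "\<dots> = ghost R m (witt_frob R n x)"
      using xc m n by (simp add: ghost_witt_frob R gs x add.nat_pow_pow mult.commute)
    finally show "ghost R m (ghost (witt_ring R) n ?v) = ghost R m (witt_frob R n x)" .
  qed (simp add: witt_frob_closed R xc)
  then show "witt_delta R x = ?v"
    by (intro ghost_inj[OF cring_witt_ring(1)[OF R(1)] torsion_free_witt_ring[OF R] _ v])
      (simp_all add: witt_delta_closed ghost_witt_delta R xc)
qed

text \<open>Every square-zero ideal lifts to one in a torsion-free ring: if \<open>\<pi>\<close> maps a polynomial ring to \<open>B\<close>,
  the pairs \<open>p + q \<epsilon>\<close> of dual numbers with \<open>\<pi> q \<in> K\<close> map to \<open>B\<close> by \<open>p + q \<epsilon> \<mapsto> \<pi> p + \<pi> q\<close>.\<close>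

definition dual_ring :: "zpoly set \<Rightarrow> (zpoly \<times> zpoly) ring" where
  "dual_ring J = \<lparr>carrier = UNIV \<times> J, monoid.mult = \<lambda>(p, q) (p', q'). (p * p', p * q' + p' * q), one = (1, 0),
     ring.zero = (0, 0), ring.add = \<lambda>(p, q) (p', q'). (p + p', q + q')\<rparr>"

lemma sq_zero_lift:
  fixes B :: "'b ring"
  assumes B: "cring B" and K: "sq_zero K B" and x: "x \<in> witt_seqs_in K" and y: "y \<in> witt_seqs_in K" and a: "a \<in> witt_seqs B"
  obtains R :: "(zpoly \<times> zpoly) ring" and K' \<Psi> x' y' a' where
    "cring R" "torsion_free R" "sq_zero K' R" "\<Psi> \<in> ring_hom R B" "x' \<in> witt_seqs_in K'" "y' \<in> witt_seqs_in K'" "a' \<in> witt_seqs R"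
    "witt_map \<Psi> x' = x" "witt_map \<Psi> y' = y" "witt_map \<Psi> a' = a"
proof -
  interpret cring B by fact
  have xy: "x \<in> witt_seqs B" "y \<in> witt_seqs B" using K x y by (simp_all add: sq_zero_witt_seqs)
  obtain \<pi> where \<pi>: "\<pi> \<in> ring_hom zpoly_ring B" "witt_map \<pi> (gen 0) = x" "witt_map \<pi> (gen 1) = y" "witt_map \<pi> (gen 2) = a"
    using lift3[OF B xy a] by metis
  interpret P: ring_hom_cring zpoly_ring B \<pi>
    using B \<pi>(1) cring_zpoly_ring by (intro ring_hom_cring.intro ring_hom_cring_axioms.intro)
  have ph: "\<pi> (p + q) = \<pi> p \<oplus>\<^bsub>B\<^esub> \<pi> q" "\<pi> (p * q) = \<pi> p \<otimes>\<^bsub>B\<^esub> \<pi> q" "\<pi> 0 = \<zero>\<^bsub>B\<^esub>" "\<pi> 1 = \<one>\<^bsub>B\<^esub>" "\<pi> p \<in> carrier B" for p q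
    using P.hom_add[of p q] P.hom_mult[of p q] P.hom_zero P.hom_one P.hom_closed[of p] by simp_all
  define J where "J = {q. \<pi> q \<in> K}"
  define R where "R = dual_ring J"
  have J0: "0 \<in> J" and Ja: "\<And>p q. p \<in> J \<Longrightarrow> q \<in> J \<Longrightarrow> p + q \<in> J" and Jm: "\<And>p q. q \<in> J \<Longrightarrow> p * q \<in> J"
    using K by (auto simp: J_def sq_zero_def ph)
  have Jm': "q * p \<in> J" if "q \<in> J" for p q using Jm[OF that, of p] by (simp add: mult.commute)
  have Jn: "- q \<in> J" if "q \<in> J" for q using Jm[OF that, of "- 1"] by simp
  have [simp]: "carrier R = UNIV \<times> J" "(p, q) \<otimes>\<^bsub>R\<^esub> (p', q') = (p * p', p * q' + p' * q)" "\<one>\<^bsub>R\<^esub> = (1, 0)"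
    "\<zero>\<^bsub>R\<^esub> = (0, 0)" "(p, q) \<oplus>\<^bsub>R\<^esub> (p', q') = (p + p', q + q')" for p q p' q'
    by (simp_all add: R_def dual_ring_def)
  have R: "cring R"
  proof (intro cringI abelian_groupI comm_monoidI)
    fix u assume "u \<in> carrier R"
    then show "\<exists>v\<in>carrier R. v \<oplus>\<^bsub>R\<^esub> u = \<zero>\<^bsub>R\<^esub>"
      by (intro bexI[of _ "(- fst u, - snd u)"]) (auto simp: Jn)
  qed (auto simp: algebra_simps J0 Ja Jm Jm')
  interpret R: cring R by (rule R)
  have pow: "add_pow R n (p, q) = (of_nat n * p, of_nat n * q)" for n :: nat and p q
    by (induction n) (simp_all add: add_pow_def algebra_simps)
  have tf: "torsion_free R"
    unfolding torsion_free_def by (auto simp: pow dest: zpoly_of_nat_mult_cancel[of _ _ 0, simplified])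
  define \<Psi> where "\<Psi> = (\<lambda>(p, q). \<pi> p \<oplus>\<^bsub>B\<^esub> \<pi> q)"
  have KK: "u \<otimes>\<^bsub>B\<^esub> v = \<zero>\<^bsub>B\<^esub>" if "u \<in> K" "v \<in> K" for u v using K that by (simp add: sq_zero_def)
  have \<Psi>: "\<Psi> \<in> ring_hom R B"
  proof (rule ring_hom_memI)
    fix u v assume "u \<in> carrier R" "v \<in> carrier R"
    then obtain p q p' q' where uv: "u = (p, q)" "v = (p', q')" "\<pi> q \<in> K" "\<pi> q' \<in> K" by (auto simp: J_def)
    \<comment> \<open>Multiplication of dual numbers omits \<open>q * q'\<close>; its image is a
      product of two elements of \<open>K\<close>, hence zero.\<close>
    have "(\<pi> p \<oplus>\<^bsub>B\<^esub> \<pi> q) \<otimes>\<^bsub>B\<^esub> (\<pi> p' \<oplus>\<^bsub>B\<^esub> \<pi> q')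
      = \<pi> p \<otimes>\<^bsub>B\<^esub> \<pi> p' \<oplus>\<^bsub>B\<^esub> (\<pi> p \<otimes>\<^bsub>B\<^esub> \<pi> q' \<oplus>\<^bsub>B\<^esub> \<pi> p' \<otimes>\<^bsub>B\<^esub> \<pi> q) \<oplus>\<^bsub>B\<^esub> \<pi> q \<otimes>\<^bsub>B\<^esub> \<pi> q'"
      using ph(5)[of p] ph(5)[of q] ph(5)[of p'] ph(5)[of q'] by algebra
    then show "\<Psi> (u \<otimes>\<^bsub>R\<^esub> v) = \<Psi> u \<otimes>\<^bsub>B\<^esub> \<Psi> v"
      using uv ph(5) by (simp add: \<Psi>_def ph(1-4) KK[OF uv(3,4)])
    show "\<Psi> (u \<oplus>\<^bsub>R\<^esub> v) = \<Psi> u \<oplus>\<^bsub>B\<^esub> \<Psi> v"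
      using uv ph(5) by (simp add: \<Psi>_def ph(1-4) a_ac)
    show "\<Psi> u \<in> carrier B" using uv ph(5) by (simp add: \<Psi>_def)
  qed (simp add: \<Psi>_def ph)
  define K' where "K' = {0 :: zpoly} \<times> J"
  have K': "sq_zero K' R"
    by (auto simp: sq_zero_def K'_def J0 Ja Jm)
  have gJ: "gen i n \<in> J" if "n > 0" "witt_map \<pi> (gen i) \<in> witt_seqs_in K" for i n
    using witt_seqs_in_apply[OF that(2,1)] that(1) by (simp add: J_def witt_map_apply)
  have s: "witt_map \<Psi> (\<lambda>n\<in>{0<..}. (0, gen i n)) = witt_map \<pi> (gen i)"
    "witt_map \<Psi> (\<lambda>n\<in>{0<..}. (gen i n, 0)) = witt_map \<pi> (gen i)" for i
    using ph(5) by (auto simp: witt_map_def \<Psi>_def ph(3))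
  show ?thesis
  \<comment> \<open>The vectors with coordinates in \<open>K\<close> are lifted to the infinitesimal
    component, the vector \<open>a\<close> to the constant one.\<close>
  proof (rule that[OF R tf K' \<Psi>, of "\<lambda>n\<in>{0<..}. (0, gen 0 n)" "\<lambda>n\<in>{0<..}. (0, gen 1 n)" "\<lambda>n\<in>{0<..}. (gen 2 n, 0)"])
    show "(\<lambda>n\<in>{0<..}. (0, gen 0 n)) \<in> witt_seqs_in K'" "(\<lambda>n\<in>{0<..}. (0, gen 1 n)) \<in> witt_seqs_in K'"
      using gJ x y \<pi> by (intro witt_seqs_in_restrict; simp add: K'_def)+
    show "(\<lambda>n\<in>{0<..}. (gen 2 n, 0)) \<in> witt_seqs R"
      by (intro witt_seqs_restrict) (simp add: J0)
  qed (simp_all only: s \<pi>)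
qed

lemma witt_ring_sq_zero:
  fixes B :: "'b ring"
  assumes B: "cring B" and K: "sq_zero K B" and x: "x \<in> witt_seqs_in K"
  shows "y \<in> witt_seqs_in K \<Longrightarrow> x \<oplus>\<^bsub>witt_ring B\<^esub> y = (\<lambda>n\<in>{0<..}. x n \<oplus>\<^bsub>B\<^esub> y n)"
    and "a \<in> witt_seqs B \<Longrightarrow> a \<otimes>\<^bsub>witt_ring B\<^esub> x = (\<lambda>n\<in>{0<..}. ghost B n a \<otimes>\<^bsub>B\<^esub> x n)"
    and "witt_delta B x = (\<lambda>n\<in>{0<..}. \<lambda>m\<in>{0<..}. x (n * m))"
proof -
  have main: "x \<oplus>\<^bsub>witt_ring B\<^esub> y = (\<lambda>n\<in>{0<..}. x n \<oplus>\<^bsub>B\<^esub> y n) \<and>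
    a \<otimes>\<^bsub>witt_ring B\<^esub> x = (\<lambda>n\<in>{0<..}. ghost B n a \<otimes>\<^bsub>B\<^esub> x n) \<and>
    witt_delta B x = (\<lambda>n\<in>{0<..}. \<lambda>m\<in>{0<..}. x (n * m))" if y: "y \<in> witt_seqs_in K" and a: "a \<in> witt_seqs B" for y a
  proof -
    obtain R :: "(zpoly \<times> zpoly) ring" and K' \<Psi> x' y' a' where
      R: "cring R" "torsion_free R" and K': "sq_zero K' R" and \<Psi>: "\<Psi> \<in> ring_hom R B"
      and l: "x' \<in> witt_seqs_in K'" "y' \<in> witt_seqs_in K'" "a' \<in> witt_seqs R"
      and e: "x = witt_map \<Psi> x'" "y = witt_map \<Psi> y'" "a = witt_map \<Psi> a'"
      using sq_zero_lift[OF B K x y a] by metis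
    note c = sq_zero_witt_seqs[OF K' l(1)] sq_zero_witt_seqs[OF K' l(2)]
    note T = witt_ring_sq_zero_torsion_free[OF R K' l(1)]
    have "x \<oplus>\<^bsub>witt_ring B\<^esub> y = witt_map \<Psi> (\<lambda>n\<in>{0<..}. x' n \<oplus>\<^bsub>R\<^esub> y' n)"
      unfolding e T(1)[OF l(2), symmetric] using witt_ring_natural(3)[OF R(1) B \<Psi> c] by simp
    moreover have "a \<otimes>\<^bsub>witt_ring B\<^esub> x = witt_map \<Psi> (\<lambda>n\<in>{0<..}. ghost R n a' \<otimes>\<^bsub>R\<^esub> x' n)"
      unfolding e T(2)[OF l(3), symmetric] using witt_ring_natural(4)[OF R(1) B \<Psi> l(3) c(1)] by simp
    moreover have "witt_delta B x = witt_map (witt_map \<Psi>) (\<lambda>n\<in>{0<..}. \<lambda>m\<in>{0<..}. x' (n * m))"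
      unfolding e T(3)[symmetric] using witt_delta_natural[OF R(1) B \<Psi> c(1)] by simp
    ultimately show ?thesis
      using c l(3) by (auto simp: witt_map_def e ring_hom_add[OF \<Psi>] ring_hom_mult[OF \<Psi>] ghost_closed[OF R(1)]
          ghost_hom[OF R(1) B \<Psi> l(3), unfolded witt_map_def] fun_eq_iff)
  qed
  interpret cring B by fact
  have "x \<in> witt_seqs B" using K x by (rule sq_zero_witt_seqs)
  then show "y \<in> witt_seqs_in K \<Longrightarrow> x \<oplus>\<^bsub>witt_ring B\<^esub> y = (\<lambda>n\<in>{0<..}. x n \<oplus>\<^bsub>B\<^esub> y n)"
    and "a \<in> witt_seqs B \<Longrightarrow> a \<otimes>\<^bsub>witt_ring B\<^esub> x = (\<lambda>n\<in>{0<..}. ghost B n a \<otimes>\<^bsub>B\<^esub> x n)"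
    and "witt_delta B x = (\<lambda>n\<in>{0<..}. \<lambda>m\<in>{0<..}. x (n * m))"
    using main x by blast+
qed

lemma witt_ring_sq_zero_zero:
  assumes B: "cring B" and K: "sq_zero K B"
  shows "\<zero>\<^bsub>witt_ring B\<^esub> = (\<lambda>n\<in>{0<..}. \<zero>\<^bsub>B\<^esub>)"
proof -
  interpret cring B by fact
  interpret W: cring "witt_ring B" by (rule cring_witt_ring[OF B])
  let ?z = "\<lambda>n\<in>{0::nat<..}. \<zero>\<^bsub>B\<^esub>"
  have z: "?z \<in> witt_seqs_in K" using K by (intro witt_seqs_in_restrict) (simp add: sq_zero_def)
  have c: "?z \<in> carrier (witt_ring B)" using sq_zero_witt_seqs[OF K z] by (simp add: carrier_witt_ring)
  \<comment> \<open>An element equal to its own double is zero.\<close>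
  have "?z \<oplus>\<^bsub>witt_ring B\<^esub> ?z = ?z" unfolding witt_ring_sq_zero(1)[OF B K z z] by auto
  then show ?thesis using c by (metis W.add.r_cancel_one')
qed

section \<open>Abelian group objects and their kernels\<close>

lemma fibre_square_simps:
  "carrier (fibre_square P) = {(x, y). x \<in> carrier (total P) \<and> y \<in> carrier (total P) \<and> proj P x = proj P y}"
  "(x, y) \<otimes>\<^bsub>fibre_square P\<^esub> (x', y') = (x \<otimes>\<^bsub>total P\<^esub> x', y \<otimes>\<^bsub>total P\<^esub> y')"
  "(x, y) \<oplus>\<^bsub>fibre_square P\<^esub> (x', y') = (x \<oplus>\<^bsub>total P\<^esub> x', y \<oplus>\<^bsub>total P\<^esub> y')"
  "\<one>\<^bsub>fibre_square P\<^esub> = (\<one>\<^bsub>total P\<^esub>, \<one>\<^bsub>total P\<^esub>)"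
  "\<zero>\<^bsub>fibre_square P\<^esub> = (\<zero>\<^bsub>total P\<^esub>, \<zero>\<^bsub>total P\<^esub>)"
  by (simp_all add: fibre_square_def RDirProd_def DirProd_def monoid.defs)

text \<open>The zero ideal of any ring has square zero.\<close>

lemma witt_ring_zero: "cring A \<Longrightarrow> \<zero>\<^bsub>witt_ring A\<^esub> = (\<lambda>n\<in>{0<..}. \<zero>\<^bsub>A\<^esub>)"
proof -
  assume A: "cring A"
  interpret cring A by fact
  have "sq_zero {\<zero>\<^bsub>A\<^esub>} A" by (auto simp: sq_zero_def)
  then show ?thesis using witt_ring_sq_zero_zero A by blast
qed

section \<open>The group law of an abelian group object in terms of the ring structure\<close>

locale ring_ab =
  fixes A :: "'u ring" and P :: "('u, 'k) ring_ab_scheme"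
  assumes is_ab: "is_ring_ab A P"
begin

abbreviation "B \<equiv> total P"
abbreviation "f \<equiv> proj P"
abbreviation "p \<equiv> ab_plus P"
abbreviation "z \<equiv> ab_zero P"
abbreviation "i \<equiv> ab_neg P"

definition K :: "'u set" where "K = {x \<in> carrier B. f x = \<zero>\<^bsub>A\<^esub>}"

lemma K_eq: "a_kernel B A f = K"
  by (simp add: a_kernel_def' K_def)

lemma crings: "cring A" "cring B"
  using is_ab by (auto simp: is_ring_ab_def Let_def)

sublocale A: cring A by (rule crings)
sublocale B: cring "total P" by (rule crings)

lemma homs: "f \<in> ring_hom B A" "z \<in> ring_hom A B" "i \<in> ring_hom B B" "p \<in> ring_hom (fibre_square P) B"
  using is_ab by (auto simp: is_ring_ab_def Let_def)

sublocale f: ring_hom_cring "total P" A "proj P"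
  using homs by unfold_locales
sublocale z: ring_hom_cring A "total P" "ab_zero P"
  using homs by unfold_locales
sublocale i: ring_hom_cring "total P" "total P" "ab_neg P"
  using homs by unfold_locales

lemma f_z [simp]: "a \<in> carrier A \<Longrightarrow> f (z a) = a"
  using is_ab by (simp add: is_ring_ab_def Let_def)

lemma f_i [simp]: "x \<in> carrier B \<Longrightarrow> f (i x) = f x"
  using is_ab by (simp add: is_ring_ab_def Let_def)

lemma p_closed: "x \<in> carrier B \<Longrightarrow> y \<in> carrier B \<Longrightarrow> f x = f y \<Longrightarrow> p (x, y) \<in> carrier B"
  using ring_hom_closed[OF homs(4), of "(x, y)"] by (simp add: fibre_square_simps)

lemma p_comm: "x \<in> carrier B \<Longrightarrow> y \<in> carrier B \<Longrightarrow> f x = f y \<Longrightarrow> p (x, y) = p (y, x)"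
  using is_ab unfolding is_ring_ab_def Let_def by blast

lemma p_i: "x \<in> carrier B \<Longrightarrow> p (i x, x) = z (f x)"
  using is_ab unfolding is_ring_ab_def Let_def by blast

lemma p_zero: "x \<in> carrier B \<Longrightarrow> p (z (f x), x) = x" "x \<in> carrier B \<Longrightarrow> p (x, z (f x)) = x"
proof -
  show 1: "p (z (f x), x) = x" if "x \<in> carrier B"
    using is_ab that unfolding is_ring_ab_def Let_def by blast
  show "p (x, z (f x)) = x" if x: "x \<in> carrier B"
    using 1[OF x] p_comm[of x "z (f x)"] x by simp
qed

text \<open>An Eckmann-Hilton argument: \<open>p\<close> is additive on the fibre square, where
  \<open>(x, z (f x)) + (z (f y), y)\<close> regroups as \<open>(x, y)\<close> plus a pair of zeros
  of the fibre. Thus \<open>p (x, y) = x + y - z (f x)\<close>, and the group law is determined by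
  the ring, the projection and the zero section.\<close>

lemma p_eq:
  assumes "x \<in> carrier B" "y \<in> carrier B" "f x = f y"
  shows "p (x, y) \<oplus>\<^bsub>B\<^esub> z (f x) = x \<oplus>\<^bsub>B\<^esub> y"
proof -
  have "p ((x, y) \<oplus>\<^bsub>fibre_square P\<^esub> (z (f x), z (f x))) = p (x, y) \<oplus>\<^bsub>B\<^esub> p (z (f x), z (f x))"
    using assms by (intro ring_hom_add[OF homs(4)]) (auto simp: fibre_square_simps)
  also have "p (z (f x), z (f x)) = z (f x)" using p_zero(1)[of "z (f x)"] assms by simp
  finally have 1: "p (x, y) \<oplus>\<^bsub>B\<^esub> z (f x) = p (x \<oplus>\<^bsub>B\<^esub> z (f x), y \<oplus>\<^bsub>B\<^esub> z (f x))"
    by (simp add: fibre_square_simps)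
  have "p ((x, z (f x)) \<oplus>\<^bsub>fibre_square P\<^esub> (z (f y), y)) = p (x, z (f x)) \<oplus>\<^bsub>B\<^esub> p (z (f y), y)"
    using assms by (intro ring_hom_add[OF homs(4)]) (auto simp: fibre_square_simps)
  then have "p (x \<oplus>\<^bsub>B\<^esub> z (f x), y \<oplus>\<^bsub>B\<^esub> z (f x)) = x \<oplus>\<^bsub>B\<^esub> y"
    using assms p_zero(2)[OF assms(1)] p_zero(1)[OF assms(2)] by (simp add: fibre_square_simps B.a_comm)
  with 1 show ?thesis by simp
qed

lemma i_eq:
  assumes "x \<in> carrier B" shows "i x \<oplus>\<^bsub>B\<^esub> x = z (f x) \<oplus>\<^bsub>B\<^esub> z (f x)"
proof -
  show ?thesis using p_eq[of "i x" x] p_i[OF assms] assms by simp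
qed

lemma K_sq_zero: "sq_zero K B"
proof -
  have "x \<otimes>\<^bsub>B\<^esub> y = \<zero>\<^bsub>B\<^esub>" if "x \<in> K" "y \<in> K" for x y
  proof -
    have xy: "x \<in> carrier B" "f x = \<zero>\<^bsub>A\<^esub>" "y \<in> carrier B" "f y = \<zero>\<^bsub>A\<^esub>" using that by (auto simp: K_def)
    have "p ((x, z (f x)) \<otimes>\<^bsub>fibre_square P\<^esub> (z (f y), y)) = p (x, z (f x)) \<otimes>\<^bsub>B\<^esub> p (z (f y), y)"
      using xy by (intro ring_hom_mult[OF homs(4)]) (auto simp: fibre_square_simps)
    also have "\<dots> = x \<otimes>\<^bsub>B\<^esub> y" by (simp only: p_zero xy(1,3))
    finally have "x \<otimes>\<^bsub>B\<^esub> y = p (\<zero>\<^bsub>B\<^esub>, \<zero>\<^bsub>B\<^esub>)" using xy by (simp add: fibre_square_simps)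
    also have "\<dots> = \<zero>\<^bsub>B\<^esub>" using p_zero(1)[of "\<zero>\<^bsub>B\<^esub>"] by simp
    finally show ?thesis .
  qed
  then show ?thesis by (auto simp: sq_zero_def) (auto simp: K_def)
qed

lemma K_I: "x \<in> carrier B \<Longrightarrow> x \<ominus>\<^bsub>B\<^esub> z (f x) \<in> K"
  by (simp add: K_def B.minus_eq A.r_neg)

lemma K_carrier: "x \<in> K \<Longrightarrow> x \<in> carrier B" "x \<in> K \<Longrightarrow> f x = \<zero>\<^bsub>A\<^esub>"
  by (simp_all add: K_def)

lemma decomp: "x \<in> carrier B \<Longrightarrow> z (f x) \<oplus>\<^bsub>B\<^esub> (x \<ominus>\<^bsub>B\<^esub> z (f x)) = x"
proof -
  assume x: "x \<in> carrier B"
  then have "z (f x) \<in> carrier B" by simp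
  with x show ?thesis by algebra
qed

lemma decompE:
  assumes "x \<in> carrier B"
  obtains a k where "a \<in> carrier A" "k \<in> K" "x = z a \<oplus>\<^bsub>B\<^esub> k"
  using decomp[OF assms] K_I[OF assms] assms that[of "f x" "x \<ominus>\<^bsub>B\<^esub> z (f x)"] by simp

lemma K_decomp:
  assumes "a \<in> carrier A" "k \<in> K"
  shows "f (z a \<oplus>\<^bsub>B\<^esub> k) = a" "(z a \<oplus>\<^bsub>B\<^esub> k) \<ominus>\<^bsub>B\<^esub> z a = k"
proof -
  have k: "k \<in> carrier B" "z a \<in> carrier B" using assms by (auto simp: K_def)
  show "f (z a \<oplus>\<^bsub>B\<^esub> k) = a" using assms k by (simp add: K_carrier)
  show "(z a \<oplus>\<^bsub>B\<^esub> k) \<ominus>\<^bsub>B\<^esub> z a = k" using k by algebra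
qed

lemma K_add: "x \<in> K \<Longrightarrow> y \<in> K \<Longrightarrow> x \<oplus>\<^bsub>B\<^esub> y \<in> K"
  and K_mult: "a \<in> carrier B \<Longrightarrow> x \<in> K \<Longrightarrow> a \<otimes>\<^bsub>B\<^esub> x \<in> K"
  and K_zero: "\<zero>\<^bsub>B\<^esub> \<in> K"
  and K_mult_zero: "x \<in> K \<Longrightarrow> y \<in> K \<Longrightarrow> x \<otimes>\<^bsub>B\<^esub> y = \<zero>\<^bsub>B\<^esub>"
  using K_sq_zero by (auto simp: sq_zero_def)

end

text \<open>By \<open>p_eq\<close> and \<open>i_eq\<close>, addition and negation are expressed by
  ring operations and the zero section, so compatibility with them is automatic.\<close>

lemma ring_ab_mapsI:
  assumes P: "is_ring_ab A P" and Q: "is_ring_ab A Q"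
    and g: "g \<in> ring_hom (total P) (total Q)" "g \<in> extensional (carrier (total P))"
    and f: "\<And>x. x \<in> carrier (total P) \<Longrightarrow> proj Q (g x) = proj P x"
    and z: "\<And>a. a \<in> carrier A \<Longrightarrow> g (ab_zero P a) = ab_zero Q a"
  shows "g \<in> ring_ab_maps A P Q"
proof -
  interpret P: ring_ab A P by unfold_locales fact
  interpret Q: ring_ab A Q by unfold_locales fact
  note gc = ring_hom_closed[OF g(1)]
  have p: "g (ab_plus P (x, y)) = ab_plus Q (g x, g y)"
    if xy: "x \<in> carrier (total P)" "y \<in> carrier (total P)" "proj P x = proj P y" for x y
  proof -
    have e: "proj Q (g x) = proj Q (g y)" using f xy by simp
    have "g (ab_plus P (x, y)) \<oplus>\<^bsub>total Q\<^esub> ab_zero Q (proj P x) = g (ab_plus P (x, y) \<oplus>\<^bsub>total P\<^esub> ab_zero P (proj P x))"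
      using xy by (simp add: ring_hom_add[OF g(1)] P.p_closed z)
    also have "\<dots> = g x \<oplus>\<^bsub>total Q\<^esub> g y" by (simp only: P.p_eq[OF xy] ring_hom_add[OF g(1)] xy(1,2))
    also have "\<dots> = ab_plus Q (g x, g y) \<oplus>\<^bsub>total Q\<^esub> ab_zero Q (proj P x)"
      using Q.p_eq[of "g x" "g y"] gc xy f e by simp
    finally show ?thesis using gc P.p_closed Q.p_closed xy e
      by (simp add: Q.B.add.right_cancel)
  qed
  have i: "g (ab_neg P x) = ab_neg Q (g x)" if x: "x \<in> carrier (total P)" for x
  proof -
    have "g (ab_neg P x) \<oplus>\<^bsub>total Q\<^esub> g x = g (ab_neg P x \<oplus>\<^bsub>total P\<^esub> x)" using x by (simp add: ring_hom_add[OF g(1)])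
    also have "\<dots> = ab_neg Q (g x) \<oplus>\<^bsub>total Q\<^esub> g x"
      using x gc f by (simp add: P.i_eq Q.i_eq ring_hom_add[OF g(1)] z)
    finally show ?thesis using gc x by (simp add: Q.B.add.right_cancel)
  qed
  show ?thesis unfolding ring_ab_maps_def using g f z p i by (auto simp: fibre_square_simps)
qed

definition kernel_lambda_module :: "'u ring \<Rightarrow> 'u lambda_ab \<Rightarrow> ('u, 'u) lambda_module" where
  "kernel_lambda_module A P = \<lparr>
     carrier = a_kernel (total P) A (proj P),
     monoid.mult = monoid.mult (total P), one = one (total P),
     ring.zero = ring.zero (total P), ring.add = ring.add (total P),
     smult = \<lambda>a x. ab_zero P a \<otimes>\<^bsub>total P\<^esub> x,
     mod_lam = \<lambda>n x. lam P x n\<rparr>"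

lemma truncate_kernel_lambda_module:
  "module.truncate (kernel_lambda_module A P) = kernel_module A (ring_ab.truncate P)"
  by (simp add: kernel_lambda_module_def kernel_module_def module.truncate_def ring_ab.truncate_def)

text \<open>Elements on which the structure maps are compatible along \<open>g\<close> are closed
  under sums. With the decomposition of the total ring this reduces compatibility to the image of
  \<open>A\<close> and to the kernel.\<close>

lemma witt_hom_eq_add:
  assumes B: "cring B" and C: "cring C" and g: "g \<in> ring_hom B C"
    and L: "L \<in> ring_hom B (witt_ring B)" and M: "M \<in> ring_hom C (witt_ring C)"
    and x: "x \<in> carrier B" "M (g x) = witt_map g (L x)" and y: "y \<in> carrier B" "M (g y) = witt_map g (L y)"
  shows "M (g (x \<oplus>\<^bsub>B\<^esub> y)) = witt_map g (L (x \<oplus>\<^bsub>B\<^esub> y))"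
  using assms ring_hom_closed[OF L] ring_hom_closed[OF g]
  by (simp add: ring_hom_add[OF g] ring_hom_add[OF L] ring_hom_add[OF M] witt_ring_natural[OF B C g] carrier_witt_ring)

section \<open>The kernel as a module over the lambda-ring\<close>

locale lambda_ab = ring_ab A P for A :: "'u ring" and P :: "'u lambda_ab" +
  fixes l :: "'u \<Rightarrow> nat \<Rightarrow> 'u"
  assumes inf: "infinite (UNIV :: 'u set)" and is_lab: "is_lambda_ab A l P"
begin

abbreviation "L \<equiv> lam P"

lemma lambda_rings: "lambda_ring A l" "lambda_ring B L"
  using is_lab by (auto simp: is_lambda_ab_def)

lemma lA: "l \<in> ring_hom A (witt_ring A)" "\<And>a. a \<in> carrier A \<Longrightarrow> l a 1 = a" "\<And>a. a \<in> carrier A \<Longrightarrow> witt_map l (l a) = witt_delta A (l a)"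
  using lambda_rings(1) lambda_ring_iff[OF inf] by auto

lemma LB: "L \<in> ring_hom B (witt_ring B)" "\<And>a. a \<in> carrier B \<Longrightarrow> L a 1 = a" "\<And>a. a \<in> carrier B \<Longrightarrow> witt_map L (L a) = witt_delta B (L a)"
  using lambda_rings(2) lambda_ring_iff[OF inf] by auto

lemma L_witt_seqs: "x \<in> carrier B \<Longrightarrow> L x \<in> witt_seqs B"
  using ring_hom_closed[OF LB(1)] by (simp add: carrier_witt_ring)

lemma l_witt_seqs: "x \<in> carrier A \<Longrightarrow> l x \<in> witt_seqs A"
  using ring_hom_closed[OF lA(1)] by (simp add: carrier_witt_ring)

lemma L_f: "x \<in> carrier B \<Longrightarrow> l (f x) = witt_map f (L x)"
  using is_lab by (auto simp: is_lambda_ab_def lambda_hom_def)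

lemma L_z: "a \<in> carrier A \<Longrightarrow> L (z a) = witt_map z (l a)"
  using is_lab by (auto simp: is_lambda_ab_def lambda_hom_def)

text \<open>The projection carries \<open>L x\<close> to \<open>l (f x) = l 0\<close>, the Witt
  vector with all coordinates 0.\<close>

lemma L_K:
  assumes x: "x \<in> K" shows "L x \<in> witt_seqs_in K"
proof -
  have xc: "x \<in> carrier B" "f x = \<zero>\<^bsub>A\<^esub>" using x by (auto simp: K_def)
  have "witt_map f (L x) = \<zero>\<^bsub>witt_ring A\<^esub>"
    using L_f[OF xc(1)] ring_hom_zero[OF lA(1) A.ring_axioms cring.axioms(1)[OF cring_witt_ring(1)[OF A.cring_axioms]]] xc by simp
  then have "f (L x n) = \<zero>\<^bsub>A\<^esub>" if "n > 0" for n
    using that by (metis witt_ring_zero A.cring_axioms greaterThan_iff restrict_apply' witt_map_apply)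
  moreover have "L x = (\<lambda>n\<in>{0<..}. L x n)"
    using L_witt_seqs[OF xc(1)] by (auto simp: witt_seqs_def PiE_iff extensional_def)
  ultimately show ?thesis using L_witt_seqs[OF xc(1)] by (metis (mono_tags, lifting) K_def witt_seqs_apply witt_seqs_in_restrict mem_Collect_eq)
qed

lemma L_closed: "x \<in> K \<Longrightarrow> n > 0 \<Longrightarrow> L x n \<in> K"
  using L_K by simp

lemma L_add: "x \<in> K \<Longrightarrow> y \<in> K \<Longrightarrow> n > 0 \<Longrightarrow> L (x \<oplus>\<^bsub>B\<^esub> y) n = L x n \<oplus>\<^bsub>B\<^esub> L y n"
  using ring_hom_add[OF LB(1)] witt_ring_sq_zero(1)[OF B.cring_axioms K_sq_zero L_K L_K] by (simp add: K_carrier)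

text \<open>The coordinate formula for products multiplies by \<open>ghost B n (L (z a))\<close>,
  and naturality along the zero section turns this into the Adams operation.\<close>

lemma L_smult:
  assumes "a \<in> carrier A" "x \<in> K" "n > 0"
  shows "L (z a \<otimes>\<^bsub>B\<^esub> x) n = z (adams A l n a) \<otimes>\<^bsub>B\<^esub> L x n"
proof -
  have "L (z a \<otimes>\<^bsub>B\<^esub> x) = L (z a) \<otimes>\<^bsub>witt_ring B\<^esub> L x" using assms ring_hom_mult[OF LB(1)] by (simp add: K_carrier)
  also have "\<dots> = (\<lambda>n\<in>{0<..}. ghost B n (L (z a)) \<otimes>\<^bsub>B\<^esub> L x n)"
    using assms by (intro witt_ring_sq_zero(2)[OF B.cring_axioms K_sq_zero L_K] L_witt_seqs) auto
  finally have "L (z a \<otimes>\<^bsub>B\<^esub> x) n = ghost B n (L (z a)) \<otimes>\<^bsub>B\<^esub> L x n" using assms by simp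
  also have "ghost B n (L (z a)) = z (adams A l n a)"
    unfolding adams_def L_z[OF assms(1)] using assms homs(2) l_witt_seqs
    by (intro ghost_hom[symmetric] A.cring_axioms B.cring_axioms) auto
  finally show ?thesis .
qed

lemma L_comp: "x \<in> K \<Longrightarrow> m > 0 \<Longrightarrow> n > 0 \<Longrightarrow> L (L x n) m = L x (m * n)"
proof -
  assume x: "x \<in> K" and mn: "m > 0" "n > 0"
  have "witt_map L (L x) n = witt_delta B (L x) n" using LB(3) K_carrier(1)[OF x] by simp
  then show ?thesis using mn unfolding witt_ring_sq_zero(3)[OF B.cring_axioms K_sq_zero L_K[OF x]]
    by (simp add: witt_map_apply mult.commute)
qed

abbreviation "KM \<equiv> kernel_lambda_module A P"

lemma KM_simps [simp]: "carrier KM = K" "x \<oplus>\<^bsub>KM\<^esub> y = x \<oplus>\<^bsub>B\<^esub> y" "a \<odot>\<^bsub>KM\<^esub> x = z a \<otimes>\<^bsub>B\<^esub> x" "mod_lam KM n x = L x n"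
  "\<zero>\<^bsub>KM\<^esub> = \<zero>\<^bsub>B\<^esub>"
  by (simp_all add: kernel_lambda_module_def K_eq)

lemma module_KM: "module A KM"
proof (intro moduleI abelian_groupI A.cring_axioms)
  fix x assume "x \<in> carrier KM"
  then have "x \<in> K" by simp
  then show "\<exists>y\<in>carrier KM. y \<oplus>\<^bsub>KM\<^esub> x = \<zero>\<^bsub>KM\<^esub>"
    by (intro bexI[of _ "\<ominus>\<^bsub>B\<^esub> x"]) (auto simp: K_def B.l_neg)
qed (auto simp: K_add K_mult K_zero K_carrier B.a_ac B.l_distr B.r_distr B.m_assoc)

lemma is_lambda_module_KM: "is_lambda_module A l KM"
  unfolding is_lambda_module_def
  by (auto simp: module_KM L_closed L_add L_smult L_comp LB(2)[simplified] K_carrier)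

end

lemma lambda_abI: "infinite (UNIV :: 'u set) \<Longrightarrow> is_lambda_ab A l P \<Longrightarrow> lambda_ab A P l" for P :: "'u lambda_ab"
  by unfold_locales (auto simp: is_lambda_ab_def)

section \<open>Full faithfulness of the kernel functor\<close>

context
  fixes A :: "'u ring" and l :: "'u \<Rightarrow> nat \<Rightarrow> 'u" and P Q :: "'u lambda_ab"
  assumes inf: "infinite (UNIV :: 'u set)" and P: "is_lambda_ab A l P" and Q: "is_lambda_ab A l Q"
begin

interpretation P: lambda_ab A P l by (rule lambda_abI[OF inf P])
interpretation Q: lambda_ab A Q l by (rule lambda_abI[OF inf Q])

lemma LRing_hom_iff:
  "g \<in> Hom (LRing_ab_cat A l) P Q \<longleftrightarrow> g \<in> ring_hom P.B Q.B \<and> g \<in> extensional (carrier P.B) \<and>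
    (\<forall>x\<in>carrier P.B. Q.f (g x) = P.f x) \<and> (\<forall>a\<in>carrier A. g (P.z a) = Q.z a) \<and>
    (\<forall>x\<in>carrier P.B. Q.L (g x) = witt_map g (P.L x))"
  unfolding LRing_ab_cat_def cat.simps
  using ring_ab_mapsI[OF P.is_ab Q.is_ab, of g] by (auto simp: lambda_hom_def ring_ab_maps_def)

lemma LMod_hom_KM_iff:
  "\<phi> \<in> Hom (LMod_cat A l) P.KM Q.KM \<longleftrightarrow> \<phi> \<in> P.K \<rightarrow>\<^sub>E Q.K \<and>
    (\<forall>x\<in>P.K. \<forall>y\<in>P.K. \<phi> (x \<oplus>\<^bsub>P.B\<^esub> y) = \<phi> x \<oplus>\<^bsub>Q.B\<^esub> \<phi> y) \<and>
    (\<forall>a\<in>carrier A. \<forall>x\<in>P.K. \<phi> (P.z a \<otimes>\<^bsub>P.B\<^esub> x) = Q.z a \<otimes>\<^bsub>Q.B\<^esub> \<phi> x) \<and>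
    (\<forall>n>0. \<forall>x\<in>P.K. \<phi> (P.L x n) = Q.L (\<phi> x) n)"
  by (auto simp: LMod_cat_def linear_maps_def)

lemma kernel_restrict_hom:
  assumes g: "g \<in> Hom (LRing_ab_cat A l) P Q"
  shows "restrict g P.K \<in> Hom (LMod_cat A l) P.KM Q.KM"
proof -
  from g[unfolded LRing_hom_iff] have g: "g \<in> ring_hom P.B Q.B" "\<And>x. x \<in> carrier P.B \<Longrightarrow> Q.f (g x) = P.f x"
    "\<And>a. a \<in> carrier A \<Longrightarrow> g (P.z a) = Q.z a" "\<And>x. x \<in> carrier P.B \<Longrightarrow> Q.L (g x) = witt_map g (P.L x)" by auto
  have gK: "g x \<in> Q.K" if "x \<in> P.K" for x
    using that g(2)[of x] ring_hom_closed[OF g(1), of x] by (simp add: P.K_def Q.K_def)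
  show ?thesis unfolding LMod_hom_KM_iff
    using gK g by (auto simp: P.K_add P.K_mult P.L_closed P.K_carrier ring_hom_add[OF g(1)] ring_hom_mult[OF g(1)] witt_map_apply)
qed

lemma LRing_hom_determined:
  assumes g: "g \<in> Hom (LRing_ab_cat A l) P Q" and x: "x \<in> carrier P.B"
  shows "g x = Q.z (P.f x) \<oplus>\<^bsub>Q.B\<^esub> restrict g P.K (x \<ominus>\<^bsub>P.B\<^esub> P.z (P.f x))"
proof -
  from g[unfolded LRing_hom_iff] have g: "g \<in> ring_hom P.B Q.B" "\<And>a. a \<in> carrier A \<Longrightarrow> g (P.z a) = Q.z a" by auto
  have "g x = g (P.z (P.f x) \<oplus>\<^bsub>P.B\<^esub> (x \<ominus>\<^bsub>P.B\<^esub> P.z (P.f x)))" using P.decomp[OF x] by simp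
  also have "\<dots> = g (P.z (P.f x)) \<oplus>\<^bsub>Q.B\<^esub> g (x \<ominus>\<^bsub>P.B\<^esub> P.z (P.f x))"
    using x P.K_I[OF x] by (intro ring_hom_add[OF g(1)]) (auto simp: P.K_carrier)
  finally show ?thesis using x P.K_I[OF x] g(2) by simp
qed

lemma kernel_restrict_inj:
  assumes "g \<in> Hom (LRing_ab_cat A l) P Q" "h \<in> Hom (LRing_ab_cat A l) P Q" "restrict g P.K = restrict h P.K"
  shows "g = h"
proof (rule extensionalityI)
  show "g \<in> extensional (carrier P.B)" "h \<in> extensional (carrier P.B)" using assms by (auto simp: LRing_hom_iff)
  show "g x = h x" if "x \<in> carrier P.B" for x
    using LRing_hom_determined[OF assms(1) that] LRing_hom_determined[OF assms(2) that] assms(3) by simp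
qed

lemma kernel_restrict_surj:
  assumes \<phi>: "\<phi> \<in> Hom (LMod_cat A l) P.KM Q.KM"
  shows "\<exists>g\<in>Hom (LRing_ab_cat A l) P Q. restrict g P.K = \<phi>"
proof -
  from \<phi>[unfolded LMod_hom_KM_iff] have \<phi>: "\<phi> \<in> P.K \<rightarrow>\<^sub>E Q.K"
    and \<phi>_add: "\<And>x y. x \<in> P.K \<Longrightarrow> y \<in> P.K \<Longrightarrow> \<phi> (x \<oplus>\<^bsub>P.B\<^esub> y) = \<phi> x \<oplus>\<^bsub>Q.B\<^esub> \<phi> y"
    and \<phi>_mult: "\<And>a x. a \<in> carrier A \<Longrightarrow> x \<in> P.K \<Longrightarrow> \<phi> (P.z a \<otimes>\<^bsub>P.B\<^esub> x) = Q.z a \<otimes>\<^bsub>Q.B\<^esub> \<phi> x"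
    and \<phi>_L: "\<And>n x. n > 0 \<Longrightarrow> x \<in> P.K \<Longrightarrow> \<phi> (P.L x n) = Q.L (\<phi> x) n" by blast+
  have \<phi>K: "\<phi> x \<in> Q.K" if "x \<in> P.K" for x using \<phi> that by auto
  then have \<phi>c: "\<phi> x \<in> carrier Q.B" if "x \<in> P.K" for x using that Q.K_carrier by blast
  have \<phi>0: "\<phi> \<zero>\<^bsub>P.B\<^esub> = \<zero>\<^bsub>Q.B\<^esub>"
    using \<phi>_add[OF P.K_zero P.K_zero] \<phi>c[OF P.K_zero] Q.B.add.r_cancel_one' by (metis P.B.r_zero P.B.zero_closed)
  \<comment> \<open>The only possible extension of \<open>\<phi>\<close>, by
    \<open>LRing_hom_determined\<close>.\<close>
  define g where "g = (\<lambda>x\<in>carrier P.B. Q.z (P.f x) \<oplus>\<^bsub>Q.B\<^esub> \<phi> (x \<ominus>\<^bsub>P.B\<^esub> P.z (P.f x)))"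
  have g: "g (P.z a \<oplus>\<^bsub>P.B\<^esub> k) = Q.z a \<oplus>\<^bsub>Q.B\<^esub> \<phi> k" if "a \<in> carrier A" "k \<in> P.K" for a k
    using that P.K_decomp[OF that] by (simp add: g_def P.K_carrier)
  have gz: "g (P.z a) = Q.z a" if "a \<in> carrier A" for a
    using g[OF that P.K_zero] that \<phi>0 by simp
  have gK: "g k = \<phi> k" if "k \<in> P.K" for k
    using g[OF P.A.zero_closed that] that \<phi>c[OF that] by (simp add: P.K_carrier)
  have hom: "g \<in> ring_hom P.B Q.B"
  proof (rule ring_hom_memI)
    fix x y assume "x \<in> carrier P.B" "y \<in> carrier P.B"
    then obtain a k b m where xy: "a \<in> carrier A" "k \<in> P.K" "x = P.z a \<oplus>\<^bsub>P.B\<^esub> k"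
      "b \<in> carrier A" "m \<in> P.K" "y = P.z b \<oplus>\<^bsub>P.B\<^esub> m" using P.decompE by metis
    note c = P.K_carrier(1)[OF xy(2)] P.K_carrier(1)[OF xy(5)] P.z.hom_closed[OF xy(1)] P.z.hom_closed[OF xy(4)]
    note d = \<phi>c[OF xy(2)] \<phi>c[OF xy(5)] Q.z.hom_closed[OF xy(1)] Q.z.hom_closed[OF xy(4)]
    show "g x \<in> carrier Q.B" unfolding xy using xy d by (simp add: g)
    have "x \<oplus>\<^bsub>P.B\<^esub> y = P.z (a \<oplus>\<^bsub>A\<^esub> b) \<oplus>\<^bsub>P.B\<^esub> (k \<oplus>\<^bsub>P.B\<^esub> m)" unfolding xy using xy c by (simp add: P.B.a_ac)
    then have "g (x \<oplus>\<^bsub>P.B\<^esub> y) = Q.z (a \<oplus>\<^bsub>A\<^esub> b) \<oplus>\<^bsub>Q.B\<^esub> \<phi> (k \<oplus>\<^bsub>P.B\<^esub> m)"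
      using g[OF P.A.a_closed[OF xy(1,4)] P.K_add[OF xy(2,5)]] by (simp only:)
    also have "\<dots> = g x \<oplus>\<^bsub>Q.B\<^esub> g y" unfolding xy using xy d by (simp add: g \<phi>_add Q.B.a_ac)
    finally show "g (x \<oplus>\<^bsub>P.B\<^esub> y) = g x \<oplus>\<^bsub>Q.B\<^esub> g y" .
    have "x \<otimes>\<^bsub>P.B\<^esub> y = P.z a \<otimes>\<^bsub>P.B\<^esub> P.z b \<oplus>\<^bsub>P.B\<^esub> (P.z a \<otimes>\<^bsub>P.B\<^esub> m \<oplus>\<^bsub>P.B\<^esub> P.z b \<otimes>\<^bsub>P.B\<^esub> k) \<oplus>\<^bsub>P.B\<^esub> k \<otimes>\<^bsub>P.B\<^esub> m"
      unfolding xy using c by algebra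
    \<comment> \<open>The product of \<open>k\<close> and \<open>m\<close> vanishes in the source,
      and so does that of \<open>\<phi> k\<close> and \<open>\<phi> m\<close> in the target; this
      makes \<open>g\<close> multiplicative although \<open>\<phi>\<close> is only linear.\<close>
    then have "x \<otimes>\<^bsub>P.B\<^esub> y = P.z (a \<otimes>\<^bsub>A\<^esub> b) \<oplus>\<^bsub>P.B\<^esub> (P.z a \<otimes>\<^bsub>P.B\<^esub> m \<oplus>\<^bsub>P.B\<^esub> P.z b \<otimes>\<^bsub>P.B\<^esub> k)"
      using xy c by (simp add: P.K_mult_zero)
    then have "g (x \<otimes>\<^bsub>P.B\<^esub> y) = Q.z (a \<otimes>\<^bsub>A\<^esub> b) \<oplus>\<^bsub>Q.B\<^esub> (Q.z a \<otimes>\<^bsub>Q.B\<^esub> \<phi> m \<oplus>\<^bsub>Q.B\<^esub> Q.z b \<otimes>\<^bsub>Q.B\<^esub> \<phi> k)"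
      using g[OF P.A.m_closed[OF xy(1,4)] P.K_add[OF P.K_mult[OF c(3) xy(5)] P.K_mult[OF c(4) xy(2)]]]
        xy(1,2,4,5) c by (simp only: \<phi>_add \<phi>_mult P.K_mult)
    also have "\<dots> = Q.z a \<otimes>\<^bsub>Q.B\<^esub> Q.z b \<oplus>\<^bsub>Q.B\<^esub> (Q.z a \<otimes>\<^bsub>Q.B\<^esub> \<phi> m \<oplus>\<^bsub>Q.B\<^esub> Q.z b \<otimes>\<^bsub>Q.B\<^esub> \<phi> k) \<oplus>\<^bsub>Q.B\<^esub> \<phi> k \<otimes>\<^bsub>Q.B\<^esub> \<phi> m"
      using xy d by (simp add: Q.K_mult_zero \<phi>K)
    also have "\<dots> = (Q.z a \<oplus>\<^bsub>Q.B\<^esub> \<phi> k) \<otimes>\<^bsub>Q.B\<^esub> (Q.z b \<oplus>\<^bsub>Q.B\<^esub> \<phi> m)" using d by algebra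
    also have "\<dots> = g x \<otimes>\<^bsub>Q.B\<^esub> g y" unfolding xy using xy by (simp add: g)
    finally show "g (x \<otimes>\<^bsub>P.B\<^esub> y) = g x \<otimes>\<^bsub>Q.B\<^esub> g y" .
  next
    show "g \<one>\<^bsub>P.B\<^esub> = \<one>\<^bsub>Q.B\<^esub>" using gz[OF P.A.one_closed] by simp
  qed
  \<comment> \<open>Structure maps are compared on the zero section and on the kernel separately;
    sums follow from \<open>witt_hom_eq_add\<close>.\<close>
  have lz: "Q.L (g (P.z a)) = witt_map g (P.L (P.z a))" if a: "a \<in> carrier A" for a
    using a P.l_witt_seqs[OF a] by (auto simp: gz Q.L_z P.L_z witt_map_comp intro!: witt_map_cong)
  have lk: "Q.L (g k) = witt_map g (P.L k)" if k: "k \<in> P.K" for k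
    using k \<phi>c[OF k] ring_hom_closed[OF hom]
    by (intro witt_seqs_eqI[OF Q.L_witt_seqs witt_map_hom_closed[OF hom P.L_witt_seqs]])
      (auto simp: gK witt_map_apply P.L_closed \<phi>_L P.K_carrier)
  have "g \<in> Hom (LRing_ab_cat A l) P Q"
    unfolding LRing_hom_iff
  proof (intro conjI ballI hom gz)
    show "g \<in> extensional (carrier P.B)" by (simp add: g_def)
    fix x assume x: "x \<in> carrier P.B"
    then obtain a k where ak: "a \<in> carrier A" "k \<in> P.K" "x = P.z a \<oplus>\<^bsub>P.B\<^esub> k" using P.decompE by metis
    show "Q.f (g x) = P.f x" unfolding ak(3) using ak P.K_decomp(1)[OF ak(1,2)] Q.K_decomp(1)[OF ak(1) \<phi>K[OF ak(2)]] by (simp add: g)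
    show "Q.L (g x) = witt_map g (P.L x)" unfolding ak(3)
      using ak by (intro witt_hom_eq_add[OF P.B.cring_axioms Q.B.cring_axioms hom P.LB(1) Q.LB(1)] lz lk) (auto simp: P.K_carrier)
  qed
  moreover have "restrict g P.K = \<phi>"
    using \<phi> gK by (auto simp: fun_eq_iff PiE_iff extensional_def)
  ultimately show ?thesis by blast
qed

end

section \<open>A criterion for abelian group objects in lambda-rings\<close>

context ring_ab
begin

abbreviation "FS \<equiv> fibre_square P"

lemma cring_FS: "cring FS"
proof (intro cringI abelian_groupI comm_monoidI)
  fix u assume "u \<in> carrier FS"
  then obtain x y where u: "u = (x, y)" "x \<in> carrier B" "y \<in> carrier B" "f x = f y" by (auto simp: fibre_square_simps)
  then show "\<exists>v\<in>carrier FS. v \<oplus>\<^bsub>FS\<^esub> u = \<zero>\<^bsub>FS\<^esub>"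
    by (intro bexI[of _ "(\<ominus>\<^bsub>B\<^esub> x, \<ominus>\<^bsub>B\<^esub> y)"]) (auto simp: fibre_square_simps B.l_neg)
qed (auto simp: fibre_square_simps B.a_ac B.m_ac B.r_distr)

lemma fst_hom: "fst \<in> ring_hom FS B" and snd_hom: "snd \<in> ring_hom FS B"
  by (auto intro!: ring_hom_memI simp: fibre_square_simps)

lemma witt_seqs_FS_eqI:
  assumes "u \<in> witt_seqs FS" "v \<in> witt_seqs FS" "witt_map fst u = witt_map fst v" "witt_map snd u = witt_map snd v"
  shows "u = v"
  using assms(1,2)
proof (rule witt_seqs_eqI)
  fix n :: nat assume "n > 0"
  then show "u n = v n" using fun_cong[OF assms(3), of n] fun_cong[OF assms(4), of n]
    by (simp add: witt_map_apply prod_eq_iff)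
qed

text \<open>A Witt vector over the fibre square is determined by its two projections, which induce
  homomorphisms of Witt rings. Compatibility with \<open>f\<close> makes each pair of coordinates
  lie in the fibre square.\<close>

lemma witt_ring_FS_hom:
  assumes L: "L \<in> ring_hom B (witt_ring B)"
    and F: "\<And>x. x \<in> carrier B \<Longrightarrow> witt_map f (L x) = l (f x)"
  shows "(\<lambda>(x, y). \<lambda>n\<in>{0<..}. (L x n, L y n)) \<in> ring_hom FS (witt_ring FS)" (is "?FL \<in> _")
proof -
  have Lc: "L x \<in> witt_seqs B" if "x \<in> carrier B" for x using ring_hom_closed[OF L that] by (simp add: carrier_witt_ring)
  have c: "?FL (x, y) \<in> witt_seqs FS" if "x \<in> carrier B" "y \<in> carrier B" "f x = f y" for x y
  proof -
    have "f (L x n) = f (L y n)" if "n > 0" for n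
      using F[OF \<open>x \<in> carrier B\<close>] F[OF \<open>y \<in> carrier B\<close>] \<open>f x = f y\<close> that by (metis witt_map_apply)
    then show ?thesis using that Lc by (auto intro!: witt_seqs_restrict simp: fibre_square_simps)
  qed
  have s: "witt_map fst (?FL (x, y)) = L x" "witt_map snd (?FL (x, y)) = L y"
    if "x \<in> carrier B" "y \<in> carrier B" "f x = f y" for x y
    using Lc that c[OF that]
    by (auto intro!: witt_seqs_eqI[of _ B _ B] witt_map_hom_closed[OF fst_hom] witt_map_hom_closed[OF snd_hom] simp del: split_conv)
      (simp_all add: witt_map_apply)
  note N = witt_ring_natural[OF cring_FS B.cring_axioms fst_hom] witt_ring_natural[OF cring_FS B.cring_axioms snd_hom]
  show ?thesis
  proof (rule ring_hom_memI; (unfold carrier_witt_ring)?)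
    fix u v assume "u \<in> carrier FS" "v \<in> carrier FS"
    then obtain x y x' y' where uv: "u = (x, y)" "x \<in> carrier B" "y \<in> carrier B" "f x = f y"
      "v = (x', y')" "x' \<in> carrier B" "y' \<in> carrier B" "f x' = f y'" by (auto simp: fibre_square_simps)
    note cu = c[OF uv(2-4)] c[OF uv(6-8)]
    have fa: "f (x \<oplus>\<^bsub>B\<^esub> x') = f (y \<oplus>\<^bsub>B\<^esub> y')" "f (x \<otimes>\<^bsub>B\<^esub> x') = f (y \<otimes>\<^bsub>B\<^esub> y')" using uv by simp_all
    note sa = s[OF B.a_closed[OF uv(2,6)] B.a_closed[OF uv(3,7)] fa(1)]
      and sm = s[OF B.m_closed[OF uv(2,6)] B.m_closed[OF uv(3,7)] fa(2)]
      and ca = c[OF B.a_closed[OF uv(2,6)] B.a_closed[OF uv(3,7)] fa(1)]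
      and cm = c[OF B.m_closed[OF uv(2,6)] B.m_closed[OF uv(3,7)] fa(2)]
    show "?FL u \<in> witt_seqs FS" unfolding uv by (rule cu)
    show "?FL (u \<oplus>\<^bsub>FS\<^esub> v) = ?FL u \<oplus>\<^bsub>witt_ring FS\<^esub> ?FL v"
      unfolding uv fibre_square_simps(3)
      by (rule witt_seqs_FS_eqI[OF ca witt_ring_closed(3)[OF cring_FS cu]])
        (simp_all only: sa N cu s[OF uv(2-4)] s[OF uv(6-8)] ring_hom_add[OF L] uv)
    show "?FL (u \<otimes>\<^bsub>FS\<^esub> v) = ?FL u \<otimes>\<^bsub>witt_ring FS\<^esub> ?FL v"
      unfolding uv fibre_square_simps(2)
      by (rule witt_seqs_FS_eqI[OF cm witt_ring_closed(4)[OF cring_FS cu]])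
        (simp_all only: sm N cu s[OF uv(2-4)] s[OF uv(6-8)] ring_hom_mult[OF L] uv)
  next
    show "?FL \<one>\<^bsub>FS\<^esub> = \<one>\<^bsub>witt_ring FS\<^esub>"
      unfolding fibre_square_simps(4)
      by (rule witt_seqs_FS_eqI[OF c[OF B.one_closed B.one_closed refl] witt_ring_closed(2)[OF cring_FS]])
        (simp_all only: s[OF B.one_closed B.one_closed refl] N ring_hom_one[OF L])
  qed
qed

lemma i_K: "x \<in> K \<Longrightarrow> i x = \<ominus>\<^bsub>B\<^esub> x"
  using i_eq[of x] by (simp add: K_carrier B.minus_equality[symmetric])

lemma i_z: "a \<in> carrier A \<Longrightarrow> i (z a) = z a"
  using i_eq[of "z a"] by (simp add: B.add.right_cancel)

lemma p_z: "a \<in> carrier A \<Longrightarrow> p (z a, z a) = z a"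
  using p_zero(1)[of "z a"] by simp

lemma lambda_set_decomp:
  assumes C: "cring C" and g: "g \<in> ring_hom B C" and L: "L \<in> ring_hom B (witt_ring B)" and M: "M \<in> ring_hom C (witt_ring C)"
    and z: "\<And>a. a \<in> carrier A \<Longrightarrow> M (g (z a)) = witt_map g (L (z a))"
    and k: "\<And>k. k \<in> K \<Longrightarrow> M (g k) = witt_map g (L k)"
    and x: "x \<in> carrier B"
  shows "M (g x) = witt_map g (L x)"
proof -
  obtain a k where ak: "a \<in> carrier A" "k \<in> K" "x = z a \<oplus>\<^bsub>B\<^esub> k" using decompE[OF x] by metis
  show ?thesis unfolding ak(3)
    using ak by (intro witt_hom_eq_add[OF B.cring_axioms C g L M] z k) (auto simp: K_carrier)
qed

end

text \<open>Each remaining axiom compares additive maps, so it is enough to treat \<open>z a\<close>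
  and the elements of the kernel. On \<open>z a\<close> the axioms are inherited from
  \<open>l\<close>; on the kernel they follow from the assumptions about coordinates.\<close>

lemma is_lambda_abI:
  fixes P :: "'u lambda_ab"
  assumes inf: "infinite (UNIV :: 'u set)" and l: "lambda_ring A l" and P: "is_ring_ab A P"
    and L: "lam P \<in> ring_hom (total P) (witt_ring (total P))"
    and z: "\<And>a. a \<in> carrier A \<Longrightarrow> lam P (ab_zero P a) = witt_map (ab_zero P) (l a)"
    and k: "\<And>x. x \<in> ring_ab.K A P \<Longrightarrow> lam P x \<in> witt_seqs_in (ring_ab.K A P)"
    and k1: "\<And>x. x \<in> ring_ab.K A P \<Longrightarrow> lam P x 1 = x"
    and kk: "\<And>x m n. x \<in> ring_ab.K A P \<Longrightarrow> m > 0 \<Longrightarrow> n > 0 \<Longrightarrow> lam P (lam P x n) m = lam P x (n * m)"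
  shows "is_lambda_ab A l P"
proof -
  interpret ring_ab A P by unfold_locales fact
  let ?L = "lam P"
  have lA: "l \<in> ring_hom A (witt_ring A)" "\<And>a. a \<in> carrier A \<Longrightarrow> l a 1 = a" "\<And>a. a \<in> carrier A \<Longrightarrow> witt_map l (l a) = witt_delta A (l a)"
    using l lambda_ring_iff[OF inf] by auto
  have lc: "a \<in> carrier A \<Longrightarrow> l a \<in> witt_seqs A" for a using ring_hom_closed[OF lA(1)] by (simp add: carrier_witt_ring)
  have Lc: "x \<in> carrier B \<Longrightarrow> ?L x \<in> witt_seqs B" for x using ring_hom_closed[OF L] by (simp add: carrier_witt_ring)
  interpret WB: cring "witt_ring B" by (rule cring_witt_ring[OF B.cring_axioms])
  have L0: "?L \<zero>\<^bsub>B\<^esub> = (\<lambda>n\<in>{0<..}. \<zero>\<^bsub>B\<^esub>)"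
    using ring_hom_zero[OF L B.ring_axioms WB.ring_axioms] witt_ring_zero[OF B.cring_axioms] by simp
  have l0: "l \<zero>\<^bsub>A\<^esub> = (\<lambda>n\<in>{0<..}. \<zero>\<^bsub>A\<^esub>)"
    using ring_hom_zero[OF lA(1) A.ring_axioms cring.axioms(1)[OF cring_witt_ring(1)[OF A.cring_axioms]]] witt_ring_zero[OF A.cring_axioms] by simp
  have f_lam: "l (f x) = witt_map f (?L x)" if "x \<in> carrier B" for x
  proof (rule lambda_set_decomp[OF A.cring_axioms homs(1) L lA(1) _ _ that])
    fix a assume a: "a \<in> carrier A"
    show "l (f (z a)) = witt_map f (?L (z a))"
      using a lc[OF a] by (intro witt_seqs_eqI[of _ A _ A]) (auto simp: z witt_map_apply intro!: witt_map_hom_closed[OF homs(1)] witt_map_hom_closed[OF homs(2)])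
  next
    fix x assume x: "x \<in> K"
    show "l (f x) = witt_map f (?L x)"
      using K_carrier(2)[OF witt_seqs_in_apply[OF k[OF x]]] x by (auto simp: K_carrier l0 witt_map_def)
  qed
  have lam_i: "?L (i x) = witt_map i (?L x)" if "x \<in> carrier B" for x
  proof (rule lambda_set_decomp[OF B.cring_axioms homs(3) L L _ _ that])
    fix a assume a: "a \<in> carrier A"
    show "?L (i (z a)) = witt_map i (?L (z a))"
      using a lc[OF a] by (auto simp: z i_z witt_map_comp intro!: witt_map_cong)
  next
    fix x assume x: "x \<in> K"
    have nx: "\<ominus>\<^bsub>B\<^esub> x \<in> K" using x by (simp add: K_def)
    \<comment> \<open>Addition of Witt vectors over \<open>K\<close> is coordinatewise, so this
      equation shows that \<open>?L\<close> turns negation in \<open>K\<close> into coordinatewise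
      negation.\<close>
    have "?L (\<ominus>\<^bsub>B\<^esub> x) \<oplus>\<^bsub>witt_ring B\<^esub> ?L x = ?L \<zero>\<^bsub>B\<^esub>"
      using x by (simp add: ring_hom_add[OF L, symmetric] K_carrier B.l_neg)
    then have fe: "(\<lambda>n\<in>{0<..}. ?L (\<ominus>\<^bsub>B\<^esub> x) n \<oplus>\<^bsub>B\<^esub> ?L x n) = (\<lambda>n\<in>{0<..}. \<zero>\<^bsub>B\<^esub>)"
      unfolding witt_ring_sq_zero(1)[OF B.cring_axioms K_sq_zero k[OF nx] k[OF x]] L0 .
    have *: "?L (\<ominus>\<^bsub>B\<^esub> x) n \<oplus>\<^bsub>B\<^esub> ?L x n = \<zero>\<^bsub>B\<^esub>" if "n > 0" for n using fun_cong[OF fe, of n] that by simp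
    show "?L (i x) = witt_map i (?L x)"
    proof (rule witt_seqs_eqI[of _ B _ B])
      fix n :: nat assume n: "n > 0"
      then show "?L (i x) n = witt_map i (?L x) n"
        using *[OF n] x witt_seqs_in_apply[OF k[OF x] n] witt_seqs_in_apply[OF k[OF nx] n]
        by (simp add: i_K witt_map_apply K_carrier B.minus_equality[symmetric])
    qed (use x Lc in \<open>auto simp: K_carrier intro!: witt_map_hom_closed[OF homs(3)]\<close>)
  qed
  have FL: "fibre_square_lam P \<in> ring_hom FS (witt_ring FS)"
    unfolding fibre_square_lam_def by (rule witt_ring_FS_hom[where l = l, OF L]) (simp add: f_lam)
  have lam_p: "?L (p (x, y)) = witt_map p (fibre_square_lam P (x, y))"
    if xy: "x \<in> carrier B" "y \<in> carrier B" "f x = f y" for x y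
  proof -
    note S = witt_hom_eq_add[OF cring_FS B.cring_axioms homs(4) FL L]
    have z2: "?L (p (z a, z a)) = witt_map p (fibre_square_lam P (z a, z a))" if a: "a \<in> carrier A" for a
      using a lc[OF a] by (auto simp: fibre_square_lam_def p_z z witt_map_def)
    have FLc: "fibre_square_lam P (x, y) \<in> witt_seqs FS" if "x \<in> carrier B" "y \<in> carrier B" "f x = f y" for x y
      using ring_hom_closed[OF FL, of "(x, y)"] that by (simp add: carrier_witt_ring fibre_square_simps)
    have e: "p (y, \<zero>\<^bsub>B\<^esub>) = y" "p (\<zero>\<^bsub>B\<^esub>, y) = y" if "y \<in> K" for y
      using p_zero[of y] that by (simp_all add: K_carrier)
    have k1: "?L (p (x, \<zero>\<^bsub>B\<^esub>)) = witt_map p (fibre_square_lam P (x, \<zero>\<^bsub>B\<^esub>))"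
      and k2: "?L (p (\<zero>\<^bsub>B\<^esub>, x)) = witt_map p (fibre_square_lam P (\<zero>\<^bsub>B\<^esub>, x))" if x: "x \<in> K" for x
    proof -
      note c = K_carrier[OF x] and Lx = witt_seqs_in_apply[OF k[OF x]]
      have "?L x = witt_map p (fibre_square_lam P (x, \<zero>\<^bsub>B\<^esub>))"
        using c by (intro witt_seqs_eqI[OF Lc witt_map_hom_closed[OF homs(4) FLc]])
          (simp_all add: witt_map_apply fibre_square_lam_def L0 e Lx)
      moreover have "?L x = witt_map p (fibre_square_lam P (\<zero>\<^bsub>B\<^esub>, x))"
        using c by (intro witt_seqs_eqI[OF Lc witt_map_hom_closed[OF homs(4) FLc]])
          (simp_all add: witt_map_apply fibre_square_lam_def L0 e Lx)
      ultimately show "?L (p (x, \<zero>\<^bsub>B\<^esub>)) = witt_map p (fibre_square_lam P (x, \<zero>\<^bsub>B\<^esub>))"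
        "?L (p (\<zero>\<^bsub>B\<^esub>, x)) = witt_map p (fibre_square_lam P (\<zero>\<^bsub>B\<^esub>, x))"
        using e[OF x] by simp_all
    qed
    obtain a m where am: "a \<in> carrier A" "m \<in> K" "x = z a \<oplus>\<^bsub>B\<^esub> m" using decompE[OF xy(1)] by metis
    obtain b n where bn: "b \<in> carrier A" "n \<in> K" "y = z b \<oplus>\<^bsub>B\<^esub> n" using decompE[OF xy(2)] by metis
    have ab: "b = a" using xy(3) unfolding am(3) bn(3) by (simp add: K_decomp am bn)
    note c = K_carrier[OF am(2)] K_carrier[OF bn(2)] am(1)
    \<comment> \<open>A pair in the fibre square is a diagonal element of the zero section plus one
      kernel element in each factor, and the claim is known for these three kinds of pairs.\<close>
    have d: "(x, y) = ((z a, z a) \<oplus>\<^bsub>FS\<^esub> (m, \<zero>\<^bsub>B\<^esub>)) \<oplus>\<^bsub>FS\<^esub> (\<zero>\<^bsub>B\<^esub>, n)"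
      using am bn c by (simp add: fibre_square_simps ab)
    have m1: "(z a, z a) \<in> carrier FS" "(m, \<zero>\<^bsub>B\<^esub>) \<in> carrier FS" "(\<zero>\<^bsub>B\<^esub>, n) \<in> carrier FS"
      using c by (simp_all add: fibre_square_simps)
    have m2: "(z a, z a) \<oplus>\<^bsub>FS\<^esub> (m, \<zero>\<^bsub>B\<^esub>) \<in> carrier FS"
      using c by (simp add: fibre_square_simps)
    show ?thesis unfolding d
      by (rule S[OF m2 S[OF m1(1) z2[OF am(1)] m1(2) k1[OF am(2)]] m1(3) k2[OF bn(2)]])
  qed
  have lk: "?L x 1 = x" if x: "x \<in> carrier B" for x
  proof -
    obtain a m where am: "a \<in> carrier A" "m \<in> K" "x = z a \<oplus>\<^bsub>B\<^esub> m" using decompE[OF x] by metis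
    note c = K_carrier[OF am(2)] am(1)
    have "?L x 1 = ghost B 1 (?L (z a) \<oplus>\<^bsub>witt_ring B\<^esub> ?L m)"
      using c x Lc by (simp add: ghost_1[OF B.cring_axioms, simplified] am(3) ring_hom_add[OF L] witt_ring_closed(3)[OF B.cring_axioms])
    also have "\<dots> = ?L (z a) 1 \<oplus>\<^bsub>B\<^esub> ?L m 1"
      using c Lc by (simp add: ghost_witt_ring[OF B.cring_axioms] ghost_1[OF B.cring_axioms, simplified])
    also have "\<dots> = x" using am k1[OF am(2)] lA(2)[OF am(1)] by (simp add: z witt_map_apply)
    finally show ?thesis .
  qed
  have comult: "witt_map ?L (?L x) = witt_delta B (?L x)" if x: "x \<in> carrier B" for x
  proof -
    obtain a m where am: "a \<in> carrier A" "m \<in> K" "x = z a \<oplus>\<^bsub>B\<^esub> m" using decompE[OF x] by metis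
    note c = K_carrier(1)[OF am(2)] z.hom_closed[OF am(1)]
    note W = witt_map_witt_ring_hom[OF B.cring_axioms WB.cring_axioms L]
    have "witt_map ?L (?L (z a)) = witt_map (witt_map z) (witt_map l (l a))"
      using am(1) lc[OF am(1)] by (auto simp: z witt_map_comp intro!: witt_map_cong)
    also have "\<dots> = witt_delta B (?L (z a))"
      using witt_delta_natural[OF A.cring_axioms B.cring_axioms homs(2) lc[OF am(1)]] lA(3)[OF am(1)] z[OF am(1)] by simp
    finally have 1: "witt_map ?L (?L (z a)) = witt_delta B (?L (z a))" .
    have 2: "witt_map ?L (?L m) = witt_delta B (?L m)"
      unfolding witt_ring_sq_zero(3)[OF B.cring_axioms K_sq_zero k[OF am(2)]]
    proof (rule witt_seqs_eqI[of _ "witt_ring B" _ "witt_ring B"])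
      show "witt_map ?L (?L m) \<in> witt_seqs (witt_ring B)" by (rule witt_map_hom_closed[OF L Lc[OF c(1)]])
      show "(\<lambda>n\<in>{0<..}. \<lambda>j\<in>{0<..}. ?L m (n * j)) \<in> witt_seqs (witt_ring B)"
        using Lc[OF c(1)] by (intro witt_seqs_restrict) (auto simp: carrier_witt_ring intro!: witt_seqs_restrict)
      fix n :: nat assume n: "n > 0"
      have "?L (?L m n) = (\<lambda>j\<in>{0<..}. ?L m (n * j))"
      proof (rule witt_seqs_eqI[OF Lc witt_seqs_restrict])
        show "?L m n \<in> carrier B" using Lc[OF c(1)] n by simp
        show "j > 0 \<Longrightarrow> ?L m (n * j) \<in> carrier B" for j using Lc[OF c(1)] n by simp
        show "j > 0 \<Longrightarrow> ?L (?L m n) j = (\<lambda>j\<in>{0<..}. ?L m (n * j)) j" for j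
          using kk[OF am(2) _ n] by simp
      qed
      then show "witt_map ?L (?L m) n = (\<lambda>n\<in>{0<..}. \<lambda>j\<in>{0<..}. ?L m (n * j)) n" using n by (simp add: witt_map_apply)
    qed
    have "?L (z a) \<in> carrier (witt_ring B)" "?L m \<in> carrier (witt_ring B)" using c Lc by (simp_all add: carrier_witt_ring)
    then show ?thesis unfolding am(3)
      using c 1 2 by (simp add: ring_hom_add[OF L] ring_hom_add[OF W] ring_hom_add[OF witt_delta_hom[OF B.cring_axioms]])
  qed
  have "lambda_ring B ?L" unfolding lambda_ring_iff[OF inf] using B.cring_axioms L lk comult by simp
  then show ?thesis unfolding is_lambda_ab_def lambda_hom_def
    using is_ab l homs f_lam lam_i lam_p z by (auto simp: fibre_square_simps)
qed

section \<open>Square-zero extensions\<close>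

text \<open>Cardinal arithmetic of infinite sets. The square-zero extension consists of pairs, which
  have to be coded by elements of \<open>'u\<close>.\<close>

lemma infinite_pair_embedding:
  assumes "infinite (UNIV :: 'u set)"
  obtains enc :: "'u \<times> 'u \<Rightarrow> 'u" where "inj enc"
proof -
  have "|UNIV \<times> UNIV :: ('u \<times> 'u) set| =o |UNIV :: 'u set|"
    using card_of_Times_same_infinite[OF assms] .
  then have "\<exists>f :: 'u \<times> 'u \<Rightarrow> 'u. inj_on f (UNIV \<times> UNIV) \<and> f ` (UNIV \<times> UNIV) \<subseteq> UNIV"
    using card_of_ordLeq ordIso_iff_ordLeq by blast
  then show ?thesis using that by auto
qed

locale sq_ext =
  fixes A :: "'u ring" and l :: "'u \<Rightarrow> nat \<Rightarrow> 'u" and M :: "('u, 'u) lambda_module"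
    and enc :: "'u \<times> 'u \<Rightarrow> 'u"
  assumes inf: "infinite (UNIV :: 'u set)" and l: "lambda_ring A l" and M: "is_lambda_module A l M"
    and enc: "inj enc"
begin

definition p1 :: "'u \<Rightarrow> 'u" where "p1 e = fst (inv_into UNIV enc e)"
definition p2 :: "'u \<Rightarrow> 'u" where "p2 e = snd (inv_into UNIV enc e)"

lemma p_enc [simp]: "p1 (enc (a, x)) = a" "p2 (enc (a, x)) = x"
  using enc by (simp_all add: p1_def p2_def)

sublocale M: module A M
  using M by (simp add: is_lambda_module_def)

definition E :: "'u ring" where
  "E = \<lparr>carrier = enc ` (carrier A \<times> carrier M),
     monoid.mult = \<lambda>e e'. enc (p1 e \<otimes>\<^bsub>A\<^esub> p1 e', p1 e \<odot>\<^bsub>M\<^esub> p2 e' \<oplus>\<^bsub>M\<^esub> p1 e' \<odot>\<^bsub>M\<^esub> p2 e),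
     one = enc (\<one>\<^bsub>A\<^esub>, \<zero>\<^bsub>M\<^esub>), ring.zero = enc (\<zero>\<^bsub>A\<^esub>, \<zero>\<^bsub>M\<^esub>),
     ring.add = \<lambda>e e'. enc (p1 e \<oplus>\<^bsub>A\<^esub> p1 e', p2 e \<oplus>\<^bsub>M\<^esub> p2 e')\<rparr>"

lemma E_simps [simp]:
  "carrier E = enc ` (carrier A \<times> carrier M)"
  "enc (a, x) \<otimes>\<^bsub>E\<^esub> enc (b, y) = enc (a \<otimes>\<^bsub>A\<^esub> b, a \<odot>\<^bsub>M\<^esub> y \<oplus>\<^bsub>M\<^esub> b \<odot>\<^bsub>M\<^esub> x)"
  "\<one>\<^bsub>E\<^esub> = enc (\<one>\<^bsub>A\<^esub>, \<zero>\<^bsub>M\<^esub>)" "\<zero>\<^bsub>E\<^esub> = enc (\<zero>\<^bsub>A\<^esub>, \<zero>\<^bsub>M\<^esub>)"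
  "enc (a, x) \<oplus>\<^bsub>E\<^esub> enc (b, y) = enc (a \<oplus>\<^bsub>A\<^esub> b, x \<oplus>\<^bsub>M\<^esub> y)"
  by (simp_all add: E_def)

lemma enc_eq [simp]: "enc u = enc v \<longleftrightarrow> u = v"
  using enc by (simp add: inj_eq)

lemma cring_E: "cring E"
proof (intro cringI abelian_groupI comm_monoidI)
  fix e assume "e \<in> carrier E"
  then obtain a x where e: "e = enc (a, x)" "a \<in> carrier A" "x \<in> carrier M" by auto
  then show "\<exists>e'\<in>carrier E. e' \<oplus>\<^bsub>E\<^esub> e = \<zero>\<^bsub>E\<^esub>"
    by (intro bexI[of _ "enc (\<ominus>\<^bsub>A\<^esub> a, \<ominus>\<^bsub>M\<^esub> x)"]) (auto simp: M.R.l_neg M.M.l_neg)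
next
  fix u v w assume "u \<in> carrier E" "v \<in> carrier E" "w \<in> carrier E"
  then obtain a x b y c t where e: "u = enc (a, x)" "a \<in> carrier A" "x \<in> carrier M" "v = enc (b, y)" "b \<in> carrier A" "y \<in> carrier M"
     "w = enc (c, t)" "c \<in> carrier A" "t \<in> carrier M" by auto
  have 1: "a \<odot>\<^bsub>M\<^esub> (b \<odot>\<^bsub>M\<^esub> t) = (a \<otimes>\<^bsub>A\<^esub> b) \<odot>\<^bsub>M\<^esub> t" "a \<odot>\<^bsub>M\<^esub> (c \<odot>\<^bsub>M\<^esub> y) = (a \<otimes>\<^bsub>A\<^esub> c) \<odot>\<^bsub>M\<^esub> y"
    "c \<odot>\<^bsub>M\<^esub> (a \<odot>\<^bsub>M\<^esub> y) = (a \<otimes>\<^bsub>A\<^esub> c) \<odot>\<^bsub>M\<^esub> y" "c \<odot>\<^bsub>M\<^esub> (b \<odot>\<^bsub>M\<^esub> x) = (b \<otimes>\<^bsub>A\<^esub> c) \<odot>\<^bsub>M\<^esub> x"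
    using e by (simp_all add: M.smult_assoc1[symmetric] M.R.m_comm)
  show "u \<otimes>\<^bsub>E\<^esub> v \<otimes>\<^bsub>E\<^esub> w = u \<otimes>\<^bsub>E\<^esub> (v \<otimes>\<^bsub>E\<^esub> w)"
    using e by (simp add: M.R.m_assoc M.smult_r_distr 1 M.M.a_assoc)
  show "(u \<oplus>\<^bsub>E\<^esub> v) \<otimes>\<^bsub>E\<^esub> w = u \<otimes>\<^bsub>E\<^esub> w \<oplus>\<^bsub>E\<^esub> v \<otimes>\<^bsub>E\<^esub> w"
    using e by (simp add: M.R.l_distr M.smult_r_distr M.smult_l_distr M.M.a_ac)
qed (auto simp: M.R.a_ac M.R.m_ac M.M.a_ac)

definition \<iota> :: "'u \<Rightarrow> 'u" where "\<iota> a = enc (a, \<zero>\<^bsub>M\<^esub>)"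
definition \<kappa> :: "'u \<Rightarrow> 'u" where "\<kappa> x = enc (\<zero>\<^bsub>A\<^esub>, x)"

lemma \<iota>_hom: "\<iota> \<in> ring_hom A E"
  by (rule ring_hom_memI) (auto simp: \<iota>_def)

definition lamE :: "'u \<Rightarrow> nat \<Rightarrow> 'u" where
  "lamE e = witt_map \<iota> (l (p1 e)) \<oplus>\<^bsub>witt_ring E\<^esub> (\<lambda>n\<in>{0<..}. \<kappa> (mod_lam M n (p2 e)))"

definition ext :: "'u lambda_ab" where
  "ext = \<lparr>total = E, proj = p1, ab_plus = \<lambda>(e, e'). enc (p1 e, p2 e \<oplus>\<^bsub>M\<^esub> p2 e'),
     ab_zero = \<iota>, ab_neg = \<lambda>e. enc (p1 e, \<ominus>\<^bsub>M\<^esub> p2 e), lam = lamE\<rparr>"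

lemma ext_simps [simp]: "total ext = E" "proj ext = p1" "ab_plus ext (e, e') = enc (p1 e, p2 e \<oplus>\<^bsub>M\<^esub> p2 e')"
  "ab_zero ext = \<iota>" "ab_neg ext e = enc (p1 e, \<ominus>\<^bsub>M\<^esub> p2 e)" "lam ext = lamE"
  by (simp_all add: ext_def)

lemma is_ring_ab_ext: "is_ring_ab A ext"
  unfolding is_ring_ab_def Let_def
proof (intro conjI)
  show "cring A" by (rule M.R.cring_axioms)
  show "cring (total ext)" by (simp add: cring_E)
  show "proj ext \<in> ring_hom (total ext) A" by (rule ring_hom_memI) auto
  show "ab_zero ext \<in> ring_hom A (total ext)" by (simp add: \<iota>_hom)
  show "ab_plus ext \<in> ring_hom (fibre_square ext) (total ext)"
    by (rule ring_hom_memI)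
      (auto simp: fibre_square_simps M.smult_r_distr M.M.a_ac)
  show "ab_neg ext \<in> ring_hom (total ext) (total ext)"
  proof (rule ring_hom_memI)
    fix u v assume "u \<in> carrier (total ext)" "v \<in> carrier (total ext)"
    then obtain a x b y where e: "u = enc (a, x)" "a \<in> carrier A" "x \<in> carrier M" "v = enc (b, y)" "b \<in> carrier A" "y \<in> carrier M"
      by auto
    show "ab_neg ext u \<in> carrier (total ext)"  "ab_neg ext (u \<oplus>\<^bsub>total ext\<^esub> v) = ab_neg ext u \<oplus>\<^bsub>total ext\<^esub> ab_neg ext v"
      "ab_neg ext (u \<otimes>\<^bsub>total ext\<^esub> v) = ab_neg ext u \<otimes>\<^bsub>total ext\<^esub> ab_neg ext v"
      using e by (simp_all add: M.M.minus_add M.smult_r_minus)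
  qed simp
qed (auto simp: fibre_square_simps \<iota>_def M.M.a_ac M.M.l_neg M.M.r_neg)

sublocale X: ring_ab A ext
  by unfold_locales (rule is_ring_ab_ext)

lemma K_ext: "X.K = \<kappa> ` carrier M"
  by (auto simp: X.K_def \<kappa>_def)

lemma lA: "l \<in> ring_hom A (witt_ring A)" "\<And>a. a \<in> carrier A \<Longrightarrow> l a 1 = a" "\<And>a. a \<in> carrier A \<Longrightarrow> witt_map l (l a) = witt_delta A (l a)"
  using l lambda_ring_iff[OF inf] by auto

lemma lc: "a \<in> carrier A \<Longrightarrow> l a \<in> witt_seqs A"
  using ring_hom_closed[OF lA(1)] by (simp add: carrier_witt_ring)

lemma mod_lam:
  "n > 0 \<Longrightarrow> x \<in> carrier M \<Longrightarrow> mod_lam M n x \<in> carrier M"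
  "n > 0 \<Longrightarrow> x \<in> carrier M \<Longrightarrow> y \<in> carrier M \<Longrightarrow> mod_lam M n (x \<oplus>\<^bsub>M\<^esub> y) = mod_lam M n x \<oplus>\<^bsub>M\<^esub> mod_lam M n y"
  "n > 0 \<Longrightarrow> a \<in> carrier A \<Longrightarrow> x \<in> carrier M \<Longrightarrow> mod_lam M n (a \<odot>\<^bsub>M\<^esub> x) = adams A l n a \<odot>\<^bsub>M\<^esub> mod_lam M n x"
  "x \<in> carrier M \<Longrightarrow> mod_lam M 1 x = x"
  "m > 0 \<Longrightarrow> n > 0 \<Longrightarrow> x \<in> carrier M \<Longrightarrow> mod_lam M m (mod_lam M n x) = mod_lam M (m * n) x"
  using M by (auto simp: is_lambda_module_def Pi_iff)

lemma mod_lam_zero: "n > 0 \<Longrightarrow> mod_lam M n \<zero>\<^bsub>M\<^esub> = \<zero>\<^bsub>M\<^esub>"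
  using mod_lam(2)[of n "\<zero>\<^bsub>M\<^esub>" "\<zero>\<^bsub>M\<^esub>"] mod_lam(1)[of n "\<zero>\<^bsub>M\<^esub>"] by (metis M.M.add.r_cancel_one' M.M.l_zero M.M.zero_closed)

definition U :: "'u \<Rightarrow> nat \<Rightarrow> 'u" where "U a = witt_map \<iota> (l a)"
definition V :: "'u \<Rightarrow> nat \<Rightarrow> 'u" where "V x = (\<lambda>n\<in>{0<..}. \<kappa> (mod_lam M n x))"

lemma lamE_enc: "lamE (enc (a, x)) = U a \<oplus>\<^bsub>witt_ring E\<^esub> V x"
  by (simp add: lamE_def U_def V_def)

sublocale WE: cring "witt_ring E" by (rule cring_witt_ring[OF cring_E])
sublocale WA: cring "witt_ring A" by (rule cring_witt_ring[OF M.R.cring_axioms])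

lemma WE_zero: "\<zero>\<^bsub>witt_ring E\<^esub> = (\<lambda>n\<in>{0<..}. \<zero>\<^bsub>E\<^esub>)"
  by (rule witt_ring_zero[OF cring_E])

lemma U_hom: "U \<in> ring_hom A (witt_ring E)"
  using ring_hom_trans[OF lA(1) witt_map_witt_ring_hom[OF M.R.cring_axioms cring_E \<iota>_hom]]
  by (simp add: comp_def U_def[abs_def])

sublocale U: ring_hom_cring A "witt_ring E" U
  by unfold_locales (rule U_hom)

lemma V_witt_seqs_in: "x \<in> carrier M \<Longrightarrow> V x \<in> witt_seqs_in X.K"
  unfolding V_def K_ext by (rule witt_seqs_in_restrict) (simp add: mod_lam)

lemma V_closed: "x \<in> carrier M \<Longrightarrow> V x \<in> carrier (witt_ring E)"
  using sq_zero_witt_seqs[OF X.K_sq_zero V_witt_seqs_in] by (simp only: carrier_witt_ring ext_simps)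

lemma V_zero: "V \<zero>\<^bsub>M\<^esub> = \<zero>\<^bsub>witt_ring E\<^esub>"
  unfolding V_def WE_zero by (auto simp: mod_lam_zero \<kappa>_def)

lemma V_add:
  assumes "x \<in> carrier M" "y \<in> carrier M"
  shows "V (x \<oplus>\<^bsub>M\<^esub> y) = V x \<oplus>\<^bsub>witt_ring E\<^esub> V y"
  using witt_ring_sq_zero(1)[OF X.crings(2) X.K_sq_zero V_witt_seqs_in[OF assms(1)] V_witt_seqs_in[OF assms(2)]] assms
  by (auto simp: V_def mod_lam \<kappa>_def)

text \<open>\<open>ghost E n (U a)\<close> is the image of the n-th Adams operation, so the
  coordinate formula for products becomes the semilinearity of \<open>mod_lam\<close>.\<close>

lemma U_V_mult:
  assumes "a \<in> carrier A" "x \<in> carrier M"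
  shows "U a \<otimes>\<^bsub>witt_ring E\<^esub> V x = V (a \<odot>\<^bsub>M\<^esub> x)"
proof -
  have u: "U a \<in> witt_seqs E" using U.hom_closed[OF assms(1)] by (simp only: carrier_witt_ring)
  have g: "ghost E n (U a) = \<iota> (adams A l n a)" if "n > 0" for n
    unfolding U_def adams_def using that assms lc \<iota>_hom by (intro ghost_hom[symmetric] M.R.cring_axioms cring_E)
  have c: "adams A l n a \<in> carrier A" if "n > 0" for n
    unfolding adams_def using that assms lc by (intro ghost_closed M.R.cring_axioms)
  have "U a \<otimes>\<^bsub>witt_ring E\<^esub> V x = (\<lambda>n\<in>{0<..}. ghost E n (U a) \<otimes>\<^bsub>E\<^esub> V x n)"
    using witt_ring_sq_zero(2)[OF X.crings(2) X.K_sq_zero V_witt_seqs_in[OF assms(2)], of "U a"] u by simp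
  also have "\<dots> = V (a \<odot>\<^bsub>M\<^esub> x)"
    using assms c by (auto simp: V_def g mod_lam \<iota>_def \<kappa>_def intro!: restrict_ext)
  finally show ?thesis .
qed

text \<open>The coordinates of \<open>V y\<close> are multiplied by ghost components of
  \<open>V x\<close>; both lie in \<open>X.K\<close>, which has square zero.\<close>

lemma V_V_mult:
  assumes "x \<in> carrier M" "y \<in> carrier M"
  shows "V x \<otimes>\<^bsub>witt_ring E\<^esub> V y = \<zero>\<^bsub>witt_ring E\<^esub>"
proof -
  have v: "V x \<in> witt_seqs E" using V_closed[OF assms(1)] by (simp only: carrier_witt_ring)
  have "V x \<otimes>\<^bsub>witt_ring E\<^esub> V y = (\<lambda>n\<in>{0<..}. ghost E n (V x) \<otimes>\<^bsub>E\<^esub> V y n)"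
    using witt_ring_sq_zero(2)[OF X.crings(2) X.K_sq_zero V_witt_seqs_in[OF assms(2)], of "V x"] v by simp
  also have "\<dots> = (\<lambda>n\<in>{0<..}. \<zero>\<^bsub>E\<^esub>)"
  proof (rule restrict_ext)
    fix n :: nat assume "n \<in> {0<..}"
    then have n: "n > 0" by simp
    have "ghost E n (V x) \<in> X.K"
      using ghost_sq_zero[OF X.crings(2) X.K_sq_zero V_witt_seqs_in[OF assms(1)] n]
        sq_zero_add_pow[OF X.K_sq_zero witt_seqs_in_apply[OF V_witt_seqs_in[OF assms(1)] n]] by simp
    then show "ghost E n (V x) \<otimes>\<^bsub>E\<^esub> V y n = \<zero>\<^bsub>E\<^esub>"
      using X.K_mult_zero witt_seqs_in_apply[OF V_witt_seqs_in[OF assms(2)] n] by simp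
  qed
  finally show ?thesis by (simp only: WE_zero)
qed

text \<open>Expand \<open>(U a + V x) (U b + V y)\<close>: \<open>U\<close> is a homomorphism,
  \<open>V\<close> is additive, mixed products follow the module structure, and the last term
  vanishes.\<close>

lemma lamE_hom: "lamE \<in> ring_hom E (witt_ring E)"
proof (rule ring_hom_memI)
  fix u v assume "u \<in> carrier E" "v \<in> carrier E"
  then obtain a x b y where e: "u = enc (a, x)" "a \<in> carrier A" "x \<in> carrier M" "v = enc (b, y)" "b \<in> carrier A" "y \<in> carrier M"
    by auto
  note c = U.hom_closed[OF e(2)] U.hom_closed[OF e(5)] V_closed[OF e(3)] V_closed[OF e(6)]
  show "lamE u \<in> carrier (witt_ring E)" using c e by (simp add: lamE_enc del: E_simps(1))
  show "lamE (u \<oplus>\<^bsub>E\<^esub> v) = lamE u \<oplus>\<^bsub>witt_ring E\<^esub> lamE v"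
    using c e by (simp add: lamE_enc V_add WE.a_ac)
  have "lamE (u \<otimes>\<^bsub>E\<^esub> v) = U a \<otimes>\<^bsub>witt_ring E\<^esub> U b \<oplus>\<^bsub>witt_ring E\<^esub> (U a \<otimes>\<^bsub>witt_ring E\<^esub> V y \<oplus>\<^bsub>witt_ring E\<^esub> U b \<otimes>\<^bsub>witt_ring E\<^esub> V x) \<oplus>\<^bsub>witt_ring E\<^esub> V x \<otimes>\<^bsub>witt_ring E\<^esub> V y"
    using c e by (simp add: lamE_enc V_add U_V_mult V_V_mult V_closed)
  also have "\<dots> = (U a \<oplus>\<^bsub>witt_ring E\<^esub> V x) \<otimes>\<^bsub>witt_ring E\<^esub> (U b \<oplus>\<^bsub>witt_ring E\<^esub> V y)" using c by algebra
  finally show "lamE (u \<otimes>\<^bsub>E\<^esub> v) = lamE u \<otimes>\<^bsub>witt_ring E\<^esub> lamE v" using e by (simp add: lamE_enc)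
next
  show "lamE \<one>\<^bsub>E\<^esub> = \<one>\<^bsub>witt_ring E\<^esub>"
    using U.hom_closed[OF M.R.one_closed] by (simp add: lamE_enc V_zero)
qed

lemma lamE_\<iota>: "a \<in> carrier A \<Longrightarrow> lamE (\<iota> a) = witt_map \<iota> (l a)"
  using U.hom_closed[of a] by (simp add: \<iota>_def[of a] lamE_enc V_zero) (simp add: U_def)

lemma lamE_\<kappa>: "x \<in> carrier M \<Longrightarrow> lamE (\<kappa> x) = V x"
  using V_closed[of x] by (simp add: \<kappa>_def lamE_enc)

lemma is_lambda_ab_ext: "is_lambda_ab A l ext"
proof (rule is_lambda_abI[OF inf l is_ring_ab_ext])
  show "lam ext \<in> ring_hom (total ext) (witt_ring (total ext))" by (simp add: lamE_hom)
  show "a \<in> carrier A \<Longrightarrow> lam ext (ab_zero ext a) = witt_map (ab_zero ext) (l a)" for a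
    by (simp add: lamE_\<iota>)
  fix x assume "x \<in> X.K"
  then obtain y where y: "x = \<kappa> y" "y \<in> carrier M" by (auto simp: K_ext)
  then show "lam ext x \<in> witt_seqs_in X.K" by (simp add: lamE_\<kappa> V_witt_seqs_in)
  show "lam ext x 1 = x" using y mod_lam(4)[of y] by (simp add: lamE_\<kappa> V_def)
  fix m n :: nat assume "m > 0" "n > 0"
  then show "lam ext (lam ext x n) m = lam ext x (n * m)"
    using y by (simp add: lamE_\<kappa> V_def mod_lam mult.commute)
qed

lemma ext_in_Obj: "ext \<in> Obj (LRing_ab_cat A l)"
  by (simp add: LRing_ab_cat_def is_lambda_ab_ext)

text \<open>The kernel consists of codes of pairs \<open>(0, x)\<close>, so it is only isomorphic to
  \<open>M\<close>, by \<open>p2\<close> and \<open>\<kappa>\<close>.\<close>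

lemma kernel_ext_iso:
  obtains \<theta> \<theta>' where "\<theta> \<in> Hom (LMod_cat A l) (kernel_lambda_module A ext) M"
    "\<theta>' \<in> Hom (LMod_cat A l) M (kernel_lambda_module A ext)"
    "\<And>x. x \<in> X.K \<Longrightarrow> \<theta>' (\<theta> x) = x" "\<And>x. x \<in> carrier M \<Longrightarrow> \<theta> (\<theta>' x) = x"
proof
  interpret Y: lambda_ab A ext l by (rule lambda_abI[OF inf is_lambda_ab_ext])
  show "restrict p2 X.K \<in> Hom (LMod_cat A l) (kernel_lambda_module A ext) M"
    unfolding LMod_cat_def linear_maps_def
    by (auto simp: X.K_add X.K_mult Y.L_closed[simplified]) (auto simp: K_ext lamE_\<kappa>[unfolded \<kappa>_def] V_def mod_lam \<kappa>_def \<iota>_def)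
  show "restrict \<kappa> (carrier M) \<in> Hom (LMod_cat A l) M (kernel_lambda_module A ext)"
    unfolding LMod_cat_def linear_maps_def
    by (auto simp: K_ext lamE_\<kappa>[unfolded \<kappa>_def] V_def mod_lam \<kappa>_def \<iota>_def)
qed (auto simp: K_ext \<kappa>_def)

end

section \<open>Adjunctions of fully faithful functors\<close>

text \<open>Morphisms of both categories are extensional functions, so equations between them can be
  checked on elements, where composition is application.\<close>

locale concrete_cat =
  fixes C :: "('o, 'u \<Rightarrow> 'u) cat" and car :: "'o \<Rightarrow> 'u set"
  assumes cat: "category C"
    and comp: "Comp C x y t g f = compose (car x) g f"
    and ident: "Ident C x = (\<lambda>a\<in>car x. a)"
    and homs: "x \<in> Obj C \<Longrightarrow> y \<in> Obj C \<Longrightarrow> Hom C x y \<subseteq> car x \<rightarrow>\<^sub>E car y"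
begin

lemma comp_apply [simp]: "a \<in> car x \<Longrightarrow> Comp C x y t g f a = g (f a)"
  by (simp add: comp compose_def)

lemma ident_apply [simp]: "a \<in> car x \<Longrightarrow> Ident C x a = a"
  by (simp add: ident)

lemma hom_apply: "f \<in> Hom C x y \<Longrightarrow> x \<in> Obj C \<Longrightarrow> y \<in> Obj C \<Longrightarrow> a \<in> car x \<Longrightarrow> f a \<in> car y"
  using homs[of x y] by auto

lemma hom_eqI:
  "f \<in> Hom C x y \<Longrightarrow> g \<in> Hom C x y \<Longrightarrow> x \<in> Obj C \<Longrightarrow> y \<in> Obj C \<Longrightarrow> (\<And>a. a \<in> car x \<Longrightarrow> f a = g a) \<Longrightarrow> f = g"
  using homs[of x y] by (intro extensionalityI[of f "car x" g]) (auto simp: PiE_def)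

lemma comp_closed: "x \<in> Obj C \<Longrightarrow> y \<in> Obj C \<Longrightarrow> t \<in> Obj C \<Longrightarrow> f \<in> Hom C x y \<Longrightarrow> g \<in> Hom C y t \<Longrightarrow> Comp C x y t g f \<in> Hom C x t"
  using cat by (auto simp: category_def)

lemma ident_closed: "x \<in> Obj C \<Longrightarrow> Ident C x \<in> Hom C x x"
  using cat by (auto simp: category_def)

lemma is_isoI:
  assumes "x \<in> Obj C" "y \<in> Obj C" "f \<in> Hom C x y" "g \<in> Hom C y x" "\<And>a. a \<in> car x \<Longrightarrow> g (f a) = a" "\<And>b. b \<in> car y \<Longrightarrow> f (g b) = b"
  shows "is_iso C x y f"
  unfolding is_iso_def
proof (intro conjI bexI[of _ g])
  show "Comp C x y x g f = Ident C x"
    using assms by (intro hom_eqI[of _ x x]) (auto simp: comp_closed ident_closed)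
  show "Comp C y x y f g = Ident C y"
    using assms by (intro hom_eqI[of _ y y]) (auto simp: comp_closed ident_closed)
qed (use assms in auto)

lemma is_isoE:
  assumes "is_iso C x y f"
  obtains g where "f \<in> Hom C x y" "g \<in> Hom C y x" "\<And>a. a \<in> car x \<Longrightarrow> g (f a) = a" "\<And>b. b \<in> car y \<Longrightarrow> f (g b) = b"
proof -
  obtain g where g: "f \<in> Hom C x y" "g \<in> Hom C y x" "Comp C x y x g f = Ident C x" "Comp C y x y f g = Ident C y"
    using assms by (auto simp: is_iso_def)
  have "g (f a) = a" if "a \<in> car x" for a using fun_cong[OF g(3), of a] that by simp
  moreover have "f (g a) = a" if "a \<in> car y" for a using fun_cong[OF g(4), of a] that by simp
  ultimately show ?thesis using that g by blast
qed

end

locale ff_functor =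
  C: concrete_cat C carC + D: concrete_cat D carD
  for C :: "('o, 'u \<Rightarrow> 'u) cat" and carC and D :: "('p, 'u \<Rightarrow> 'u) cat" and carD +
  fixes F :: "('o, 'u \<Rightarrow> 'u, 'p, 'u \<Rightarrow> 'u) cfunctor"
  assumes functor_F: "is_functor C D F"
    and faithful: "x \<in> Obj C \<Longrightarrow> y \<in> Obj C \<Longrightarrow> g \<in> Hom C x y \<Longrightarrow> h \<in> Hom C x y \<Longrightarrow> ar F x y g = ar F x y h \<Longrightarrow> g = h"
    and full: "x \<in> Obj C \<Longrightarrow> y \<in> Obj C \<Longrightarrow> k \<in> Hom D (ob F x) (ob F y) \<Longrightarrow> \<exists>g\<in>Hom C x y. ar F x y g = k"
    and ess_surj: "d \<in> Obj D \<Longrightarrow> \<exists>x\<in>Obj C. \<exists>\<theta>. is_iso D (ob F x) d \<theta>"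
begin

lemma F_ob: "x \<in> Obj C \<Longrightarrow> ob F x \<in> Obj D"
  and F_ar: "x \<in> Obj C \<Longrightarrow> y \<in> Obj C \<Longrightarrow> f \<in> Hom C x y \<Longrightarrow> ar F x y f \<in> Hom D (ob F x) (ob F y)"
  and F_ident: "x \<in> Obj C \<Longrightarrow> ar F x x (Ident C x) = Ident D (ob F x)"
  and F_comp: "x \<in> Obj C \<Longrightarrow> y \<in> Obj C \<Longrightarrow> t \<in> Obj C \<Longrightarrow> f \<in> Hom C x y \<Longrightarrow> g \<in> Hom C y t \<Longrightarrow>
    ar F x t (Comp C x y t g f) = Comp D (ob F x) (ob F y) (ob F t) (ar F y t g) (ar F x y f)"
  using functor_F by (auto simp: is_functor_def)

lemma F_comp_apply: "x \<in> Obj C \<Longrightarrow> y \<in> Obj C \<Longrightarrow> t \<in> Obj C \<Longrightarrow> f \<in> Hom C x y \<Longrightarrow> g \<in> Hom C y t \<Longrightarrow>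
    a \<in> carD (ob F x) \<Longrightarrow> ar F x t (Comp C x y t g f) a = ar F y t g (ar F x y f a)"
  by (simp add: F_comp)

lemma F_apply: "x \<in> Obj C \<Longrightarrow> y \<in> Obj C \<Longrightarrow> f \<in> Hom C x y \<Longrightarrow> a \<in> carD (ob F x) \<Longrightarrow> ar F x y f a \<in> carD (ob F y)"
  using D.hom_apply[OF F_ar] F_ob by blast

lemma faithful_apply:
  assumes "x \<in> Obj C" "y \<in> Obj C" "g \<in> Hom C x y" "h \<in> Hom C x y"
    and "\<And>a. a \<in> carD (ob F x) \<Longrightarrow> ar F x y g a = ar F x y h a"
  shows "g = h"
  by (rule faithful[OF assms(1-4) D.hom_eqI[OF F_ar[OF assms(1,2,3)] F_ar[OF assms(1,2,4)] F_ob[OF assms(1)] F_ob[OF assms(2)] assms(5)]])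

lemma iso_reflect:
  assumes "x \<in> Obj C" "y \<in> Obj C" "g \<in> Hom C x y" "is_iso D (ob F x) (ob F y) (ar F x y g)"
  shows "is_iso C x y g"
proof -
  obtain h where h: "h \<in> Hom D (ob F y) (ob F x)" "\<And>a. a \<in> carD (ob F x) \<Longrightarrow> h (ar F x y g a) = a"
    "\<And>b. b \<in> carD (ob F y) \<Longrightarrow> ar F x y g (h b) = b" using D.is_isoE[OF assms(4)] by metis
  obtain k where k: "k \<in> Hom C y x" "ar F y x k = h" using full[OF assms(2,1) h(1)] by blast
  have "Comp C x y x k g = Ident C x"
    by (rule faithful_apply[of x x]) (use assms k h in \<open>auto simp: C.comp_closed C.ident_closed F_comp F_ident\<close>)
  moreover have "Comp C y x y g k = Ident C y"
    by (rule faithful_apply[of y y]) (use assms k h in \<open>auto simp: C.comp_closed C.ident_closed F_comp F_ident\<close>)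
  ultimately show ?thesis using assms k by (auto simp: is_iso_def)
qed

text \<open>For each \<open>y\<close> an object \<open>H y\<close> and an isomorphism
  \<open>\<theta> y\<close> from its image onto \<open>y\<close> are chosen. On arrows the right
  adjoint is the preimage of conjugation by these isomorphisms; the counit is
  \<open>\<theta>\<close> and the unit is the preimage of its inverse. Equations in \<open>C\<close>
  are verified after applying the faithful \<open>F\<close>.\<close>

lemma adjunction_exists: "\<exists>G e u. is_adjunction C D \<lparr>ladj = F, radj = G, adj_counit = e, adj_unit = u\<rparr>"
proof -
  have "\<exists>t. fst t \<in> Obj C \<and> fst (snd t) \<in> Hom D (ob F (fst t)) y \<and> snd (snd t) \<in> Hom D y (ob F (fst t)) \<and>
      (\<forall>a\<in>carD (ob F (fst t)). snd (snd t) (fst (snd t) a) = a) \<and> (\<forall>b\<in>carD y. fst (snd t) (snd (snd t) b) = b)"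
    if y: "y \<in> Obj D" for y
  proof -
    obtain x \<theta> where x: "x \<in> Obj C" "is_iso D (ob F x) y \<theta>" using ess_surj[OF y] by blast
    from D.is_isoE[OF x(2)] obtain \<theta>' where "\<theta> \<in> Hom D (ob F x) y" "\<theta>' \<in> Hom D y (ob F x)"
      "\<And>a. a \<in> carD (ob F x) \<Longrightarrow> \<theta>' (\<theta> a) = a" "\<And>b. b \<in> carD y \<Longrightarrow> \<theta> (\<theta>' b) = b" by metis
    with x(1) show ?thesis by (intro exI[of _ "(x, \<theta>, \<theta>')"]) simp
  qed
  then have "\<forall>y\<in>Obj D. \<exists>t. fst t \<in> Obj C \<and> fst (snd t) \<in> Hom D (ob F (fst t)) y \<and> snd (snd t) \<in> Hom D y (ob F (fst t)) \<and>
      (\<forall>a\<in>carD (ob F (fst t)). snd (snd t) (fst (snd t) a) = a) \<and> (\<forall>b\<in>carD y. fst (snd t) (snd (snd t) b) = b)"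
    by blast
  from bchoice[OF this] obtain t where t: "\<forall>y\<in>Obj D. fst (t y) \<in> Obj C \<and> fst (snd (t y)) \<in> Hom D (ob F (fst (t y))) y \<and>
      snd (snd (t y)) \<in> Hom D y (ob F (fst (t y))) \<and>
      (\<forall>a\<in>carD (ob F (fst (t y))). snd (snd (t y)) (fst (snd (t y)) a) = a) \<and>
      (\<forall>b\<in>carD y. fst (snd (t y)) (snd (snd (t y)) b) = b)" by blast
  define H \<theta> \<theta>' where "H y = fst (t y)" and "\<theta> y = fst (snd (t y))" and "\<theta>' y = snd (snd (t y))" for y
  have H: "\<And>y. y \<in> Obj D \<Longrightarrow> H y \<in> Obj C"
    and \<theta>: "\<And>y. y \<in> Obj D \<Longrightarrow> \<theta> y \<in> Hom D (ob F (H y)) y" and \<theta>': "\<And>y. y \<in> Obj D \<Longrightarrow> \<theta>' y \<in> Hom D y (ob F (H y))"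
    and inv1: "\<And>y a. y \<in> Obj D \<Longrightarrow> a \<in> carD (ob F (H y)) \<Longrightarrow> \<theta>' y (\<theta> y a) = a"
    and inv2: "\<And>y b. y \<in> Obj D \<Longrightarrow> b \<in> carD y \<Longrightarrow> \<theta> y (\<theta>' y b) = b"
    using t by (simp_all add: H_def \<theta>_def \<theta>'_def)
  define lift where "lift x y h = (SOME g. g \<in> Hom C x y \<and> ar F x y g = h)" for x y h
  have lift: "lift x y h \<in> Hom C x y" "ar F x y (lift x y h) = h"
    if "x \<in> Obj C" "y \<in> Obj C" "h \<in> Hom D (ob F x) (ob F y)" for x y h
    using someI_ex[of "\<lambda>g. g \<in> Hom C x y \<and> ar F x y g = h"] full[OF that] unfolding lift_def by blast+
  define conj where "conj y y' f = Comp D (ob F (H y)) y' (ob F (H y')) (\<theta>' y') (Comp D (ob F (H y)) y y' f (\<theta> y))" for y y' f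
  have conj: "conj y y' f \<in> Hom D (ob F (H y)) (ob F (H y'))" if "y \<in> Obj D" "y' \<in> Obj D" "f \<in> Hom D y y'" for y y' f
    unfolding conj_def using that by (intro D.comp_closed \<theta> \<theta>' F_ob H)
  have conj_apply: "conj y y' f a = \<theta>' y' (f (\<theta> y a))" if "a \<in> carD (ob F (H y))" for y y' f a
    using that by (simp add: conj_def)
  define G where "G = \<lparr>ob = H, ar = \<lambda>y y' f. lift (H y) (H y') (conj y y' f)\<rparr>"
  define e where "e = (\<lambda>y\<in>Obj D. \<theta> y)"
  define u where "u = (\<lambda>x\<in>Obj C. lift x (H (ob F x)) (\<theta>' (ob F x)))"
  have G_ob [simp]: "ob G y = H y" for y by (simp add: G_def)
  have G_ar: "ar G y y' f \<in> Hom C (H y) (H y')" "ar F (H y) (H y') (ar G y y' f) = conj y y' f"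
    if "y \<in> Obj D" "y' \<in> Obj D" "f \<in> Hom D y y'" for y y' f
    unfolding G_def using lift[OF H[OF that(1)] H[OF that(2)] conj[OF that]] by simp_all
  have u: "u x \<in> Hom C x (H (ob F x))" "ar F x (H (ob F x)) (u x) = \<theta>' (ob F x)" if "x \<in> Obj C" for x
    unfolding u_def using lift[OF that H[OF F_ob[OF that]] \<theta>'[OF F_ob[OF that]]] that by simp_all
  have \<theta>c: "\<theta> y a \<in> carD y" if "y \<in> Obj D" "a \<in> carD (ob F (H y))" for y a
    using D.hom_apply[OF \<theta> F_ob[OF H]] that by blast
  have \<theta>'c: "\<theta>' y a \<in> carD (ob F (H y))" if "y \<in> Obj D" "a \<in> carD y" for y a
    using D.hom_apply[OF \<theta>' _ F_ob[OF H]] that by blast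
  have functor_G: "is_functor D C G"
    unfolding is_functor_def
  proof (intro conjI ballI)
    fix y assume y: "y \<in> Obj D"
    show "ar G y y (Ident D y) = Ident C (ob G y)"
    proof (rule faithful_apply[of "H y" "H y"])
      fix a assume a: "a \<in> carD (ob F (H y))"
      then show "ar F (H y) (H y) (ar G y y (Ident D y)) a = ar F (H y) (H y) (Ident C (ob G y)) a"
        using y by (simp add: G_ar D.ident_closed conj_apply \<theta>c inv1 F_ident H)
    qed (use y H G_ar D.ident_closed C.ident_closed in auto)
  next
    fix y y' y'' f g assume y: "y \<in> Obj D" "y' \<in> Obj D" "y'' \<in> Obj D" "f \<in> Hom D y y'" "g \<in> Hom D y' y''"
    note c = D.comp_closed[OF y]
    show "ar G y y'' (Comp D y y' y'' g f) = Comp C (ob G y) (ob G y') (ob G y'') (ar G y' y'' g) (ar G y y' f)"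
    proof (rule faithful_apply[of "H y" "H y''"])
      show "Comp C (ob G y) (ob G y') (ob G y'') (ar G y' y'' g) (ar G y y' f) \<in> Hom C (H y) (H y'')"
        using y by (auto intro!: C.comp_closed H G_ar)
      fix a assume a: "a \<in> carD (ob F (H y))"
      then have "f (\<theta> y a) \<in> carD y'" using D.hom_apply[OF y(4)] y \<theta>c by blast
      then show "ar F (H y) (H y'') (ar G y y'' (Comp D y y' y'' g f)) a =
        ar F (H y) (H y'') (Comp C (ob G y) (ob G y') (ob G y'') (ar G y' y'' g) (ar G y y' f)) a"
        using a y c by (simp add: G_ar F_comp_apply H conj_apply \<theta>c \<theta>'c inv2)
    qed (use y H G_ar c in auto)
  qed (use C.cat D.cat H G_ar in auto)
  have nat_e: "nat_trans D D (F \<circ>\<^sub>F G) id_functor e"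
    unfolding nat_trans_def comp_functor_def id_functor_def cfunctor.simps G_ob
  proof (intro conjI ballI)
    show "e \<in> extensional (Obj D)" by (simp add: e_def)
    show "y \<in> Obj D \<Longrightarrow> e y \<in> Hom D (ob F (H y)) y" for y using \<theta> by (simp add: e_def)
    fix y y' f assume y: "y \<in> Obj D" "y' \<in> Obj D" "f \<in> Hom D y y'"
    show "Comp D (ob F (H y)) (ob F (H y')) y' (e y') (ar F (H y) (H y') (ar G y y' f)) = Comp D (ob F (H y)) y y' f (e y)"
    proof (rule D.hom_eqI[of _ "ob F (H y)" y'])
      fix a assume a: "a \<in> carD (ob F (H y))"
      have "f (\<theta> y a) \<in> carD y'" using D.hom_apply[OF y(3)] y \<theta>c a by blast
      then show "Comp D (ob F (H y)) (ob F (H y')) y' (e y') (ar F (H y) (H y') (ar G y y' f)) a = Comp D (ob F (H y)) y y' f (e y) a"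
        using a y by (simp add: e_def G_ar conj_apply inv2)
    qed (use y in \<open>auto intro!: D.comp_closed F_ob H F_ar G_ar \<theta> simp: e_def\<close>)
  qed
  have nat_u: "nat_trans C C id_functor (G \<circ>\<^sub>F F) u"
    unfolding nat_trans_def comp_functor_def id_functor_def cfunctor.simps G_ob
  proof (intro conjI ballI)
    show "u \<in> extensional (Obj C)" by (simp add: u_def)
    show "x \<in> Obj C \<Longrightarrow> u x \<in> Hom C x (H (ob F x))" for x using u by simp
    fix x y f assume x: "x \<in> Obj C" "y \<in> Obj C" "f \<in> Hom C x y"
    note Ff = F_ar[OF x]
    show "Comp C x y (H (ob F y)) (u y) f = Comp C x (H (ob F x)) (H (ob F y)) (ar G (ob F x) (ob F y) (ar F x y f)) (u x)"
    proof (rule faithful_apply[of x "H (ob F y)"])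
      fix a assume a: "a \<in> carD (ob F x)"
      show "ar F x (H (ob F y)) (Comp C x y (H (ob F y)) (u y) f) a =
        ar F x (H (ob F y)) (Comp C x (H (ob F x)) (H (ob F y)) (ar G (ob F x) (ob F y) (ar F x y f)) (u x)) a"
        using a x Ff by (simp add: F_comp_apply H F_ob u G_ar conj_apply \<theta>'c inv2)
    qed (use x Ff in \<open>auto intro!: C.comp_closed H F_ob u G_ar\<close>)
  qed
  show ?thesis
  proof (intro exI)
    show "is_adjunction C D \<lparr>ladj = F, radj = G, adj_counit = e, adj_unit = u\<rparr>"
      unfolding is_adjunction_def Let_def adj.simps
    proof (intro conjI ballI functor_F functor_G nat_e nat_u)
      fix x assume x: "x \<in> Obj C"
      show "Comp D (ob F x) (ob F (ob G (ob F x))) (ob F x) (e (ob F x)) (ar F x (ob G (ob F x)) (u x)) = Ident D (ob F x)"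
        using x by (intro D.hom_eqI[of _ "ob F x" "ob F x"])
          (auto intro!: D.comp_closed F_ob H D.ident_closed F_ar u \<theta> \<theta>' simp: e_def u(2) inv2)
    next
      fix y assume y: "y \<in> Obj D"
      note c = F_ob[OF H[OF y]]
      show "Comp C (ob G y) (ob G (ob F (ob G y))) (ob G y) (ar G (ob F (ob G y)) y (e y)) (u (ob G y)) = Ident C (ob G y)"
      proof (rule faithful_apply[of "H y" "H y"])
        fix a assume a: "a \<in> carD (ob F (H y))"
        show "ar F (H y) (H y) (Comp C (ob G y) (ob G (ob F (ob G y))) (ob G y) (ar G (ob F (ob G y)) y (e y)) (u (ob G y))) a =
          ar F (H y) (H y) (Ident C (ob G y)) a"
          using a y c by (simp add: F_comp_apply H u G_ar \<theta> e_def conj_apply \<theta>'c \<theta>c inv1 inv2 F_ident)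
      qed (use y c in \<open>auto intro!: C.comp_closed H u G_ar \<theta> C.ident_closed simp: e_def\<close>)
    qed
  qed
qed

section \<open>Arbitrary adjunctions with left adjoint \<open>F\<close>\<close>

context
  fixes P assumes adj: "is_adjunction C D P" and ladj: "ladj P = F"
begin

abbreviation "G \<equiv> radj P"
abbreviation "e \<equiv> adj_counit P"
abbreviation "u \<equiv> adj_unit P"

lemma functor_G: "is_functor D C G"
  using adj by (simp add: is_adjunction_def Let_def)

lemma G_ob: "y \<in> Obj D \<Longrightarrow> ob G y \<in> Obj C"
  and G_ar: "x \<in> Obj D \<Longrightarrow> y \<in> Obj D \<Longrightarrow> f \<in> Hom D x y \<Longrightarrow> ar G x y f \<in> Hom C (ob G x) (ob G y)"
  and G_comp: "x \<in> Obj D \<Longrightarrow> y \<in> Obj D \<Longrightarrow> t \<in> Obj D \<Longrightarrow> f \<in> Hom D x y \<Longrightarrow> g \<in> Hom D y t \<Longrightarrow>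
    ar G x t (Comp D x y t g f) = Comp C (ob G x) (ob G y) (ob G t) (ar G y t g) (ar G x y f)"
  using functor_G by (auto simp: is_functor_def)

lemma e_hom: "y \<in> Obj D \<Longrightarrow> e y \<in> Hom D (ob F (ob G y)) y"
  using adj ladj by (auto simp: is_adjunction_def Let_def nat_trans_def comp_functor_def id_functor_def)

lemma u_hom: "x \<in> Obj C \<Longrightarrow> u x \<in> Hom C x (ob G (ob F x))"
  using adj ladj by (auto simp: is_adjunction_def Let_def nat_trans_def comp_functor_def id_functor_def)

lemma e_natural:
  assumes "y \<in> Obj D" "y' \<in> Obj D" "f \<in> Hom D y y'" "a \<in> carD (ob F (ob G y))"
  shows "e y' (ar F (ob G y) (ob G y') (ar G y y' f) a) = f (e y a)"
proof -
  have "Comp D (ob F (ob G y)) (ob F (ob G y')) y' (e y') (ar F (ob G y) (ob G y') (ar G y y' f)) =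
    Comp D (ob F (ob G y)) y y' f (e y)"
    using adj ladj assms by (auto simp: is_adjunction_def Let_def nat_trans_def comp_functor_def id_functor_def)
  from fun_cong[OF this, of a] show ?thesis using assms by simp
qed

lemma u_natural:
  assumes "x \<in> Obj C" "y \<in> Obj C" "f \<in> Hom C x y"
  shows "Comp C x y (ob G (ob F y)) (u y) f = Comp C x (ob G (ob F x)) (ob G (ob F y)) (ar G (ob F x) (ob F y) (ar F x y f)) (u x)"
  using adj ladj assms by (auto simp: is_adjunction_def Let_def nat_trans_def comp_functor_def id_functor_def)

lemma triangle1: "x \<in> Obj C \<Longrightarrow> a \<in> carD (ob F x) \<Longrightarrow> e (ob F x) (ar F x (ob G (ob F x)) (u x) a) = a"
proof -
  assume x: "x \<in> Obj C" "a \<in> carD (ob F x)"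
  have "Comp D (ob F x) (ob F (ob G (ob F x))) (ob F x) (e (ob F x)) (ar F x (ob G (ob F x)) (u x)) = Ident D (ob F x)"
    using adj ladj x by (auto simp: is_adjunction_def Let_def)
  from fun_cong[OF this, of a] show ?thesis using x by simp
qed

lemma triangle2:
  "y \<in> Obj D \<Longrightarrow> Comp C (ob G y) (ob G (ob F (ob G y))) (ob G y) (ar G (ob F (ob G y)) y (e y)) (u (ob G y)) = Ident C (ob G y)"
  using adj ladj by (auto simp: is_adjunction_def Let_def)

text \<open>By naturality of the unit and the second triangle identity, \<open>k\<close> is
  recovered from its transpose as \<open>G (e \<circ> F k) \<circ> u\<close>.\<close>

lemma transpose_cancel:
  assumes x: "x \<in> Obj C" and y: "y \<in> Obj D" and k: "k \<in> Hom C x (ob G y)" "k' \<in> Hom C x (ob G y)"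
    and eq: "\<And>a. a \<in> carD (ob F x) \<Longrightarrow> e y (ar F x (ob G y) k a) = e y (ar F x (ob G y) k' a)"
  shows "k = k'"
proof -
  have main: "k b = Comp C x (ob G (ob F x)) (ob G y)
     (ar G (ob F x) y (Comp D (ob F x) (ob F (ob G y)) y (e y) (ar F x (ob G y) k))) (u x) b"
    if k: "k \<in> Hom C x (ob G y)" and b: "b \<in> carC x" for k b
  proof -
    note o = G_ob[OF y] F_ob[OF x] F_ob[OF G_ob[OF y]]
    have kb: "k b \<in> carC (ob G y)" using C.hom_apply[OF k x o(1) b] .
    have ub: "u x b \<in> carC (ob G (ob F x))" using C.hom_apply[OF u_hom[OF x] x G_ob[OF o(2)] b] .
    have "k b = ar G (ob F (ob G y)) y (e y) (u (ob G y) (k b))"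
      using fun_cong[OF triangle2[OF y], of "k b"] kb by simp
    also have "u (ob G y) (k b) = ar G (ob F x) (ob F (ob G y)) (ar F x (ob G y) k) (u x b)"
      using fun_cong[OF u_natural[OF x o(1) k], of b] b by simp
    finally show ?thesis
      using b ub by (simp add: G_comp[OF o(2,3) y F_ar[OF x o(1) k] e_hom[OF y]])
  qed
  have eqc: "Comp D (ob F x) (ob F (ob G y)) y (e y) (ar F x (ob G y) k) = Comp D (ob F x) (ob F (ob G y)) y (e y) (ar F x (ob G y) k')"
    using x y k eq by (intro D.hom_eqI[of _ "ob F x" y]) (auto intro!: D.comp_closed F_ob G_ob F_ar e_hom)
  show ?thesis
  proof (rule C.hom_eqI[OF k x G_ob[OF y]])
    show "k b = k' b" if "b \<in> carC x" for b
      using main[OF k(1) that] main[OF k(2) that] by (simp only: eqc)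
  qed
qed

text \<open>An isomorphism \<open>\<theta>\<close> from some \<open>F x\<close> onto
  \<open>y\<close> factors through the counit by its transpose \<open>g\<close>, so
  \<open>\<sigma> = F g \<circ> \<theta>'\<close> is a right inverse of the counit. By fullness
  \<open>\<sigma> \<circ> e\<close> is \<open>F k\<close> for some \<open>k\<close>, and this
  \<open>k\<close> has the same transpose as the identity.\<close>

lemma counit_iso:
  assumes y: "y \<in> Obj D" shows "is_iso D (ob F (ob G y)) y (e y)"
proof -
  obtain x \<theta> where x: "x \<in> Obj C" "is_iso D (ob F x) y \<theta>" using ess_surj[OF y] by blast
  obtain \<theta>' where \<theta>: "\<theta> \<in> Hom D (ob F x) y" "\<theta>' \<in> Hom D y (ob F x)" "\<And>b. b \<in> carD y \<Longrightarrow> \<theta> (\<theta>' b) = b"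
    using D.is_isoE[OF x(2)] by metis
  note o = F_ob[OF x(1)] G_ob[OF y] F_ob[OF G_ob[OF y]] G_ob[OF F_ob[OF x(1)]]
  note g\<theta> = G_ar[OF o(1) y \<theta>(1)] and ux = u_hom[OF x(1)]
  define g where "g = Comp C x (ob G (ob F x)) (ob G y) (ar G (ob F x) y \<theta>) (u x)"
  have g: "g \<in> Hom C x (ob G y)" unfolding g_def by (rule C.comp_closed[OF x(1) o(4,2) ux g\<theta>])
  have eg: "e y (ar F x (ob G y) g a) = \<theta> a" if a: "a \<in> carD (ob F x)" for a
    using a F_apply[OF x(1) o(4) ux a] triangle1[OF x(1) a]
    by (simp add: g_def F_comp_apply[OF x(1) o(4,2) ux g\<theta>] e_natural[OF o(1) y \<theta>(1)])
  define \<sigma> where "\<sigma> = Comp D y (ob F x) (ob F (ob G y)) (ar F x (ob G y) g) \<theta>'"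
  have \<sigma>: "\<sigma> \<in> Hom D y (ob F (ob G y))" unfolding \<sigma>_def by (rule D.comp_closed[OF y o(1,3) \<theta>(2) F_ar[OF x(1) o(2) g]])
  have e\<sigma>: "e y (\<sigma> b) = b" if b: "b \<in> carD y" for b
    using b D.hom_apply[OF \<theta>(2) y o(1) b] by (simp add: \<sigma>_def eg \<theta>(3))
  have \<sigma>e: "Comp D (ob F (ob G y)) y (ob F (ob G y)) \<sigma> (e y) \<in> Hom D (ob F (ob G y)) (ob F (ob G y))"
    by (rule D.comp_closed[OF o(3) y o(3) e_hom[OF y] \<sigma>])
  obtain k where k: "k \<in> Hom C (ob G y) (ob G y)" "ar F (ob G y) (ob G y) k = Comp D (ob F (ob G y)) y (ob F (ob G y)) \<sigma> (e y)"
    using full[OF o(2,2) \<sigma>e] by blast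
  have "k = Ident C (ob G y)"
    using D.hom_apply[OF e_hom[OF y] o(3) y]
    by (intro transpose_cancel[OF o(2) y k(1) C.ident_closed[OF o(2)]]) (simp add: k(2) e\<sigma> F_ident o)
  then have "Comp D (ob F (ob G y)) y (ob F (ob G y)) \<sigma> (e y) = Ident D (ob F (ob G y))"
    using k(2) F_ident[OF o(2)] by simp
  from fun_cong[OF this] have "\<sigma> (e y a) = a" if "a \<in> carD (ob F (ob G y))" for a
    using that by (metis D.comp_apply D.ident_apply)
  then show ?thesis using e\<sigma> by (intro D.is_isoI[OF o(3) y e_hom[OF y] \<sigma>])
qed

text \<open>The counit is invertible and, by the first triangle identity, \<open>F u\<close> is its
  inverse; moreover \<open>F\<close> reflects isomorphisms.\<close>

lemma unit_iso:
  assumes x: "x \<in> Obj C" shows "is_iso C x (ob G (ob F x)) (u x)"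
proof (rule iso_reflect[OF x G_ob[OF F_ob[OF x]] u_hom[OF x]])
  note o = F_ob[OF x] G_ob[OF F_ob[OF x]] F_ob[OF G_ob[OF F_ob[OF x]]]
  obtain e' where e': "e' \<in> Hom D (ob F x) (ob F (ob G (ob F x)))"
    "\<And>a. a \<in> carD (ob F (ob G (ob F x))) \<Longrightarrow> e' (e (ob F x) a) = a"
    using D.is_isoE[OF counit_iso[OF o(1)]] by metis
  have "ar F x (ob G (ob F x)) (u x) (e (ob F x) b) = b" if b: "b \<in> carD (ob F (ob G (ob F x)))" for b
  proof -
    have eb: "e (ob F x) b \<in> carD (ob F x)" using D.hom_apply[OF e_hom[OF o(1)] o(3,1) b] .
    have "e' (e (ob F x) (ar F x (ob G (ob F x)) (u x) (e (ob F x) b))) = e' (e (ob F x) b)"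
      using triangle1[OF x eb] by simp
    then show ?thesis using e'(2) b F_apply[OF x o(2) u_hom[OF x] eb] by metis
  qed
  then show "is_iso D (ob F x) (ob F (ob G (ob F x))) (ar F x (ob G (ob F x)) (u x))"
    using triangle1[OF x] by (intro D.is_isoI[OF o(1,3) F_ar[OF x o(2) u_hom[OF x]] e_hom[OF o(1)]])
qed

lemma adjoint_equivalence: "is_adjoint_equivalence C D P"
  unfolding is_adjoint_equivalence_def nat_iso_def
  using adj ladj counit_iso unit_iso by (auto simp: is_adjunction_def Let_def comp_functor_def id_functor_def)

end

end

section \<open>Adjunctions over the square\<close>

lemma concrete_catI:
  assumes comp: "\<And>x y t g f. Comp C x y t g f = compose (car x) g f"
    and ident: "\<And>x. Ident C x = (\<lambda>a\<in>car x. a)"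
    and homs: "\<And>x y. x \<in> Obj C \<Longrightarrow> y \<in> Obj C \<Longrightarrow> Hom C x y \<subseteq> car x \<rightarrow>\<^sub>E car y"
    and ident_closed: "\<And>x. x \<in> Obj C \<Longrightarrow> Ident C x \<in> Hom C x x"
    and comp_closed: "\<And>x y t f g. x \<in> Obj C \<Longrightarrow> y \<in> Obj C \<Longrightarrow> t \<in> Obj C \<Longrightarrow> f \<in> Hom C x y \<Longrightarrow> g \<in> Hom C y t \<Longrightarrow>
      Comp C x y t g f \<in> Hom C x t"
  shows "concrete_cat C car"
proof
  have h: "f \<in> car x \<rightarrow> car y" "f \<in> extensional (car x)" if "x \<in> Obj C" "y \<in> Obj C" "f \<in> Hom C x y" for x y f
    using homs[OF that(1,2)] that(3) by (auto simp: PiE_def)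
  show "category C"
    unfolding category_def
  proof (intro conjI ballI)
    fix x y f assume x: "x \<in> Obj C" "y \<in> Obj C" "f \<in> Hom C x y"
    show "Comp C x y y (Ident C y) f = f" "Comp C x x y f (Ident C x) = f"
      unfolding comp ident using h[OF x] by (auto intro: Id_compose compose_Id)
  next
    fix w x y t f g k assume x: "w \<in> Obj C" "x \<in> Obj C" "y \<in> Obj C" "t \<in> Obj C" "f \<in> Hom C w x" "g \<in> Hom C x y" "k \<in> Hom C y t"
    show "Comp C w x t (Comp C x y t k g) f = Comp C w y t k (Comp C w x y g f)"
      unfolding comp by (rule compose_assoc[OF h(1)[OF x(1,2,5)], symmetric])
  qed (use ident_closed comp_closed in auto)
qed (use comp ident homs in auto)

text \<open>The left adjoint of an adjunction over the square is determined only up to the values of \<open>mod_lam\<close> at 0 and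
  outside of the carrier, which no hom-set depends on.\<close>

definition mod_agree :: "('a, 'b) lambda_module \<Rightarrow> ('a, 'b) lambda_module \<Rightarrow> bool" where
  "mod_agree M M' \<longleftrightarrow> module.truncate M = module.truncate M' \<and> (\<forall>n>0. \<forall>x\<in>carrier M. mod_lam M n x = mod_lam M' n x)"

lemma mod_agreeD:
  assumes "mod_agree M M'"
  shows "carrier M = carrier M'" "x \<oplus>\<^bsub>M\<^esub> y = x \<oplus>\<^bsub>M'\<^esub> y" "a \<odot>\<^bsub>M\<^esub> x = a \<odot>\<^bsub>M'\<^esub> x"
    "n > 0 \<Longrightarrow> x \<in> carrier M \<Longrightarrow> mod_lam M n x = mod_lam M' n x"
proof -
  have t: "module.truncate M = module.truncate M'" using assms by (simp add: mod_agree_def)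
  show "carrier M = carrier M'" using arg_cong[OF t, of carrier] by (simp add: module.truncate_def)
  show "x \<oplus>\<^bsub>M\<^esub> y = x \<oplus>\<^bsub>M'\<^esub> y" using arg_cong[OF t, of "\<lambda>R. ring.add R x y"] by (simp add: module.truncate_def)
  show "a \<odot>\<^bsub>M\<^esub> x = a \<odot>\<^bsub>M'\<^esub> x" using arg_cong[OF t, of "\<lambda>R. smult R a x"] by (simp add: module.truncate_def)
qed (use assms in \<open>simp add: mod_agree_def\<close>)

lemma LMod_hom_agree:
  assumes M: "mod_agree M M'" and N: "mod_agree N N'"
  shows "Hom (LMod_cat A l) M N = Hom (LMod_cat A l) M' N'"
proof -
  have "f \<in> Hom (LMod_cat A l) M N \<longleftrightarrow> f \<in> Hom (LMod_cat A l) M' N'" for f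
  proof (cases "f \<in> carrier M \<rightarrow>\<^sub>E carrier N")
    case True
    then have "f x \<in> carrier N" if "x \<in> carrier M" for x using that by auto
    then show ?thesis
      using mod_agreeD(4)[OF M] mod_agreeD(4)[OF N]
      by (auto simp: LMod_cat_def linear_maps_def mod_agreeD(1-3)[OF M] mod_agreeD(1-3)[OF N])
  qed (auto simp: LMod_cat_def linear_maps_def mod_agreeD(1)[OF M] mod_agreeD(1)[OF N])
  then show ?thesis by blast
qed

lemma mod_agree_refl: "mod_agree M M"
  by (simp add: mod_agree_def)

lemma mod_agree_sym: "mod_agree M M' \<Longrightarrow> mod_agree M' M"
  using mod_agreeD(1)[of M M'] by (simp add: mod_agree_def)

lemma mod_agree_trans: "mod_agree M M' \<Longrightarrow> mod_agree M' M'' \<Longrightarrow> mod_agree M M''"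
  using mod_agreeD(1)[of M M'] by (simp add: mod_agree_def)

section \<open>The kernel functor with its module operations\<close>

locale lambda_base =
  fixes A :: "'u ring" and l :: "'u \<Rightarrow> nat \<Rightarrow> 'u"
  assumes inf: "infinite (UNIV :: 'u set)" and base: "lambda_ring A l"
begin

abbreviation "\<C> \<equiv> LRing_ab_cat A l"
abbreviation "\<D> \<equiv> LMod_cat A l"
abbreviation "ker P \<equiv> a_kernel (total P) A (proj P)"

lemma Obj_C: "P \<in> Obj \<C> \<longleftrightarrow> is_lambda_ab A l P"
  by (simp add: LRing_ab_cat_def)

lemma Obj_D: "M \<in> Obj \<D> \<longleftrightarrow> is_lambda_module A l M"
  by (simp add: LMod_cat_def)

lemma ker_eq: "P \<in> Obj \<C> \<Longrightarrow> ker P = ring_ab.K A P"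
  using ring_ab.K_eq[of A P] lambda_abI[OF inf] by (auto simp: Obj_C lambda_ab_def)

lemma carrier_KM: "carrier (kernel_lambda_module A P) = ker P"
  by (simp add: kernel_lambda_module_def)

lemma concrete_C: "concrete_cat \<C> (\<lambda>P. carrier (total P))"
proof (rule concrete_catI)
  show "Comp \<C> x y t g f = compose (carrier (total x)) g f" "Ident \<C> x = (\<lambda>a\<in>carrier (total x). a)" for x y t g f
    by (simp_all add: LRing_ab_cat_def)
  show "Hom \<C> x y \<subseteq> carrier (total x) \<rightarrow>\<^sub>E carrier (total y)" if "x \<in> Obj \<C>" "y \<in> Obj \<C>" for x y
    using LRing_hom_iff[OF inf that[unfolded Obj_C]] by (auto simp: PiE_def ring_hom_closed)
next
  fix P assume P: "P \<in> Obj \<C>"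
  interpret P: lambda_ab A P l using P lambda_abI[OF inf] by (simp add: Obj_C)
  have "witt_map (\<lambda>a\<in>carrier P.B. a) (P.L x) = P.L x" if "x \<in> carrier P.B" for x
    using P.L_witt_seqs[OF that] by (intro witt_seqs_eqI[OF witt_map_closed]) (auto simp: witt_map_apply)
  moreover have "(\<lambda>a\<in>carrier P.B. a) \<in> ring_hom P.B P.B" by (rule ring_hom_memI) auto
  ultimately show "Ident \<C> P \<in> Hom \<C> P P"
    unfolding LRing_hom_iff[OF inf P[unfolded Obj_C] P[unfolded Obj_C]] by (simp add: LRing_ab_cat_def)
next
  fix P Q R f g assume o: "P \<in> Obj \<C>" "Q \<in> Obj \<C>" "R \<in> Obj \<C>" and f: "f \<in> Hom \<C> P Q" and g: "g \<in> Hom \<C> Q R"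
  note o' = o[unfolded Obj_C]
  interpret P: lambda_ab A P l using o' lambda_abI[OF inf] by blast
  interpret Q: lambda_ab A Q l using o' lambda_abI[OF inf] by blast
  interpret R: lambda_ab A R l using o' lambda_abI[OF inf] by blast
  have f: "f \<in> ring_hom P.B Q.B" "\<And>x. x \<in> carrier P.B \<Longrightarrow> Q.f (f x) = P.f x" "\<And>a. a \<in> carrier A \<Longrightarrow> f (P.z a) = Q.z a"
    "\<And>x. x \<in> carrier P.B \<Longrightarrow> Q.L (f x) = witt_map f (P.L x)"
    using f LRing_hom_iff[OF inf o'(1,2)] by auto
  have g: "g \<in> ring_hom Q.B R.B" "\<And>x. x \<in> carrier Q.B \<Longrightarrow> R.f (g x) = Q.f x" "\<And>a. a \<in> carrier A \<Longrightarrow> g (Q.z a) = R.z a"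
    "\<And>x. x \<in> carrier Q.B \<Longrightarrow> R.L (g x) = witt_map g (Q.L x)"
    using g LRing_hom_iff[OF inf o'(2,3)] by auto
  note fc = ring_hom_closed[OF f(1)] and gc = ring_hom_closed[OF g(1)]
  have "compose (carrier P.B) g f \<in> ring_hom P.B R.B"
    by (rule ring_hom_memI)
      (auto simp: compose_eq fc gc ring_hom_add[OF f(1)] ring_hom_add[OF g(1)] ring_hom_mult[OF f(1)] ring_hom_mult[OF g(1)]
        ring_hom_one[OF f(1)] ring_hom_one[OF g(1)])
  moreover have "witt_map g (witt_map f (P.L x)) = witt_map (compose (carrier P.B) g f) (P.L x)" if "x \<in> carrier P.B" for x
    unfolding witt_map_comp using P.L_witt_seqs[OF that] by (intro witt_map_cong) (simp add: compose_eq)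
  ultimately show "Comp \<C> P Q R g f \<in> Hom \<C> P R"
    unfolding LRing_hom_iff[OF inf o'(1,3)] using f g fc
    by (simp add: LRing_ab_cat_def compose_eq)
qed

lemma concrete_D: "concrete_cat \<D> carrier"
proof (rule concrete_catI)
  show "Comp \<D> x y t g f = compose (carrier x) g f" "Ident \<D> x = (\<lambda>a\<in>carrier x. a)" for x y t g f
    by (simp_all add: LMod_cat_def)
  show "Hom \<D> x y \<subseteq> carrier x \<rightarrow>\<^sub>E carrier y" for x y by (auto simp: LMod_cat_def linear_maps_def)
next
  fix M assume "M \<in> Obj \<D>"
  then have M: "is_lambda_module A l M" by (simp add: Obj_D)
  then interpret module A M by (simp add: is_lambda_module_def)
  have "n > 0 \<Longrightarrow> x \<in> carrier M \<Longrightarrow> mod_lam M n x \<in> carrier M" for n x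
    using M by (auto simp: is_lambda_module_def Pi_iff)
  then show "Ident \<D> M \<in> Hom \<D> M M" by (auto simp: LMod_cat_def linear_maps_def)
next
  fix M N K f g assume o: "M \<in> Obj \<D>" "N \<in> Obj \<D>" "K \<in> Obj \<D>" and f: "f \<in> Hom \<D> M N" and g: "g \<in> Hom \<D> N K"
  from o(1) have M: "is_lambda_module A l M" by (simp add: Obj_D)
  then interpret module A M by (simp add: is_lambda_module_def)
  have "n > 0 \<Longrightarrow> x \<in> carrier M \<Longrightarrow> mod_lam M n x \<in> carrier M" for n x
    using M by (auto simp: is_lambda_module_def Pi_iff)
  moreover have "f x \<in> carrier N" if "x \<in> carrier M" for x using f that by (auto simp: LMod_cat_def linear_maps_def)
  ultimately show "Comp \<D> M N K g f \<in> Hom \<D> M K"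
    using f g by (auto simp: LMod_cat_def linear_maps_def compose_def)
qed

lemma LMod_ob: "P \<in> Obj \<C> \<Longrightarrow> kernel_lambda_module A P \<in> Obj \<D>"
  using lambda_ab.is_lambda_module_KM[OF lambda_abI[OF inf]] by (simp add: Obj_C Obj_D)

definition kernel_lambda_functor :: "('u lambda_ab, 'u \<Rightarrow> 'u, ('u, 'u) lambda_module, 'u \<Rightarrow> 'u) cfunctor" where
  "kernel_lambda_functor = \<lparr>ob = kernel_lambda_module A, ar = \<lambda>P Q g. restrict g (ker P)\<rparr>"

lemma functor_kernel_lambda_functor: "is_functor \<C> \<D> kernel_lambda_functor"
proof -
  interpret C: concrete_cat \<C> "\<lambda>P. carrier (total P)" by (rule concrete_C)
  interpret D: concrete_cat \<D> carrier by (rule concrete_D)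
  have ar: "restrict g (ker P) \<in> Hom \<D> (kernel_lambda_module A P) (kernel_lambda_module A Q)"
    if "P \<in> Obj \<C>" "Q \<in> Obj \<C>" "g \<in> Hom \<C> P Q" for P Q g
    using kernel_restrict_hom[OF inf that(1,2)[unfolded Obj_C] that(3)] by (simp add: ker_eq that)
  have sub: "ker P \<subseteq> carrier (total P)" for P :: "'u lambda_ab" by (auto simp: a_kernel_def')
  have img: "f a \<in> ker Q" if "P \<in> Obj \<C>" "Q \<in> Obj \<C>" "f \<in> Hom \<C> P Q" "a \<in> ker P" for P Q f a
    using D.hom_apply[OF ar[OF that(1-3)] LMod_ob[OF that(1)] LMod_ob[OF that(2)]] that(4) by (simp add: carrier_KM)
  show ?thesis
    unfolding is_functor_def kernel_lambda_functor_def cfunctor.simps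
  proof (intro conjI ballI C.cat D.cat LMod_ob ar)
    fix P assume "P \<in> Obj \<C>"
    show "restrict (Ident \<C> P) (ker P) = Ident \<D> (kernel_lambda_module A P)"
      unfolding C.ident D.ident carrier_KM using sub[of P] by (simp add: Int_absorb1)
  next
    fix P Q R f g assume o: "P \<in> Obj \<C>" "Q \<in> Obj \<C>" "R \<in> Obj \<C>" "f \<in> Hom \<C> P Q" "g \<in> Hom \<C> Q R"
    show "restrict (Comp \<C> P Q R g f) (ker P) =
      Comp \<D> (kernel_lambda_module A P) (kernel_lambda_module A Q) (kernel_lambda_module A R) (restrict g (ker Q)) (restrict f (ker P))"
      unfolding C.comp D.comp carrier_KM compose_def using sub[of P] img[OF o(1,2,4)] by (intro restrict_ext) auto
  qed auto
qed

lemma square_kernel_lambda_functor: "square_commutes A l kernel_lambda_functor"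
  unfolding square_commutes_def functors_equal_def
  by (auto simp: comp_functor_def forget_mod_def kernel_functor_def forget_ab_def kernel_lambda_functor_def truncate_kernel_lambda_module)
    (auto simp: kernel_module_def ring_ab.truncate_def)

lemma units_kernel_lambda_functor: "units_agree A l kernel_lambda_functor"
  unfolding units_agree_def
proof (intro ballI)
  fix P x assume P: "P \<in> Obj \<C>" and x: "x \<in> carrier (ob kernel_lambda_functor P)"
  interpret P: lambda_ab A P l using P lambda_abI[OF inf] by (simp add: Obj_C)
  have "x \<in> carrier P.B" using x by (simp add: kernel_lambda_functor_def carrier_KM P.K_eq P.K_carrier)
  then show "(\<lambda>n\<in>{0<..}. mod_lam (ob kernel_lambda_functor P) n x) = lam P x"
    using P.L_witt_seqs[of x] by (intro witt_seqs_eqI[of _ P.B _ P.B] witt_seqs_restrict) (simp_all add: kernel_lambda_functor_def)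
qed

section \<open>Functors over the square are fully faithful and essentially surjective\<close>

context
  fixes L :: "('u lambda_ab, 'u \<Rightarrow> 'u, ('u, 'u) lambda_module, 'u \<Rightarrow> 'u) cfunctor"
  assumes L: "is_functor \<C> \<D> L" and sq: "square_commutes A l L" and un: "units_agree A l L"
begin

lemma L_ar: "P \<in> Obj \<C> \<Longrightarrow> Q \<in> Obj \<C> \<Longrightarrow> g \<in> Hom \<C> P Q \<Longrightarrow> ar L P Q g = restrict g (ker P)"
  using sq unfolding square_commutes_def functors_equal_def
  by (auto simp: comp_functor_def forget_mod_def kernel_functor_def forget_ab_def kernel_module_def ring_ab.truncate_def)

text \<open>The square gives the underlying module, and \<open>units_agree\<close> gives the
  operations at positive indices on the carrier.\<close>

lemma L_agree:
  assumes P: "P \<in> Obj \<C>" shows "mod_agree (ob L P) (kernel_lambda_module A P)"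
proof -
  have "module.truncate (ob L P) = module.truncate (kernel_lambda_module A P)"
    using sq P unfolding square_commutes_def functors_equal_def truncate_kernel_lambda_module
    by (auto simp: comp_functor_def forget_mod_def kernel_functor_def forget_ab_def)
  moreover have "mod_lam (ob L P) n x = mod_lam (kernel_lambda_module A P) n x" if "n > 0" "x \<in> carrier (ob L P)" for n x
  proof -
    have "(\<lambda>n\<in>{0<..}. mod_lam (ob L P) n x) = lam P x" using un P that by (simp add: units_agree_def)
    from fun_cong[OF this, of n] show ?thesis using that by (simp add: kernel_lambda_module_def)
  qed
  ultimately show ?thesis by (simp add: mod_agree_def)
qed

lemma L_carrier: "P \<in> Obj \<C> \<Longrightarrow> carrier (ob L P) = ker P"
  using mod_agreeD(1)[OF L_agree] by (simp add: carrier_KM)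

lemma ff_L: "ff_functor \<C> (\<lambda>P. carrier (total P)) \<D> carrier L"
proof (intro ff_functor.intro concrete_C concrete_D ff_functor_axioms.intro L)
  interpret D: concrete_cat \<D> carrier by (rule concrete_D)
  fix P Q assume o: "P \<in> Obj \<C>" "Q \<in> Obj \<C>"
  show "g = h" if "g \<in> Hom \<C> P Q" "h \<in> Hom \<C> P Q" "ar L P Q g = ar L P Q h" for g h
    using kernel_restrict_inj[OF inf o[unfolded Obj_C] that(1,2)] that(3) by (simp add: L_ar o that(1,2) ker_eq)
  fix k assume "k \<in> Hom \<D> (ob L P) (ob L Q)"
  then have "k \<in> Hom \<D> (kernel_lambda_module A P) (kernel_lambda_module A Q)"
    using LMod_hom_agree[OF L_agree[OF o(1)] L_agree[OF o(2)]] by simp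
  from kernel_restrict_surj[OF inf o[unfolded Obj_C] this]
  show "\<exists>g\<in>Hom \<C> P Q. ar L P Q g = k" using o by (auto simp: L_ar ker_eq)
next
  interpret D: concrete_cat \<D> carrier by (rule concrete_D)
  fix M assume M: "M \<in> Obj \<D>"
  \<comment> \<open>Essential surjectivity: the kernel of the square-zero extension is isomorphic to
    \<open>M\<close>, and replacing this kernel by the value of \<open>L\<close> leaves the hom-sets
    unchanged.\<close>
  obtain enc :: "'u \<times> 'u \<Rightarrow> 'u" where "inj enc" using infinite_pair_embedding[OF inf] by metis
  then interpret S: sq_ext A l M enc using inf base M by unfold_locales (auto simp: Obj_D)
  have X: "S.ext \<in> Obj \<C>" by (rule S.ext_in_Obj)
  obtain \<theta> \<theta>' where t: "\<theta> \<in> Hom \<D> (kernel_lambda_module A S.ext) M" "\<theta>' \<in> Hom \<D> M (kernel_lambda_module A S.ext)"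
    "\<And>x. x \<in> S.X.K \<Longrightarrow> \<theta>' (\<theta> x) = x" "\<And>x. x \<in> carrier M \<Longrightarrow> \<theta> (\<theta>' x) = x" using S.kernel_ext_iso by metis
  have LX: "ob L S.ext \<in> Obj \<D>" using L X by (simp add: is_functor_def)
  have "is_iso \<D> (ob L S.ext) M \<theta>"
  proof (rule D.is_isoI[OF LX M])
    show "\<theta> \<in> Hom \<D> (ob L S.ext) M" using t(1) LMod_hom_agree[OF L_agree[OF X] mod_agree_refl] by simp
    show "\<theta>' \<in> Hom \<D> M (ob L S.ext)" using t(2) LMod_hom_agree[OF mod_agree_refl L_agree[OF X]] by simp
  qed (use t X in \<open>auto simp: L_carrier S.X.K_eq simp del: S.ext_simps\<close>)
  then show "\<exists>x\<in>Obj \<C>. \<exists>\<theta>. is_iso \<D> (ob L x) M \<theta>" using X by blast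
qed

end

lemma adjunction_over_squareD:
  assumes "is_adjunction_over_square A l P"
  shows "is_adjunction \<C> \<D> P" "is_functor \<C> \<D> (ladj P)" "square_commutes A l (ladj P)" "units_agree A l (ladj P)"
  using assms by (auto simp: is_adjunction_over_square_def is_adjunction_def Let_def)

lemma ff_ladj: "is_adjunction_over_square A l P \<Longrightarrow> ff_functor \<C> (\<lambda>P. carrier (total P)) \<D> carrier (ladj P)"
  by (rule ff_L[OF adjunction_over_squareD(2-4)])

lemma adjunction_over_square_exists: "\<exists>P. is_adjunction_over_square A l P"
proof -
  interpret F: ff_functor \<C> "\<lambda>P. carrier (total P)" \<D> carrier kernel_lambda_functor
    by (rule ff_L[OF functor_kernel_lambda_functor square_kernel_lambda_functor units_kernel_lambda_functor])
  from F.adjunction_exists show ?thesis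
    unfolding is_adjunction_over_square_def using square_kernel_lambda_functor units_kernel_lambda_functor by (metis adj.select_convs(1))
qed

lemma adjunction_over_square_equivalence:
  assumes "is_adjunction_over_square A l P" shows "is_adjoint_equivalence \<C> \<D> P"
proof -
  interpret F: ff_functor \<C> "\<lambda>P. carrier (total P)" \<D> carrier "ladj P" by (rule ff_ladj[OF assms])
  show ?thesis by (rule F.adjoint_equivalence[OF adjunction_over_squareD(1)[OF assms] refl])
qed

section \<open>Comparison of two adjunctions over the square\<close>

context
  fixes P Q
  assumes P: "is_adjunction_over_square A l P" and Q: "is_adjunction_over_square A l Q"
begin

interpretation F: ff_functor \<C> "\<lambda>P. carrier (total P)" \<D> carrier "ladj P" by (rule ff_ladj[OF P])
interpretation F': ff_functor \<C> "\<lambda>P. carrier (total P)" \<D> carrier "ladj Q" by (rule ff_ladj[OF Q])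

abbreviation "F \<equiv> ob (ladj P)"
abbreviation "F' \<equiv> ob (ladj Q)"
abbreviation "G \<equiv> ob (radj P)"
abbreviation "G' \<equiv> ob (radj Q)"
abbreviation "e \<equiv> adj_counit P"
abbreviation "e' \<equiv> adj_counit Q"

lemmas aP = adjunction_over_squareD(1)[OF P] refl[of "ladj P"]
lemmas aQ = adjunction_over_squareD(1)[OF Q] refl[of "ladj Q"]
lemmas sP = adjunction_over_squareD(2-4)[OF P]
lemmas sQ = adjunction_over_squareD(2-4)[OF Q]

lemmas ar_F [simp] = L_ar[OF sP]
lemmas ar_F' [simp] = L_ar[OF sQ]
lemmas car_F [simp] = L_carrier[OF sP]
lemmas car_F' [simp] = L_carrier[OF sQ]
lemmas G_ob [simp] = F.G_ob[OF aP]
lemmas G'_ob [simp] = F'.G_ob[OF aQ]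
lemmas F_ob [simp] = F.F_ob
lemmas F'_ob [simp] = F'.F_ob

lemma F_agree: "x \<in> Obj \<C> \<Longrightarrow> mod_agree (F x) (F' x)"
  using mod_agree_trans[OF L_agree[OF sP] mod_agree_sym[OF L_agree[OF sQ]]] .

text \<open>\<open>F x\<close> and \<open>F' x\<close> may be different records; with equal
  hom-sets, morphisms can nevertheless be composed across the two left adjoints.\<close>

lemma hom_F: "x \<in> Obj \<C> \<Longrightarrow> Hom \<D> (F x) d = Hom \<D> (F' x) d" "x \<in> Obj \<C> \<Longrightarrow> Hom \<D> d (F x) = Hom \<D> d (F' x)"
  using LMod_hom_agree[OF F_agree mod_agree_refl] LMod_hom_agree[OF mod_agree_refl F_agree] by blast+

text \<open>On modules the comparison is the counit of \<open>P\<close> followed by the inverse of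
  the counit of \<open>Q\<close>; fullness lifts it to group objects.\<close>

lemma comparison_exists:
  assumes y: "y \<in> Obj \<D>"
  shows "\<exists>g. g \<in> Hom \<C> (G y) (G' y) \<and> is_iso \<C> (G y) (G' y) g \<and> (\<forall>a\<in>ker (G y). e' y (g a) = e y a)"
proof -
  note o = G_ob[OF y] G'_ob[OF y] y
  obtain i where i: "i \<in> Hom \<D> y (F (G y))" "\<And>a. a \<in> ker (G y) \<Longrightarrow> i (e y a) = a" "\<And>b. b \<in> carrier y \<Longrightarrow> e y (i b) = b"
    and e: "e y \<in> Hom \<D> (F (G y)) y"
    using F.D.is_isoE[OF F.counit_iso[OF aP y]] o by (metis car_F)
  obtain i' where i': "i' \<in> Hom \<D> y (F' (G' y))" "\<And>a. a \<in> ker (G' y) \<Longrightarrow> i' (e' y a) = a" "\<And>b. b \<in> carrier y \<Longrightarrow> e' y (i' b) = b"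
    and e': "e' y \<in> Hom \<D> (F' (G' y)) y"
    using F.D.is_isoE[OF F'.counit_iso[OF aQ y]] o by (metis car_F')
  have ec: "e y a \<in> carrier y" if "a \<in> ker (G y)" for a using F.D.hom_apply[OF e] o that by simp
  have ec': "e' y a \<in> carrier y" if "a \<in> ker (G' y)" for a using F.D.hom_apply[OF e'] o that by simp
  have ic: "i b \<in> ker (G y)" if "b \<in> carrier y" for b using F.D.hom_apply[OF i(1)] o that by simp
  have ic': "i' b \<in> ker (G' y)" if "b \<in> carrier y" for b using F.D.hom_apply[OF i'(1)] o that by simp
  define k where "k = Comp \<D> (F (G y)) y (F (G' y)) i' (e y)"
  define k' where "k' = Comp \<D> (F (G' y)) y (F (G y)) i (e' y)"
  have i'': "i' \<in> Hom \<D> y (F (G' y))" and e'': "e' y \<in> Hom \<D> (F (G' y)) y" using i'(1) e' o by (simp_all add: hom_F)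
  have k: "k \<in> Hom \<D> (F (G y)) (F (G' y))" unfolding k_def
    using o by (intro F.D.comp_closed[OF _ _ _ e i'']) auto
  have k': "k' \<in> Hom \<D> (F (G' y)) (F (G y))" unfolding k'_def
    using o by (intro F.D.comp_closed[OF _ _ _ e'' i(1)]) auto
  have ka: "k a = i' (e y a)" if "a \<in> ker (G y)" for a using that o by (simp add: k_def)
  have ka': "k' a = i (e' y a)" if "a \<in> ker (G' y)" for a using that o by (simp add: k'_def)
  have iso: "is_iso \<D> (F (G y)) (F (G' y)) k"
    using o by (intro F.D.is_isoI[OF _ _ k k']) (auto simp: ka ka' i i' ec ec' ic ic')
  obtain g where g: "g \<in> Hom \<C> (G y) (G' y)" "ar (ladj P) (G y) (G' y) g = k" using F.full[OF o(1,2) k] by blast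
  have gk: "g a = k a" if "a \<in> ker (G y)" for a using g that o by (metis ar_F restrict_apply')
  have "is_iso \<C> (G y) (G' y) g" by (rule F.iso_reflect[OF o(1,2) g(1)]) (simp only: g(2) iso)
  moreover have "\<forall>a\<in>ker (G y). e' y (g a) = e y a" by (simp add: gk ka i' ec)
  ultimately show ?thesis using g(1) by blast
qed

lemma ker_apply: "x \<in> Obj \<C> \<Longrightarrow> y \<in> Obj \<C> \<Longrightarrow> g \<in> Hom \<C> x y \<Longrightarrow> a \<in> ker x \<Longrightarrow> g a \<in> ker y"
  using F.F_apply[of x y g a] by simp

lemma ker_subset: "ker x \<subseteq> carrier (total x)" for x :: "'u lambda_ab"
  by (auto simp: a_kernel_def')

lemma comp_ker: "a \<in> ker x \<Longrightarrow> Comp \<C> x y t g f a = g (f a)" for x :: "'u lambda_ab"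
  using ker_subset[of x] by auto

text \<open>Cancellation of transposes for \<open>Q\<close>, whose left adjoint acts on arrows by
  restriction to kernels.\<close>

lemma comparison_unique:
  assumes y: "y \<in> Obj \<D>" and g: "g \<in> Hom \<C> x (G' y)" "h \<in> Hom \<C> x (G' y)" and x: "x \<in> Obj \<C>"
    and eq: "\<And>a. a \<in> ker x \<Longrightarrow> e' y (g a) = e' y (h a)"
  shows "g = h"
  using assms by (intro F'.transpose_cancel[OF aQ x y g]) simp

lemma counit_apply:
  assumes "y \<in> Obj \<D>" "y' \<in> Obj \<D>" "f \<in> Hom \<D> y y'" "a \<in> ker (G y)"
  shows "e y' (ar (radj P) y y' f a) = f (e y a)"
  using F.e_natural[OF aP assms(1-3), of a] F.G_ar[OF aP assms(1-3)] assms by simp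

lemma counit'_apply:
  assumes "y \<in> Obj \<D>" "y' \<in> Obj \<D>" "f \<in> Hom \<D> y y'" "a \<in> ker (G' y)"
  shows "e' y' (ar (radj Q) y y' f a) = f (e' y a)"
  using F'.e_natural[OF aQ assms(1-3), of a] F'.G_ar[OF aQ assms(1-3)] assms by simp

lemma unique_iso_over_square: "\<exists>!st. iso_over_square A l P Q st"
proof -
  \<comment> \<open>Compatibility with the square leaves no choice for \<open>s\<close>: it must be
    the identity on the common kernel.\<close>
  define s :: "'u lambda_ab \<Rightarrow> 'u \<Rightarrow> 'u" where "s = (\<lambda>x\<in>Obj \<C>. \<lambda>a\<in>ker x. a)"
  define t where "t = (\<lambda>y\<in>Obj \<D>. SOME g. g \<in> Hom \<C> (G y) (G' y) \<and> is_iso \<C> (G y) (G' y) g \<and> (\<forall>a\<in>ker (G y). e' y (g a) = e y a))"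
  have t: "t y \<in> Hom \<C> (G y) (G' y)" "is_iso \<C> (G y) (G' y) (t y)" "\<And>a. a \<in> ker (G y) \<Longrightarrow> e' y (t y a) = e y a"
    if "y \<in> Obj \<D>" for y
    using someI_ex[OF comparison_exists[OF that]] that by (auto simp: t_def)
  have s_id: "s x = Ident \<D> (F x)" "s x = Ident \<D> (F' x)" if "x \<in> Obj \<C>" for x
    using that by (simp_all add: s_def F.D.ident)
  have s_hom: "s x \<in> Hom \<D> (F x) (F' x)" "s x \<in> Hom \<D> (F' x) (F x)" if "x \<in> Obj \<C>" for x
    using F.D.ident_closed[OF F_ob[OF that]] that by (simp_all add: hom_F s_id(1)[symmetric])
  have s_apply: "s x a = a" if "x \<in> Obj \<C>" "a \<in> ker x" for x a using that by (simp add: s_def)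
  have nat_s: "nat_iso \<C> \<D> (ladj P) (ladj Q) s"
    unfolding nat_iso_def nat_trans_def
  proof (intro conjI ballI s_hom)
    show "s \<in> extensional (Obj \<C>)" by (simp add: s_def)
    fix x y f assume o: "x \<in> Obj \<C>" "y \<in> Obj \<C>" "f \<in> Hom \<C> x y"
    show "Comp \<D> (F x) (F y) (F' y) (s y) (ar (ladj P) x y f) = Comp \<D> (F x) (F' x) (F' y) (ar (ladj Q) x y f) (s x)"
      unfolding F.D.comp compose_def using o by (intro restrict_ext) (simp add: s_apply ker_apply)
  next
    fix x assume x: "x \<in> Obj \<C>"
    then show "is_iso \<D> (F x) (F' x) (s x)"
      by (intro F.D.is_isoI[OF _ _ s_hom]) (auto simp: s_apply)
  qed auto
  have nat_t: "nat_iso \<D> \<C> (radj P) (radj Q) t"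
    unfolding nat_iso_def nat_trans_def
  proof (intro conjI ballI t)
    show "t \<in> extensional (Obj \<D>)" by (simp add: t_def)
    fix y y' f assume o: "y \<in> Obj \<D>" "y' \<in> Obj \<D>" "f \<in> Hom \<D> y y'"
    note Gf = F.G_ar[OF aP o] F'.G_ar[OF aQ o]
    show "Comp \<C> (G y) (G y') (G' y') (t y') (ar (radj P) y y' f) = Comp \<C> (G y) (G' y) (G' y') (ar (radj Q) y y' f) (t y)"
    \<comment> \<open>After the counit of \<open>Q\<close>, both composites become \<open>f\<close>
      after the counit of \<open>P\<close>.\<close>
    proof (rule comparison_unique[OF o(2)])
      fix a assume a: "a \<in> ker (G y)"
      have "ar (radj P) y y' f a \<in> ker (G y')" "t y a \<in> ker (G' y)"
        using ker_apply[OF _ _ Gf(1) a] ker_apply[OF _ _ t(1)[OF o(1)] a] o by simp_all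
      then show "e' y' (Comp \<C> (G y) (G y') (G' y') (t y') (ar (radj P) y y' f) a) =
        e' y' (Comp \<C> (G y) (G' y) (G' y') (ar (radj Q) y y' f) (t y) a)"
        using a o by (simp add: comp_ker t counit_apply counit'_apply)
    qed (use o Gf t in \<open>auto intro!: F.C.comp_closed\<close>)
  qed auto
  have adj: "adjunction_iso \<C> \<D> P Q s t"
    unfolding adjunction_iso_def Let_def
  proof (intro conjI ballI nat_s nat_t)
    fix y assume y: "y \<in> Obj \<D>"
    show "Comp \<D> (F (G y)) (F' (G' y)) y (e' y) (Comp \<D> (F (G y)) (F (G' y)) (F' (G' y)) (s (G' y)) (ar (ladj P) (G y) (G' y) (t y))) = e y"
      using y t[OF y] ker_apply[OF _ _ t(1)[OF y]]
      by (intro F.D.hom_eqI[of _ "F (G y)" y])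
        (auto intro!: F.D.comp_closed s_hom F.F_ar F.e_hom[OF aP] F'.e_hom[OF aQ] simp: s_apply simp del: ar_F, auto simp: s_apply)
  next
    fix x assume x: "x \<in> Obj \<C>"
    note o = x F_ob[OF x] F'_ob[OF x]
    note h = F.u_hom[OF aP x] t(1)[OF o(2)] F'.G_ar[OF aQ o(2,3) s_hom(1)[OF x]]
    show "Comp \<C> x (G (F x)) (G' (F' x)) (Comp \<C> (G (F x)) (G' (F x)) (G' (F' x)) (ar (radj Q) (F x) (F' x) (s x)) (t (F x))) (adj_unit P x) = adj_unit Q x"
    \<comment> \<open>Both sides have the same transpose, the identity on the kernel, by the first
      triangle identities of \<open>P\<close> and \<open>Q\<close>.\<close>
    proof (rule comparison_unique[OF o(3) _ _ x])
      show "Comp \<C> x (G (F x)) (G' (F' x)) (Comp \<C> (G (F x)) (G' (F x)) (G' (F' x)) (ar (radj Q) (F x) (F' x) (s x)) (t (F x))) (adj_unit P x)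
        \<in> Hom \<C> x (G' (F' x))"
        using o by (intro F.C.comp_closed[OF _ _ _ h(1) F.C.comp_closed[OF _ _ _ h(2,3)]]) auto
      show "adj_unit Q x \<in> Hom \<C> x (G' (F' x))" by (rule F'.u_hom[OF aQ x])
      fix a assume a: "a \<in> ker x"
      have c: "adj_unit P x a \<in> ker (G (F x))" using ker_apply[OF x _ h(1) a] o by simp
      have d: "t (F x) (adj_unit P x a) \<in> ker (G' (F x))" using ker_apply[OF _ _ h(2) c] o by simp
      have 1: "e (F x) (adj_unit P x a) = a" using F.triangle1[OF aP x, of a] h(1) a x by simp
      have 2: "e' (F' x) (adj_unit Q x a) = a" using F'.triangle1[OF aQ x, of a] F'.u_hom[OF aQ x] a x by simp
      show "e' (F' x) (Comp \<C> x (G (F x)) (G' (F' x)) (Comp \<C> (G (F x)) (G' (F x)) (G' (F' x)) (ar (radj Q) (F x) (F' x) (s x)) (t (F x))) (adj_unit P x) a)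
        = e' (F' x) (adj_unit Q x a)"
        using a c d 1 2 o by (simp add: comp_ker counit'_apply s_hom t s_apply)
    qed
  qed
  have forget: "(ar forget_mod (F x) (F' x) f = Ident (Mod_cat A) (ob (kernel_functor A \<circ>\<^sub>F forget_ab) x)) \<longleftrightarrow> f = (\<lambda>a\<in>ker x. a)" for x f
    by (simp add: forget_mod_def Mod_cat_def comp_functor_def kernel_functor_def forget_ab_def kernel_module_def ring_ab.truncate_def)
  show ?thesis
  proof (rule ex1I)
    show "iso_over_square A l P Q (s, t)"
      unfolding iso_over_square_def split_conv using adj by (auto simp: forget) (simp_all add: s_def)
  next
    fix st assume st: "iso_over_square A l P Q st"
    obtain s' t' where e: "st = (s', t')" by (cases st)
    from st have a: "adjunction_iso \<C> \<D> P Q s' t'" and f: "\<And>x. x \<in> Obj \<C> \<Longrightarrow> s' x = (\<lambda>a\<in>ker x. a)"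
      unfolding e iso_over_square_def split_conv forget by auto
    have n: "nat_trans \<C> \<D> (ladj P) (ladj Q) s'" "nat_trans \<D> \<C> (radj P) (radj Q) t'"
      using a by (auto simp: adjunction_iso_def Let_def nat_iso_def)
    have "s' = s" using f n(1) by (intro extensionalityI[of _ "Obj \<C>"]) (auto simp: s_def nat_trans_def)
    moreover have "t' = t"
    proof (rule extensionalityI[of _ "Obj \<D>"])
      show "t' \<in> extensional (Obj \<D>)" "t \<in> extensional (Obj \<D>)" using n(2) by (auto simp: nat_trans_def t_def)
      fix y assume y: "y \<in> Obj \<D>"
      have t': "t' y \<in> Hom \<C> (G y) (G' y)" using n(2) y by (auto simp: nat_trans_def)
      show "t' y = t y"
      \<comment> \<open>As \<open>s'\<close> is the identity on kernels, compatibility with the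
        counits gives \<open>t' y\<close> the same transpose as \<open>t y\<close>.\<close>
      proof (rule comparison_unique[OF y t' t(1)[OF y] G_ob[OF y]])
        fix b assume b: "b \<in> ker (G y)"
        have "Comp \<D> (F (G y)) (F' (G' y)) y (e' y) (Comp \<D> (F (G y)) (F (G' y)) (F' (G' y)) (s' (G' y)) (ar (ladj P) (G y) (G' y) (t' y))) = e y"
          using a y by (auto simp: adjunction_iso_def Let_def)
        from fun_cong[OF this, of b] have "e' y (t' y b) = e y b"
          using b y t' ker_apply[OF _ _ t' b] by (simp add: f)
        then show "e' y (t' y b) = e' y (t y b)" using t(3)[OF y b] by simp
      qed
    qed
    ultimately show "st = (s, t)" using e by simp
  qed
qed

end

end

theorem proposition2p10:
  fixes A :: "'u ring" and l :: "'u \<Rightarrow> nat \<Rightarrow> 'u"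
  assumes "infinite (UNIV :: 'u set)"
    and "lambda_ring A l"
  shows "(\<exists>P. is_adjunction_over_square A l P) \<and>
    (\<forall>P Q. is_adjunction_over_square A l P \<and> is_adjunction_over_square A l Q \<longrightarrow>
       (\<exists>!st. iso_over_square A l P Q st)) \<and>
    (\<forall>P. is_adjunction_over_square A l P \<longrightarrow>
       is_adjoint_equivalence (LRing_ab_cat A l) (LMod_cat A l) P)"
proof -
  interpret lambda_base A l using assms by unfold_locales
  show ?thesis
    using adjunction_over_square_exists unique_iso_over_square adjunction_over_square_equivalence by blast
qed

end
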